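(* Let $\mathcal{H}=L^2(\mathbb{R}^d)\otimes L^2(\mathbb{R}^d)$, and let $\varphi_1,\varphi_2,\phi_1,\phi_2\in L^2(\mathbb{R}^d)$ be admissible rotation invariant wavelets with $\|\varphi_j\|=\|\phi_j\|=1$, $j=1,2$; put $\vec\varphi=\varphi_1\otimes\varphi_2$ and $\vec\phi=\phi_1\otimes\phi_2$. Let $X=\mathbb{R}^{2d}\times(\mathbb{R}\setminus\{0\})^2$ be equipped with the measure $$d\mu(b,a)=\frac{db_1\,da_1}{|a_1|^{d+1}}\,\frac{db_2\,da_2}{|a_2|^{d+1}},\qquad b=(b_1,b_2)\in\mathbb{R}^d\times\mathbb{R}^d,\ a=(a_1,a_2).$$ If $m\in L^p(X,\mu)$, $1\le p<\infty$, then the operator $M$ on $\mathcal{H}$ weakly defined by $$\langle M\vec f,\vec g\rangle=\int_Xm(b,a)\,\langle\vec f,\pi_{\mathrm{aff}}(b,a)\vec\varphi\rangle\,\langle\pi_{\mathrm{aff}}(b,a)\vec\phi,\vec g\rangle\,d\mu(b,a),\qquad\vec f,\vec g\in\mathcal{H},$$ belongs to the Schatten class $\mathcal{S}_p(\mathcal{H})$.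
   Context: For $b\in\mathbb{R}^d$, $a\in\mathbb{R}\setminus\{0\}$: $\pi_{\mathrm{aff}}(b,a)=T_bD_a$ on $L^2(\mathbb{R}^d)$, where $T_bf(t)=f(t-b)$ and $D_af(t)=|a|^{-d/2}f(t/a)$. On tensors, for $b=(b_1,b_2)$, $a=(a_1,a_2)$: $\pi_{\mathrm{aff}}(b,a)\vec\varphi=\pi_{\mathrm{aff}}(b_1,a_1)\varphi_1\otimes\pi_{\mathrm{aff}}(b_2,a_2)\varphi_2$. A rotation invariant function $g\in L^2(\mathbb{R}^d)$ is an admissible wavelet if $0<\int_{\mathbb{R}^d}\frac{|\hat g(\omega)|^2}{|\omega|^d}\,d\omega<\infty$, where $\hat g(\omega)=\int g(t)e^{-2\pi it\cdot\omega}dt$ (extended to $L^2$). $\mathcal{S}_p(\mathcal{H})$, $1\le p<\infty$, is the class of compact operators on $\mathcal{H}$ whose sequence of singular values belongs to $\ell^p$. *)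

theory Defs
  imports "HOL-Analysis.Analysis"
begin

section \<open>The Hilbert space of square integrable functions\<close>

definition square_integrable :: "('a::euclidean_space \<Rightarrow> complex) \<Rightarrow> bool" where
  "square_integrable f \<longleftrightarrow>
     f \<in> borel_measurable lborel \<and> integrable lborel (\<lambda>x. (cmod (f x))\<^sup>2)"

lemma square_integrable_measurable:
  "square_integrable f \<Longrightarrow> f \<in> borel_measurable borel"
  by (simp add: square_integrable_def)

lemma square_integrable_0: "square_integrable (\<lambda>x. 0)"
  by (simp add: square_integrable_def)

lemma square_integrable_mult_const:
  assumes "square_integrable f"
  shows "square_integrable (\<lambda>x. c * f x)"
  using assms by (auto simp: square_integrable_def norm_mult power_mult_distrib)

lemma square_integrable_add:
  assumes "square_integrable f" "square_integrable g"
  shows "square_integrable (\<lambda>x. f x + g x)"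
proof -
  note [measurable] = assms[THEN square_integrable_measurable]
  have "integrable lborel (\<lambda>x. 2 * (cmod (f x))\<^sup>2 + 2 * (cmod (g x))\<^sup>2)"
    using assms by (auto simp: square_integrable_def)
  then have "integrable lborel (\<lambda>x. (cmod (f x + g x))\<^sup>2)"
  proof (rule Bochner_Integration.integrable_bound)
    show "AE x in lborel. norm ((cmod (f x + g x))\<^sup>2)
        \<le> norm (2 * (cmod (f x))\<^sup>2 + 2 * (cmod (g x))\<^sup>2)"
    proof (rule AE_I2)
      fix x
      have "(cmod (f x + g x))\<^sup>2 \<le> (cmod (f x) + cmod (g x))\<^sup>2"
        by (intro power_mono norm_triangle_ineq) auto
      also have "\<dots> \<le> 2 * (cmod (f x))\<^sup>2 + 2 * (cmod (g x))\<^sup>2"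
        using sum_squares_bound[of "cmod (f x)" "cmod (g x)"]
        by (simp add: power2_sum)
      finally show "norm ((cmod (f x + g x))\<^sup>2) \<le> norm (2 * (cmod (f x))\<^sup>2 + 2 * (cmod (g x))\<^sup>2)"
        by simp
    qed
  qed measurable
  then show ?thesis by (simp add: square_integrable_def)
qed

lemma square_integrable_diff:
  assumes "square_integrable f" "square_integrable g"
  shows "square_integrable (\<lambda>x. f x - g x)"
  using square_integrable_add[OF assms(1) square_integrable_mult_const[OF assms(2), of "-1"]]
  by simp

lemma borel_measurable_cnj [measurable (raw)]:
  "f \<in> borel_measurable M \<Longrightarrow> (\<lambda>x. cnj (f x)) \<in> borel_measurable M"
  by (rule borel_measurable_continuous_on[OF continuous_on_cnj[OF continuous_on_id]]) simp_all

lemma square_integrable_mult_cnj: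
  assumes "square_integrable f" "square_integrable g"
  shows "integrable lborel (\<lambda>x. f x * cnj (g x))"
proof -
  note [measurable] = assms[THEN square_integrable_measurable]
  have "integrable lborel (\<lambda>x. (cmod (f x))\<^sup>2 + (cmod (g x))\<^sup>2)"
    using assms by (auto simp: square_integrable_def)
  then show ?thesis
  proof (rule Bochner_Integration.integrable_bound)
    show "AE x in lborel. norm (f x * cnj (g x)) \<le> norm ((cmod (f x))\<^sup>2 + (cmod (g x))\<^sup>2)"
    proof (rule AE_I2)
      fix x
      have "2 * (cmod (f x) * cmod (g x)) \<le> (cmod (f x))\<^sup>2 + (cmod (g x))\<^sup>2"
        using sum_squares_bound[of "cmod (f x)" "cmod (g x)"] by simp
      moreover have "0 \<le> cmod (f x) * cmod (g x)" by simp
      ultimately have "cmod (f x) * cmod (g x) \<le> (cmod (f x))\<^sup>2 + (cmod (g x))\<^sup>2" by linarith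
      then show "norm (f x * cnj (g x)) \<le> norm ((cmod (f x))\<^sup>2 + (cmod (g x))\<^sup>2)"
        by (simp add: norm_mult)
    qed
  qed measurable
qed

lemma AE_eq_binop:
  assumes "AE x in M. f x = f' x" "AE x in M. g x = g' x"
  shows "AE x in M. h (f x) (g x) = h (f' x) (g' x)"
  using assms by eventually_elim simp

definition l2_eq :: "('a::euclidean_space \<Rightarrow> complex) \<Rightarrow> ('a \<Rightarrow> complex) \<Rightarrow> bool" where
  "l2_eq f g \<longleftrightarrow> square_integrable f \<and> square_integrable g \<and> (AE x in lborel. f x = g x)"

text \<open>Every class of Lebesgue measurable functions modulo null sets has a Borel representative,
  so \<open>'a l2\<close> is the usual space \<open>L\<^sup>2('a)\<close>.\<close>

quotient_type (overloaded) 'a l2 = "'a::euclidean_space \<Rightarrow> complex" / partial: l2_eq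
proof (rule part_equivpI)
  show "\<exists>f. l2_eq f (f :: 'a \<Rightarrow> complex)"
    using square_integrable_0 by (auto simp: l2_eq_def)
  show "symp (l2_eq :: ('a \<Rightarrow> complex) \<Rightarrow> _)"
    by (auto simp: symp_def l2_eq_def elim!: eventually_mono)
  show "transp (l2_eq :: ('a \<Rightarrow> complex) \<Rightarrow> _)"
  proof (rule transpI)
    fix f g h :: "'a \<Rightarrow> complex"
    assume fg: "l2_eq f g" and gh: "l2_eq g h"
    then have "AE x in lborel. f x = g x" "AE x in lborel. g x = h x"
      by (auto simp: l2_eq_def)
    then have "AE x in lborel. f x = h x" by eventually_elim simp
    with fg gh show "l2_eq f h" by (simp add: l2_eq_def)
  qed
qed

lift_definition cinner :: "'a::euclidean_space l2 \<Rightarrow> 'a l2 \<Rightarrow> complex" is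
  "\<lambda>f g. LINT x|lborel. f x * cnj (g x)"
proof -
  fix f f' g g' :: "'a \<Rightarrow> complex"
  assume f: "l2_eq f f'" and g: "l2_eq g g'"
  have [measurable]: "f \<in> borel_measurable borel" "f' \<in> borel_measurable borel"
    "g \<in> borel_measurable borel" "g' \<in> borel_measurable borel"
    using f g by (auto simp: l2_eq_def square_integrable_measurable)
  have "AE x in lborel. f x * cnj (g x) = f' x * cnj (g' x)"
    using f g by (auto simp: l2_eq_def intro: AE_eq_binop[where h = "\<lambda>u v. u * cnj v"])
  then show "(LINT x|lborel. f x * cnj (g x)) = (LINT x|lborel. f' x * cnj (g' x))"
    by (intro integral_cong_AE) measurable
qed

lift_definition scaleC :: "complex \<Rightarrow> 'a::euclidean_space l2 \<Rightarrow> 'a l2" is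
  "\<lambda>c f x. c * f x"
  by (auto simp: l2_eq_def intro: square_integrable_mult_const)

instantiation l2 :: (euclidean_space) real_inner
begin

lift_definition zero_l2 :: "'a l2" is "\<lambda>x. 0"
  by (simp add: l2_eq_def square_integrable_0)

lift_definition plus_l2 :: "'a l2 \<Rightarrow> 'a l2 \<Rightarrow> 'a l2" is "\<lambda>f g x. f x + g x"
  unfolding l2_eq_def by (blast intro: square_integrable_add AE_eq_binop[where h = "(+)"])

lift_definition uminus_l2 :: "'a l2 \<Rightarrow> 'a l2" is "\<lambda>f x. - f x"
  by (auto simp: l2_eq_def square_integrable_def)

lift_definition minus_l2 :: "'a l2 \<Rightarrow> 'a l2 \<Rightarrow> 'a l2" is "\<lambda>f g x. f x - g x"
  unfolding l2_eq_def by (blast intro: square_integrable_diff AE_eq_binop[where h = "(-)"])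

definition "scaleR r f = scaleC (complex_of_real r) f" for f :: "'a l2"
definition "inner f g = Re (cinner f g)" for f g :: "'a l2"
definition "norm f = sqrt (inner f f)" for f :: "'a l2"
definition "sgn f = scaleR (inverse (norm f)) f" for f :: "'a l2"
definition "dist f g = norm (f - g)" for f g :: "'a l2"
definition "(uniformity :: ('a l2 \<times> 'a l2) filter) = (INF e\<in>{0 <..}. principal {(x, y). dist x y < e})"
definition "open U \<longleftrightarrow> (\<forall>x\<in>U. eventually (\<lambda>(x', y). x' = x \<longrightarrow> y \<in> U) uniformity)" for U :: "'a l2 set"

instance
proof
  fix f g h :: "'a l2" and r s :: real
  show "f + g + h = f + (g + h)"
    by transfer (auto simp: l2_eq_def add.assoc intro!: square_integrable_add)
  show "f + g = g + f"
    by transfer (auto simp: l2_eq_def add.commute intro!: square_integrable_add)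
  show "0 + f = f"
    by transfer (auto simp: l2_eq_def)
  show "- f + f = 0"
    by transfer (auto simp: l2_eq_def square_integrable_0)
  show "f - g = f + - g"
    by transfer (auto simp: l2_eq_def square_integrable_diff)
  show "r *\<^sub>R (f + g) = r *\<^sub>R f + r *\<^sub>R g"
    unfolding scaleR_l2_def
    by transfer (auto simp: l2_eq_def distrib_left distrib_right
        intro!: square_integrable_add square_integrable_mult_const)
  show "(r + s) *\<^sub>R f = r *\<^sub>R f + s *\<^sub>R f"
    unfolding scaleR_l2_def
    by transfer (auto simp: l2_eq_def distrib_left distrib_right
        intro!: square_integrable_add square_integrable_mult_const)
  show "r *\<^sub>R s *\<^sub>R f = (r * s) *\<^sub>R f"
    unfolding scaleR_l2_def
    by transfer (auto simp: l2_eq_def mult.assoc intro!: square_integrable_mult_const)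
  show "1 *\<^sub>R f = f"
    unfolding scaleR_l2_def by transfer (auto simp: l2_eq_def)
  show "dist f g = norm (f - g)" by (rule dist_l2_def)
  show "sgn f = inverse (norm f) *\<^sub>R f" by (rule sgn_l2_def)
  show "norm f = sqrt (inner f f)" by (rule norm_l2_def)
  show "(uniformity :: ('a l2 \<times> 'a l2) filter) = (INF e\<in>{0 <..}. principal {(x, y). dist x y < e})"
    by (rule uniformity_l2_def)
  show "open U \<longleftrightarrow> (\<forall>x\<in>U. eventually (\<lambda>(x', y). x' = x \<longrightarrow> y \<in> U) uniformity)" for U :: "'a l2 set"
    by (rule open_l2_def)
  have comm: "cinner f g = cnj (cinner g f)"
  proof transfer
    fix f g :: "'a \<Rightarrow> complex"
    have "(\<lambda>x. f x * cnj (g x)) = (\<lambda>x. cnj (g x * cnj (f x)))"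
      by (simp add: mult.commute)
    then show "(LINT x|lborel. f x * cnj (g x)) = cnj (LINT x|lborel. g x * cnj (f x))"
      by (simp only: Bochner_Integration.integral_cnj)
  qed
  then show "inner f g = inner g f"
    by (simp add: inner_l2_def)
  have add: "cinner (f + g) h = cinner f h + cinner g h"
    by transfer (simp add: l2_eq_def distrib_right square_integrable_mult_cnj)
  then show "inner (f + g) h = inner f h + inner g h"
    by (simp add: inner_l2_def)
  have scale: "cinner (scaleC c f) g = c * cinner f g" for c
    by transfer (simp add: mult.assoc)
  then show "inner (r *\<^sub>R f) g = r * inner f g"
    by (simp add: inner_l2_def scaleR_l2_def)
  have self: "cinner f f = complex_of_real (Re (cinner f f))
      \<and> 0 \<le> Re (cinner f f) \<and> (Re (cinner f f) = 0 \<longrightarrow> f = 0)"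
  proof transfer
    fix f :: "'a \<Rightarrow> complex" assume f: "l2_eq f f"
    have eq: "(LINT x|lborel. f x * cnj (f x)) = complex_of_real (LINT x|lborel. (cmod (f x))\<^sup>2)"
      unfolding complex_norm_square[symmetric] by (rule integral_complex_of_real)
    have "(LINT x|lborel. (cmod (f x))\<^sup>2) = 0 \<Longrightarrow> l2_eq f (\<lambda>x. 0)"
      using f by (subst (asm) integral_nonneg_eq_0_iff_AE)
        (auto simp: l2_eq_def square_integrable_0 square_integrable_def)
    then show "(LINT x|lborel. f x * cnj (f x)) = complex_of_real (Re (LINT x|lborel. f x * cnj (f x)))
      \<and> 0 \<le> Re (LINT x|lborel. f x * cnj (f x))
      \<and> (Re (LINT x|lborel. f x * cnj (f x)) = 0 \<longrightarrow> l2_eq f (\<lambda>x. 0))"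
      unfolding eq by simp
  qed
  have zero: "cinner 0 0 = (0 :: complex)" for h :: "'a l2"
    by transfer simp
  show "0 \<le> inner f f" using self by (simp add: inner_l2_def)
  show "inner f f = 0 \<longleftrightarrow> f = 0"
    using self zero by (auto simp: inner_l2_def)
qed

end

lemma vector_space_l2: "vector_space (scaleC :: complex \<Rightarrow> 'a::euclidean_space l2 \<Rightarrow> 'a l2)"
proof
  fix c d :: complex and f g :: "'a l2"
  show "scaleC c (f + g) = scaleC c f + scaleC c g"
    by transfer (auto simp: l2_eq_def distrib_left
        intro!: square_integrable_add square_integrable_mult_const)
  show "scaleC (c + d) f = scaleC c f + scaleC d f"
    by transfer (auto simp: l2_eq_def distrib_right
        intro!: square_integrable_add square_integrable_mult_const)
  show "scaleC c (scaleC d f) = scaleC (c * d) f"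
    by transfer (auto simp: l2_eq_def mult.assoc intro!: square_integrable_mult_const)
  show "scaleC 1 f = f"
    by transfer (auto simp: l2_eq_def)
qed

section \<open>Tensor products\<close>

text \<open>The Hilbert space tensor product of \<open>L\<^sup>2('a)\<close> and \<open>L\<^sup>2('b)\<close> is realised as
  \<open>L\<^sup>2('a \<times> 'b)\<close>, with \<open>(f \<otimes> g)(x, y) = f(x) g(y)\<close>.  The lemmas \<open>cinner_tensor\<close> and
  \<open>tensor_total\<close> below say that this is a tensor product: inner products of elementary tensors
  factor, and only \<open>0\<close> is orthogonal to all elementary tensors.\<close>

lemma square_integrable_tensor:
  fixes f :: "'a::euclidean_space \<Rightarrow> complex" and g :: "'b::euclidean_space \<Rightarrow> complex"
  assumes "square_integrable f" "square_integrable g"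
  shows "square_integrable (\<lambda>(x, y). f x * g y)"
proof -
  note [measurable] = assms[THEN square_integrable_measurable]
  have "integrable (lborel \<Otimes>\<^sub>M lborel) (\<lambda>(x, y). (cmod (f x))\<^sup>2 * (cmod (g y))\<^sup>2)"
    using assms by (intro lborel_pair.Fubini_integrable)
      (auto simp: square_integrable_def)
  then have "integrable lborel (\<lambda>z. (cmod (case z of (x, y) \<Rightarrow> f x * g y))\<^sup>2)"
    by (simp add: lborel_prod case_prod_unfold norm_mult power_mult_distrib)
  moreover have "(\<lambda>(x, y). f x * g y) \<in> borel_measurable lborel"
    unfolding lborel_prod[symmetric] by measurable
  ultimately show ?thesis
    by (simp add: square_integrable_def)
qed

lift_definition tensor :: "'a::euclidean_space l2 \<Rightarrow> 'b::euclidean_space l2 \<Rightarrow> ('a \<times> 'b) l2"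
  (infixr "\<otimes>\<^sub>2" 75) is "\<lambda>f g (x, y). f x * g y"
  subgoal for f f' g g'
  proof -
    assume f: "l2_eq f f'" and g: "l2_eq g g'"
    have [measurable]: "f \<in> borel_measurable borel" "f' \<in> borel_measurable borel"
      "g \<in> borel_measurable borel" "g' \<in> borel_measurable borel"
      using f g by (auto simp: l2_eq_def square_integrable_measurable)
    have "AE z in lborel \<Otimes>\<^sub>M lborel. f (fst z) = f' (fst z) \<and> g (snd z) = g' (snd z)"
    proof (rule lborel_pair.AE_pair_measure)
      show "{z \<in> space (lborel \<Otimes>\<^sub>M lborel). f (fst z) = f' (fst z) \<and> g (snd z) = g' (snd z)}
          \<in> sets (lborel \<Otimes>\<^sub>M lborel)"
        by measurable
      show "AE x in lborel. AE y in lborel. f (fst (x, y)) = f' (fst (x, y)) \<and> g (snd (x, y)) = g' (snd (x, y))"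
        using f g by (auto simp: l2_eq_def)
    qed
    then have "AE z in (lborel :: ('a \<times> 'b) measure).
        (case z of (x, y) \<Rightarrow> f x * g y) = (case z of (x, y) \<Rightarrow> f' x * g' y)"
      unfolding lborel_prod by (auto simp: case_prod_beta elim: eventually_mono)
    with f g show ?thesis
      by (auto simp: l2_eq_def intro!: square_integrable_tensor)
  qed
  done

lemma cinner_tensor: "cinner (f \<otimes>\<^sub>2 g) (f' \<otimes>\<^sub>2 g') = cinner f f' * cinner g g'"
proof transfer
  fix f f' :: "'a \<Rightarrow> complex" and g g' :: "'b \<Rightarrow> complex"
  assume "l2_eq f f" "l2_eq f' f'" "l2_eq g g" "l2_eq g' g'"
  then have sq: "square_integrable f" "square_integrable f'" "square_integrable g" "square_integrable g'"
    by (auto simp: l2_eq_def)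
  have "integrable (lborel \<Otimes>\<^sub>M lborel) (\<lambda>z. (case z of (x, y) \<Rightarrow> f x * g y) * cnj (case z of (x, y) \<Rightarrow> f' x * g' y))"
    using square_integrable_mult_cnj[OF square_integrable_tensor[OF sq(1,3)] square_integrable_tensor[OF sq(2,4)]]
    by (simp add: lborel_prod)
  from lborel_pair.integral_fst'[OF this]
  have "(LINT z|lborel. (case z of (x, y) \<Rightarrow> f x * g y) * cnj (case z of (x, y) \<Rightarrow> f' x * g' y))
     = (LINT x|lborel. LINT y|lborel. (f x * cnj (f' x)) * (g y * cnj (g' y)))"
    by (simp add: lborel_prod mult_ac)
  then show "(LINT z|lborel. (case z of (x, y) \<Rightarrow> f x * g y) * cnj (case z of (x, y) \<Rightarrow> f' x * g' y))
     = (LINT x|lborel. f x * cnj (f' x)) * (LINT y|lborel. g y * cnj (g' y))"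
    by simp
qed

lemma AE_zero_of_box_integrals_zero:
  fixes u :: "'a::euclidean_space \<Rightarrow> real"
  assumes [measurable]: "u \<in> borel_measurable borel"
    and int: "\<And>a b. set_integrable lborel (box a b) u"
    and zero: "\<And>a b. (LINT x:box a b|lborel. u x) = 0"
  shows "AE x in lborel. u x = 0"
proof -
  let ?M = "density lborel (\<lambda>x. ennreal (u x))" and ?N = "density lborel (\<lambda>x. ennreal (- u x))"
  have box: "emeasure ?M (box a b) = emeasure ?N (box a b)" "emeasure ?M (box a b) \<noteq> \<infinity>" for a b
  proof -
    let ?v = "\<lambda>x. indicator (box a b) x * u x"
    have v: "integrable lborel ?v" "integral\<^sup>L lborel ?v = 0"
      using int[of a b] zero[of a b] by (auto simp: set_integrable_def set_lebesgue_integral_def)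
    have M: "emeasure ?M (box a b) = (\<integral>\<^sup>+ x. ennreal (?v x) \<partial>lborel)"
      by (subst emeasure_density) (auto intro!: nn_integral_cong split: split_indicator)
    have N: "emeasure ?N (box a b) = (\<integral>\<^sup>+ x. ennreal (- ?v x) \<partial>lborel)"
      by (subst emeasure_density) (auto intro!: nn_integral_cong split: split_indicator)
    have fin: "(\<integral>\<^sup>+ x. ennreal (?v x) \<partial>lborel) \<noteq> \<infinity>" "(\<integral>\<^sup>+ x. ennreal (- ?v x) \<partial>lborel) \<noteq> \<infinity>"
      using v(1) by (simp_all add: real_integrable_def)
    have e: "enn2real (\<integral>\<^sup>+ x. ennreal (?v x) \<partial>lborel) = enn2real (\<integral>\<^sup>+ x. ennreal (- ?v x) \<partial>lborel)"
      using v real_lebesgue_integral_def[OF v(1)] by simp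
    have "(\<integral>\<^sup>+ x. ennreal (?v x) \<partial>lborel) = (\<integral>\<^sup>+ x. ennreal (- ?v x) \<partial>lborel)"
      using arg_cong[OF e, of ennreal] fin by (simp add: ennreal_enn2real_if)
    then show "emeasure ?M (box a b) = emeasure ?N (box a b)" "emeasure ?M (box a b) \<noteq> \<infinity>"
      using fin unfolding M N by simp_all
  qed
  have "?M = ?N"
  proof (rule measure_eqI_generator_eq)
    let ?E = "range (\<lambda>(a, b). box a b :: 'a set)"
    show "Int_stable ?E"
      by (auto simp: Int_stable_def box_Int_box)
    show "?E \<subseteq> Pow UNIV" "sets ?M = sigma_sets UNIV ?E" "sets ?N = sigma_sets UNIV ?E"
      by (simp_all add: borel_eq_box sets_lborel)
    let ?A = "\<lambda>n::nat. box (- (real n *\<^sub>R One)) (real n *\<^sub>R One) :: 'a set"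
    show "range ?A \<subseteq> ?E" "(\<Union>i. ?A i) = UNIV"
      unfolding UN_box_eq_UNIV by auto
    show "emeasure ?M (?A i) \<noteq> \<infinity>" for i by (rule box(2))
    show "emeasure ?M X = emeasure ?N X" if "X \<in> ?E" for X
      using that box(1) by auto
  qed
  then have "AE x in lborel. ennreal (u x) = ennreal (- u x)"
    by (subst (asm) sigma_finite_measure.density_unique_iff[OF sigma_finite_lborel]) auto
  then show ?thesis
  proof eventually_elim
    fix x assume "ennreal (u x) = ennreal (- u x)"
    then show "u x = 0"
      by (cases "0 \<le> u x") (auto simp: ennreal_neg ennreal_eq_0_iff)
  qed
qed

lemma square_integrable_indicator_box:
  "square_integrable (\<lambda>x. complex_of_real (indicator (box a b) x))"
proof -
  have "(\<lambda>x. (cmod (complex_of_real (indicator (box a b) x)))\<^sup>2) = (indicator (box a b) :: 'a \<Rightarrow> real)"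
    by (auto simp: indicator_def)
  then show ?thesis
    using emeasure_bounded_finite[OF bounded_box, of a b]
    by (simp add: square_integrable_def integrable_real_indicator)
qed

lemma tensor_total:
  fixes h :: "('a::euclidean_space \<times> 'b::euclidean_space) l2"
  assumes "\<And>f g. cinner h (f \<otimes>\<^sub>2 g) = 0"
  shows "h = 0"
  using assms
proof transfer
  fix h :: "'a \<times> 'b \<Rightarrow> complex"
  assume h: "l2_eq h h"
    and orth: "\<And>f g. l2_eq f f \<Longrightarrow> l2_eq g g \<Longrightarrow>
      (LINT z|lborel. h z * cnj (case z of (x, y) \<Rightarrow> f x * g y)) = 0"
  have sq: "square_integrable h" using h by (simp add: l2_eq_def)
  note [measurable] = square_integrable_measurable[OF sq]
  have box: "integrable lborel (\<lambda>z. h z * complex_of_real (indicator (box p q) z))"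
    "(LINT z|lborel. h z * complex_of_real (indicator (box p q) z)) = 0" for p q
  proof -
    show "integrable lborel (\<lambda>z. h z * complex_of_real (indicator (box p q) z))"
      using square_integrable_mult_cnj[OF sq square_integrable_indicator_box] by simp
    have eq: "(\<lambda>z. cnj (case z of (x, y) \<Rightarrow> complex_of_real (indicator (box (fst p) (fst q)) x)
         * complex_of_real (indicator (box (snd p) (snd q)) y)))
      = (\<lambda>z. complex_of_real (indicator (box p q) z))"
      by (cases p; cases q) (auto simp: fun_eq_iff box_prod indicator_def)
    have "(LINT z|lborel. h z * cnj (case z of (x, y) \<Rightarrow>
         complex_of_real (indicator (box (fst p) (fst q)) x)
         * complex_of_real (indicator (box (snd p) (snd q)) y))) = 0"
      by (rule orth) (simp_all add: l2_eq_def square_integrable_indicator_box)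
    then show "(LINT z|lborel. h z * complex_of_real (indicator (box p q) z)) = 0"
      using eq[THEN fun_cong] by simp
  qed
  have "AE z in lborel. Re (h z) = 0"
  proof (rule AE_zero_of_box_integrals_zero)
    fix p q
    show "set_integrable lborel (box p q) (\<lambda>z. Re (h z))"
      using integrable_Re[OF box(1)[of p q]] by (simp add: set_integrable_def mult.commute)
    show "(LINT z:box p q|lborel. Re (h z)) = 0"
      using integral_Re[OF box(1)[of p q]] box(2)[of p q]
      by (simp add: set_lebesgue_integral_def mult.commute)
  qed measurable
  moreover have "AE z in lborel. Im (h z) = 0"
  proof (rule AE_zero_of_box_integrals_zero)
    fix p q
    show "set_integrable lborel (box p q) (\<lambda>z. Im (h z))"
      using integrable_Im[OF box(1)[of p q]] by (simp add: set_integrable_def mult.commute)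
    show "(LINT z:box p q|lborel. Im (h z)) = 0"
      using integral_Im[OF box(1)[of p q]] box(2)[of p q]
      by (simp add: set_lebesgue_integral_def mult.commute)
  qed measurable
  ultimately have "AE z in lborel. h z = 0"
    by eventually_elim (simp add: complex_eq_iff)
  with sq show "l2_eq h (\<lambda>z. 0)"
    by (simp add: l2_eq_def square_integrable_0)
qed

section \<open>The affine representation\<close>

lemma lborel_affine_substitution:
  fixes t :: "'a::euclidean_space" and c :: real
  assumes c: "c \<noteq> 0"
  shows AE_lborel_affine: "AE x in lborel. P x \<Longrightarrow> AE x in lborel. P (t + c *\<^sub>R x)"
    and square_integrable_affine: "square_integrable f \<Longrightarrow> square_integrable (\<lambda>x. f (t + c *\<^sub>R x))"
proof -
  note eq = lborel_affine[OF c, of t]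
  have k: "ennreal (\<bar>c\<bar> ^ DIM('a)) > 0" using c by simp
  show "AE x in lborel. P (t + c *\<^sub>R x)" if "AE x in lborel. P x"
  proof -
    have "AE x in density (distr lborel borel (\<lambda>x. t + c *\<^sub>R x)) (\<lambda>_. ennreal (\<bar>c\<bar> ^ DIM('a))). P x"
      using that by (simp only: eq[symmetric])
    then have "AE x in distr lborel borel (\<lambda>x. t + c *\<^sub>R x). P x"
      using k by (subst (asm) AE_density) auto
    then show ?thesis
      by (rule AE_distrD[rotated]) measurable
  qed
  show "square_integrable (\<lambda>x. f (t + c *\<^sub>R x))" if f: "square_integrable f"
  proof -
    note [measurable] = square_integrable_measurable[OF f]
    have "integrable (density (distr lborel borel (\<lambda>x. t + c *\<^sub>R x)) (\<lambda>_. ennreal (\<bar>c\<bar> ^ DIM('a))))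
        (\<lambda>x. (cmod (f x))\<^sup>2)"
      using f by (simp only: eq[symmetric] square_integrable_def)
    then have "integrable (distr lborel borel (\<lambda>x. t + c *\<^sub>R x)) (\<lambda>x. \<bar>c\<bar> ^ DIM('a) *\<^sub>R (cmod (f x))\<^sup>2)"
      by (subst (asm) integrable_density) auto
    then have "integrable lborel (\<lambda>x. (cmod (f (t + c *\<^sub>R x)))\<^sup>2)"
      using c by (subst (asm) integrable_distr_eq) auto
    then show ?thesis by (simp add: square_integrable_def)
  qed
qed

lift_definition translate :: "'a::euclidean_space \<Rightarrow> 'a l2 \<Rightarrow> 'a l2" is
  "\<lambda>b f t. f (t - b)"
  subgoal for b f g
    using AE_lborel_affine[of 1 "\<lambda>x. f x = g x" "- b"] square_integrable_affine[of 1 f "- b"]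
      square_integrable_affine[of 1 g "- b"]
    by (simp add: l2_eq_def)
  done

lift_definition dilate :: "real \<Rightarrow> 'a::euclidean_space l2 \<Rightarrow> 'a l2" is
  "\<lambda>a f t. complex_of_real (\<bar>a\<bar> powr (- real DIM('a) / 2)) * f (t /\<^sub>R a)"
  subgoal for a f g
    using AE_lborel_affine[of "inverse a" "\<lambda>x. f x = g x" 0]
      square_integrable_affine[of "inverse a" f 0] square_integrable_affine[of "inverse a" g 0]
    by (cases "a = 0")
      (auto simp: l2_eq_def square_integrable_0 intro!: square_integrable_mult_const)
  done

definition pi_aff :: "'a::euclidean_space \<Rightarrow> real \<Rightarrow> 'a l2 \<Rightarrow> 'a l2" where
  "pi_aff b a f = translate b (dilate a f)"

text \<open>The action on an elementary tensor, given by its two factors.\<close>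

definition pi_aff_tensor ::
  "('a::euclidean_space \<times> 'b::euclidean_space) \<times> (real \<times> real) \<Rightarrow> 'a l2 \<Rightarrow> 'b l2 \<Rightarrow> ('a \<times> 'b) l2"
where
  "pi_aff_tensor = (\<lambda>((b\<^sub>1, b\<^sub>2), (a\<^sub>1, a\<^sub>2)) f\<^sub>1 f\<^sub>2. pi_aff b\<^sub>1 a\<^sub>1 f\<^sub>1 \<otimes>\<^sub>2 pi_aff b\<^sub>2 a\<^sub>2 f\<^sub>2)"

definition aff_measure :: "(('a::euclidean_space \<times> 'b::euclidean_space) \<times> (real \<times> real)) measure" where
  "aff_measure = density
     (restrict_space lborel (UNIV \<times> ((- {0}) \<times> (- {0}))))
     (\<lambda>((b\<^sub>1, b\<^sub>2), (a\<^sub>1, a\<^sub>2)).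
        ennreal (1 / \<bar>a\<^sub>1\<bar> ^ (DIM('a) + 1) * (1 / \<bar>a\<^sub>2\<bar> ^ (DIM('b) + 1))))"

definition weak_multiplier ::
  "(('a::euclidean_space \<times> 'b::euclidean_space) \<times> (real \<times> real) \<Rightarrow> complex) \<Rightarrow>
   'a l2 \<Rightarrow> 'b l2 \<Rightarrow> 'a l2 \<Rightarrow> 'b l2 \<Rightarrow> (('a \<times> 'b) l2 \<Rightarrow> ('a \<times> 'b) l2) \<Rightarrow> bool"
where
  "weak_multiplier m \<phi>\<^sub>1 \<phi>\<^sub>2 \<psi>\<^sub>1 \<psi>\<^sub>2 M \<longleftrightarrow>
     (\<forall>f g. has_bochner_integral aff_measure
        (\<lambda>x. m x * cinner f (pi_aff_tensor x \<phi>\<^sub>1 \<phi>\<^sub>2) * cinner (pi_aff_tensor x \<psi>\<^sub>1 \<psi>\<^sub>2) g)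
        (cinner (M f) g))"

section \<open>Admissible wavelets\<close>

definition fourier :: "('a::euclidean_space \<Rightarrow> complex) \<Rightarrow> 'a \<Rightarrow> complex" where
  "fourier g \<omega> = (LINT t|lborel. g t * exp (- 2 * of_real pi * \<i> * of_real (t \<bullet> \<omega>)))"

text \<open>The graph of the Fourier transform on \<open>L\<^sup>2\<close>: the closure of the graph of the integral
  transform on \<open>L\<^sup>1 \<inter> L\<^sup>2\<close>.  By Plancherel's theorem it is the graph of a function on all
  of \<open>L\<^sup>2\<close>.\<close>

definition is_fourier_transform :: "'a::euclidean_space l2 \<Rightarrow> 'a l2 \<Rightarrow> bool" where
  "is_fourier_transform g h \<longleftrightarrow>
     (\<exists>u :: nat \<Rightarrow> 'a \<Rightarrow> complex.
        (\<forall>n. integrable lborel (u n) \<and> square_integrable (u n) \<and> square_integrable (fourier (u n))) \<and>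
        (\<lambda>n. abs_l2 (u n)) \<longlonglongrightarrow> g \<and> (\<lambda>n. abs_l2 (fourier (u n))) \<longlonglongrightarrow> h)"

lift_definition admissibility_integral :: "'a::euclidean_space l2 \<Rightarrow> ennreal" is
  "\<lambda>h. \<integral>\<^sup>+ \<omega>. ennreal ((cmod (h \<omega>))\<^sup>2 / norm \<omega> ^ DIM('a)) \<partial>lborel"
  by (auto simp: l2_eq_def intro!: nn_integral_cong_AE elim: eventually_mono)

lemma AE_lborel_rotation:
  fixes R :: "real ^ 'n ^ 'n"
  assumes R: "orthogonal_matrix R" and P: "AE x in lborel. P x"
  shows "AE x in lborel. P (R *v x)"
proof -
  from P have "AE x in lebesgue. P x" by (rule AE_completion)
  then have "negligible {x. \<not> P x}"
    unfolding eventually_ae_filter_negligible by (blast intro: negligible_subset)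
  then have "negligible ((*v) (transpose R) ` {x. \<not> P x})"
    by (intro negligible_differentiable_image_negligible linear_imp_differentiable_on)
      simp_all
  moreover have "{x. \<not> P (R *v x)} \<subseteq> (*v) (transpose R) ` {x. \<not> P x}"
  proof
    fix x assume "x \<in> {x. \<not> P (R *v x)}"
    moreover have "x = transpose R *v (R *v x)"
      using R by (simp add: matrix_vector_mul_assoc orthogonal_matrix)
    ultimately show "x \<in> (*v) (transpose R) ` {x. \<not> P x}" by blast
  qed
  ultimately have "AE x in lebesgue. P (R *v x)"
    unfolding eventually_ae_filter_negligible by blast
  then show ?thesis by (simp add: AE_completion_iff)
qed

text \<open>Invariance under the special orthogonal group; in dimension one this is no restriction.\<close>

lift_definition rotation_invariant :: "(real ^ 'n) l2 \<Rightarrow> bool" is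
  "\<lambda>g. \<forall>R :: real ^ 'n ^ 'n. rotation_matrix R \<longrightarrow> (AE t in lborel. g (R *v t) = g t)"
proof -
  have imp: "AE t in lborel. g (R *v t) = g t"
    if "l2_eq f g" "rotation_matrix R" "AE t in lborel. f (R *v t) = f t"
    for f g :: "real ^ 'n \<Rightarrow> complex" and R :: "real ^ 'n ^ 'n"
  proof -
    have "AE t in lborel. f t = g t" using that by (simp add: l2_eq_def)
    moreover from this have "AE t in lborel. f (R *v t) = g (R *v t)"
      by (rule AE_lborel_rotation[rotated]) (use that in \<open>simp add: rotation_matrix_def\<close>)
    ultimately show ?thesis using that(3) by eventually_elim simp
  qed
  fix f g :: "real ^ 'n \<Rightarrow> complex"
  assume fg: "l2_eq f g"
  then have gf: "l2_eq g f" by (auto simp: l2_eq_def elim: eventually_mono)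
  show "(\<forall>R :: real ^ 'n ^ 'n. rotation_matrix R \<longrightarrow> (AE t in lborel. f (R *v t) = f t)) \<longleftrightarrow>
        (\<forall>R :: real ^ 'n ^ 'n. rotation_matrix R \<longrightarrow> (AE t in lborel. g (R *v t) = g t))"
    using imp[OF fg] imp[OF gf] by blast
qed

definition admissible_wavelet :: "(real ^ 'n) l2 \<Rightarrow> bool" where
  "admissible_wavelet g \<longleftrightarrow> rotation_invariant g \<and>
     (\<exists>h. is_fourier_transform g h \<and>
          0 < admissibility_integral h \<and> admissibility_integral h < \<infinity>)"

section \<open>Schatten classes\<close>

definition compact_operator :: "('a::euclidean_space l2 \<Rightarrow> 'a l2) \<Rightarrow> bool" where
  "compact_operator T \<longleftrightarrow>
     Vector_Spaces.linear scaleC scaleC T \<and> compact (closure (T ` cball 0 1))"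

definition cadjoint :: "('a::euclidean_space l2 \<Rightarrow> 'a l2) \<Rightarrow> 'a l2 \<Rightarrow> 'a l2" where
  "cadjoint T = (SOME S. \<forall>f g. cinner (T f) g = cinner f (S g))"

text \<open>The singular values of a compact operator are the square roots of the eigenvalues of \<open>T\<^sup>*T\<close>,
  in decreasing order and repeated according to (complex) multiplicity.  For infinite rank the
  sequence lists exactly the positive singular values; for finite rank these are followed by
  zeros.\<close>

definition singular_value_sequence :: "('a::euclidean_space l2 \<Rightarrow> 'a l2) \<Rightarrow> (nat \<Rightarrow> real) \<Rightarrow> bool" where
  "singular_value_sequence T s \<longleftrightarrow>
     decseq s \<and> (\<forall>n. 0 \<le> s n) \<and>
     (\<forall>\<sigma>>0. finite {n. s n = \<sigma>} \<and>
        card {n. s n = \<sigma>} = vector_space.dim scaleC {f. cadjoint T (T f) = scaleC (of_real (\<sigma>\<^sup>2)) f})"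

definition schatten_class :: "real \<Rightarrow> ('a::euclidean_space l2 \<Rightarrow> 'a l2) set" where
  "schatten_class p = {T. compact_operator T \<and>
     (\<exists>s. singular_value_sequence T s \<and> summable (\<lambda>n. s n powr p))}"

end

(*
  The multiplier is well defined and Schatten as soon as both families of wavelets satisfy a Bessel
  inequality  int |<f, pi(x) phi>|^2 dmu(x) <= C |f|^2.

  Schatten class.  For orthonormal (u_i), (v_i) put w_i(x) = |<u_i, pi(x) phi>| |<pi(x) psi, v_i>|.
  Then |<M u_i, v_i>| <= int |m| w_i, int w_i <= C and sum_i w_i <= 1, so convexity of t^p gives
  sum_i |<M u_i, v_i>|^p <= C^(p-1) int |m|^p.  A bound of this kind for all finite orthonormal
  families forces M to be compact and, applied to eigenvectors of the operator M* M with
  v_i = M u_i / |M u_i|, bounds the sum of the p-th powers of the singular values.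

  Bessel inequality.  For one wavelet g the function b |-> <f, T_b D_a g> is a convolution, so
  Plancherel bounds its L^2 norm by the integral of |f^|^2 |a|^d |g^(a omega)|^2; integrating over a
  leaves |f^|^2 against G(omega) = int |g^(a omega)|^2 da / |a|, which is invariant under dilations
  and, almost everywhere, under rotations, hence bounded by admissibility.  The tensor product
  follows by applying the one-wavelet inequality in each variable.  Constants are not optimised.
*)
theory Submission
  imports Defs "HOL-Probability.Characteristic_Functions"
begin

section \<open>Hilbert space geometry of the square integrable functions\<close>

text \<open>Admissibility gives the transform of a wavelet only as an \<open>L2\<close> limit, and
  rotation invariance only up to a null set that depends on the rotation, so no pointwise radial
  profile is at hand. The bound on \<open>G\<close> is therefore proved in integrated form, against
  continuous nonnegative weights, by averaging over small balls. The weight that occurs is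
  \<open>|fourier f|^2\<close>, which is continuous when \<open>f\<close> is integrable; hence the
  Bessel inequality starts from bounded continuous integrable test functions, and density with
  Fatou's lemma carries it to all of \<open>L2\<close>. Plancherel enters as two one-sided
  estimates, both read off from one Gaussian-regularised identity: \<open>fourier_L2_le\<close> for
  integrable functions, and \<open>L2_le_fourier\<close> for bounded continuous integrable ones,
  such as the coefficients of a test function in the translation variable. On the operator side,
  finite orthonormal systems of maximal size do the work: the diagonal bound limits their length,
  and maximality says that the operator is small off a finite set of vectors, or that an eigenspace
  is exhausted.\<close>

interpretation l2: vector_space "scaleC :: complex \<Rightarrow> 'a::euclidean_space l2 \<Rightarrow> 'a l2"
  by (rule vector_space_l2)

section \<open>Algebra of the complex inner product\<close>

lemma cinner_commute: "cinner f g = cnj (cinner g f)"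
proof transfer
  fix f g :: "'a \<Rightarrow> complex"
  have "(\<lambda>x. f x * cnj (g x)) = (\<lambda>x. cnj (g x * cnj (f x)))"
    by (simp add: mult.commute)
  then show "(LINT x|lborel. f x * cnj (g x)) = cnj (LINT x|lborel. g x * cnj (f x))"
    by (simp only: Bochner_Integration.integral_cnj)
qed

lemma cinner_add_left: "cinner (f + g) h = cinner f h + cinner g h"
  by transfer (simp add: l2_eq_def distrib_right square_integrable_mult_cnj)

lemma cinner_scaleC_left [simp]: "cinner (scaleC c f) g = c * cinner f g"
  by transfer (simp add: mult.assoc)

lemma cinner_add_right: "cinner f (g + h) = cinner f g + cinner f h"
proof -
  have "cinner f (g + h) = cnj (cinner (g + h) f)" by (rule cinner_commute)
  also have "\<dots> = cinner f g + cinner f h"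
    by (simp add: cinner_add_left cinner_commute[symmetric])
  finally show ?thesis .
qed

lemma cinner_scaleC_right [simp]: "cinner f (scaleC c g) = cnj c * cinner f g"
proof -
  have "cinner f (scaleC c g) = cnj (cinner (scaleC c g) f)" by (rule cinner_commute)
  also have "\<dots> = cnj c * cinner f g"
    by (simp add: cinner_commute[symmetric])
  finally show ?thesis .
qed

lemma cinner_zero_left [simp]: "cinner 0 g = 0"
  using cinner_scaleC_left[of 0 0 g] by simp

lemma cinner_zero_right [simp]: "cinner g 0 = 0"
  using cinner_scaleC_right[of g 0 0] by simp

lemma cinner_minus_left [simp]: "cinner (- f) g = - cinner f g"
  using cinner_scaleC_left[of "-1" f g] by simp

lemma cinner_minus_right [simp]: "cinner f (- g) = - cinner f g"
  using cinner_scaleC_right[of f "-1" g] by simp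

lemma cinner_diff_left: "cinner (f - g) h = cinner f h - cinner g h"
  using cinner_add_left[of f "- g" h] by simp

lemma cinner_diff_right: "cinner h (f - g) = cinner h f - cinner h g"
  using cinner_add_right[of h f "- g"] by simp

lemma cinner_sum_left: "cinner (\<Sum>i\<in>I. f i) g = (\<Sum>i\<in>I. cinner (f i) g)"
  by (induction I rule: infinite_finite_induct) (auto simp: cinner_add_left)

lemma cinner_sum_right: "cinner g (\<Sum>i\<in>I. f i) = (\<Sum>i\<in>I. cinner g (f i))"
  by (induction I rule: infinite_finite_induct) (auto simp: cinner_add_right)

lemma scaleR_scaleC: "r *\<^sub>R f = scaleC (complex_of_real r) f"
  by (simp add: scaleR_l2_def)

lemma cinner_self: "cinner f f = complex_of_real ((norm f)\<^sup>2)"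
proof (rule complex_eqI)
  show "Re (cinner f f) = Re (complex_of_real ((norm f)\<^sup>2))"
    using power2_norm_eq_inner[of f] by (simp add: inner_l2_def)
  show "Im (cinner f f) = Im (complex_of_real ((norm f)\<^sup>2))"
    using cinner_commute[of f f] by (simp add: complex_eq_iff)
qed

lemma cinner_eq_zero_iff [simp]: "cinner f f = 0 \<longleftrightarrow> f = 0"
  by (simp add: cinner_self)

lemma norm_scaleC [simp]: "norm (scaleC c f) = cmod c * norm f"
proof -
  have "cinner (scaleC c f) (scaleC c f) = complex_of_real ((cmod c * norm f)\<^sup>2)"
    by (simp add: cinner_self[of f] power_mult_distrib mult_ac complex_norm_square[of c, unfolded of_real_power])
  then have "(norm (scaleC c f))\<^sup>2 = (cmod c * norm f)\<^sup>2"
    unfolding cinner_self of_real_eq_iff .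
  then show ?thesis
    by (simp add: power2_eq_iff_nonneg)
qed

text \<open>A unimodular factor \<open>c\<close> turns \<open>cinner f g\<close> into its modulus,
  so the real inequality for \<open>scaleC c f\<close> and \<open>g\<close> gives the complex
  one.\<close>

lemma cinner_Cauchy_Schwarz: "cmod (cinner f g) \<le> norm f * norm g"
proof (cases "cinner f g = 0")
  case False
  define c where "c = cnj (cinner f g) / cmod (cinner f g)"
  have c: "cmod c = 1" "c * cinner f g = cmod (cinner f g)"
    using False
    by (simp_all add: c_def norm_divide complex_norm_square[symmetric] mult.commute power2_eq_square)
  have "cmod (cinner f g) = inner (scaleC c f) g"
    using c by (simp add: inner_l2_def)
  also have "\<dots> \<le> norm (scaleC c f) * norm g"
    by (rule norm_cauchy_schwarz)
  finally show ?thesis using c by simp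
qed auto

lemma cinner_ext_right:
  assumes "\<And>g. cinner g f = cinner g f'"
  shows "f = f'"
proof -
  have "cinner (f - f') (f - f') = 0"
    by (simp only: cinner_diff_right assms[of "f - f'"] diff_self)
  then show ?thesis by simp
qed

lemma cinner_ext_left:
  assumes "\<And>g. cinner f g = cinner f' g"
  shows "f = f'"
proof -
  have "cinner (f - f') (f - f') = 0"
    by (simp only: cinner_diff_left assms[of "f - f'"] diff_self)
  then show ?thesis by simp
qed

section \<open>Representatives and completeness\<close>

lemma l2_representative:
  obtains f where "square_integrable f" "F = abs_l2 f"
proof -
  have "l2_eq (rep_l2 F) (rep_l2 F)" "abs_l2 (rep_l2 F) = F"
    using Quotient_l2 by (auto simp: Quotient_def)
  then show thesis using that[of "rep_l2 F"] by (auto simp: l2_eq_def)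
qed

lemma l2_eq_refl: "square_integrable f \<Longrightarrow> l2_eq f f"
  by (simp add: l2_eq_def)

lemma abs_l2_eq_iff:
  assumes "square_integrable f" "square_integrable g"
  shows "abs_l2 f = abs_l2 g \<longleftrightarrow> (AE x in lborel. f x = g x)"
proof -
  have "abs_l2 f = abs_l2 g \<longleftrightarrow> l2_eq f g"
    using Quotient_rel[OF Quotient_l2, of f g] assms by (simp add: l2_eq_refl)
  then show ?thesis using assms by (simp add: l2_eq_def)
qed

lemma cinner_abs:
  "square_integrable f \<Longrightarrow> square_integrable g \<Longrightarrow>
    cinner (abs_l2 f) (abs_l2 g) = (LINT x|lborel. f x * cnj (g x))"
  by (simp add: cinner.abs_eq l2_eq_refl)

lemma diff_abs_l2:
  "square_integrable f \<Longrightarrow> square_integrable g \<Longrightarrow> abs_l2 f - abs_l2 g = abs_l2 (\<lambda>x. f x - g x)"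
  by (simp add: minus_l2.abs_eq l2_eq_refl)

lemma norm_abs_l2:
  assumes "square_integrable f"
  shows "ennreal ((norm (abs_l2 f))\<^sup>2) = (\<integral>\<^sup>+x. ennreal ((cmod (f x))\<^sup>2) \<partial>lborel)"
proof -
  have "complex_of_real ((norm (abs_l2 f))\<^sup>2) = complex_of_real (LINT x|lborel. (cmod (f x))\<^sup>2)"
    unfolding cinner_self[symmetric] cinner_abs[OF assms assms] complex_norm_square[symmetric]
    by (rule integral_complex_of_real)
  then have "(norm (abs_l2 f))\<^sup>2 = (LINT x|lborel. (cmod (f x))\<^sup>2)"
    using of_real_eq_iff by blast
  then show ?thesis
    using assms by (simp add: square_integrable_def nn_integral_eq_integral)
qed

lemma square_integrable_iff_nn_integral:
  "square_integrable f \<longleftrightarrow>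
    f \<in> borel_measurable borel \<and> (\<integral>\<^sup>+x. ennreal ((cmod (f x))\<^sup>2) \<partial>lborel) < \<infinity>"
  by (auto simp: square_integrable_def integrable_iff_bounded)

text \<open>The approximating sequences of \<open>is_fourier_transform\<close> converge as classes;
  here that becomes convergence of integrals of representatives, which can be rotated and estimated
  pointwise.\<close>

lemma abs_l2_tendsto_iff:
  assumes "\<And>n. square_integrable (f n)" "square_integrable g"
  shows "(\<lambda>n. abs_l2 (f n)) \<longlonglongrightarrow> abs_l2 g \<longleftrightarrow>
    (\<lambda>n. \<integral>\<^sup>+x. ennreal ((cmod (f n x - g x))\<^sup>2) \<partial>lborel) \<longlonglongrightarrow> 0"
proof -
  let ?d = "\<lambda>n. norm (abs_l2 (f n) - abs_l2 g)"
  have "(\<lambda>n. abs_l2 (f n)) \<longlonglongrightarrow> abs_l2 g \<longleftrightarrow> ?d \<longlonglongrightarrow> 0"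
    unfolding tendsto_norm_zero_iff by (rule LIM_zero_iff[symmetric])
  also have "\<dots> \<longleftrightarrow> (\<lambda>n. (?d n)\<^sup>2) \<longlonglongrightarrow> 0"
  proof
    show "(\<lambda>n. (?d n)\<^sup>2) \<longlonglongrightarrow> 0" if "?d \<longlonglongrightarrow> 0"
      using tendsto_power[OF that, of 2] by simp
    show "?d \<longlonglongrightarrow> 0" if "(\<lambda>n. (?d n)\<^sup>2) \<longlonglongrightarrow> 0"
      using tendsto_real_sqrt[OF that] by simp
  qed
  also have "\<dots> \<longleftrightarrow> (\<lambda>n. ennreal ((?d n)\<^sup>2)) \<longlonglongrightarrow> ennreal 0"
    by (rule tendsto_ennreal_iff[symmetric]) auto
  finally show ?thesis
    using assms by (simp add: diff_abs_l2 norm_abs_l2 square_integrable_diff)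
qed

text \<open>Riesz-Fischer. A subsequence with geometrically small increments converges almost
  everywhere. Fatou's lemma along it bounds \<open>f k - g\<close> by the Cauchy estimate, so the
  pointwise limit is also the norm limit of the whole sequence.\<close>

lemma complete_l2: "complete (UNIV :: 'a::euclidean_space l2 set)"
proof (rule completeI)
  fix F :: "nat \<Rightarrow> 'a l2"
  assume F: "Cauchy F"
  have "\<exists>f. \<forall>n. square_integrable (f n) \<and> F n = abs_l2 (f n)"
    by (rule choice) (metis l2_representative)
  then obtain f where f: "\<And>n. square_integrable (f n)" "\<And>n. F n = abs_l2 (f n)" by blast
  have [measurable]: "f n \<in> borel_measurable borel" for n
    using f by (auto intro: square_integrable_measurable)
  have "\<forall>n. \<exists>N. \<forall>k\<ge>N. \<forall>l\<ge>N. norm (F k - F l) < (1/4)^n"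
    using F by (auto simp: Cauchy_iff)
  then obtain N where N: "\<And>n k l. k \<ge> N n \<Longrightarrow> l \<ge> N n \<Longrightarrow> norm (F k - F l) < (1/4)^n"
    by metis
  define r where "r = rec_nat (N 0) (\<lambda>n m. max (Suc m) (N (Suc n)))"
  have r_Suc: "r (Suc n) = max (Suc (r n)) (N (Suc n))" and r_0: "r 0 = N 0" for n
    by (simp_all add: r_def)
  have mono: "strict_mono r"
    by (rule strict_monoI_Suc) (simp add: r_Suc)
  have rN: "N n \<le> r n" for n
    by (cases n) (simp_all add: r_Suc r_0)
  define d where "d n x = f (r (Suc n)) x - f (r n) x" for n x
  have d_sq: "(\<integral>\<^sup>+x. ennreal ((cmod (d n x))\<^sup>2) \<partial>lborel) \<le> ennreal ((1/16)^n)" for n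
  proof -
    have "norm (F (r (Suc n)) - F (r n)) < (1/4)^n"
      using rN[of n] mono[THEN strict_monoD, of n "Suc n"] by (intro N) auto
    then have "(norm (F (r (Suc n)) - F (r n)))\<^sup>2 \<le> ((1/4)^n)\<^sup>2"
      by (intro power_mono) auto
    also have "((1/4)^n)\<^sup>2 = ((1/16)^n :: real)"
      by (simp add: power2_eq_square power_mult_distrib[symmetric])
    finally have "ennreal ((norm (F (r (Suc n)) - F (r n)))\<^sup>2) \<le> ennreal ((1/16)^n)"
      by (rule ennreal_leI)
    then show ?thesis
      unfolding d_def using f by (simp add: diff_abs_l2 norm_abs_l2 square_integrable_diff)
  qed
  have [measurable]: "d n \<in> borel_measurable borel" for n
    unfolding d_def by measurable
  \<comment> \<open>The weight \<open>4^n\<close> is small against the decay \<open>(1/16)^n\<close>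
    of the integrals, so the sum is integrable; it is large enough that finiteness at
    \<open>x\<close> forces \<open>cmod (d n x)\<close> to decay like \<open>(1/2)^n\<close>, which
    is summable.\<close>
  have "(\<integral>\<^sup>+x. (\<Sum>n. ennreal (4^n * (cmod (d n x))\<^sup>2)) \<partial>lborel)
      = (\<Sum>n. ennreal (4^n) * (\<integral>\<^sup>+x. ennreal ((cmod (d n x))\<^sup>2) \<partial>lborel))"
    by (subst nn_integral_suminf) (auto simp: ennreal_mult nn_integral_cmult)
  also have "\<dots> \<le> (\<Sum>n. ennreal ((1/4)^n))"
  proof (intro suminf_le summableI)
    fix n
    have "ennreal (4^n) * (\<integral>\<^sup>+x. ennreal ((cmod (d n x))\<^sup>2) \<partial>lborel) \<le> ennreal (4^n) * ennreal ((1/16)^n)"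
      by (intro mult_left_mono d_sq) auto
    also have "\<dots> = ennreal ((1/4)^n)"
      by (simp add: ennreal_mult[symmetric] power_mult_distrib[symmetric])
    finally show "ennreal (4^n) * (\<integral>\<^sup>+x. ennreal ((cmod (d n x))\<^sup>2) \<partial>lborel) \<le> ennreal ((1/4)^n)" .
  qed
  also have "\<dots> < \<infinity>"
    by (subst suminf_ennreal2) (auto intro: summable_geometric)
  finally have "AE x in lborel. (\<Sum>n. ennreal (4^n * (cmod (d n x))\<^sup>2)) \<noteq> \<infinity>"
    by (intro nn_integral_PInf_AE) auto
  then have conv: "AE x in lborel. convergent (\<lambda>n. f (r n) x)"
  proof eventually_elim
    fix x assume fin: "(\<Sum>n. ennreal (4^n * (cmod (d n x))\<^sup>2)) \<noteq> \<infinity>"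
    then have "summable (\<lambda>n. 4^n * (cmod (d n x))\<^sup>2)"
      by (intro summable_suminf_not_top) auto
    then have "bounded (range (\<lambda>n. 4^n * (cmod (d n x))\<^sup>2))"
      by (intro convergent_imp_bounded[OF summable_LIMSEQ_zero])
    then obtain B where B: "\<And>n. 4^n * (cmod (d n x))\<^sup>2 \<le> B"
      by (auto simp: bounded_iff)
    have "cmod (d n x) \<le> sqrt B * (1/2)^n" for n
    proof -
      have "(2^n * cmod (d n x))\<^sup>2 \<le> B"
      proof -
        have "(2^n)\<^sup>2 = (4^n :: real)"
          by (simp add: power2_eq_square power_mult_distrib[symmetric])
        then show ?thesis using B[of n] by (simp add: power_mult_distrib)
      qed
      then have "2^n * cmod (d n x) \<le> sqrt B"
        by (rule real_le_rsqrt)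
      then show ?thesis by (simp add: power_divide field_simps)
    qed
    note d_le = this
    have "summable (\<lambda>n. d n x)"
      by (rule summable_comparison_test'[OF summable_mult[OF summable_geometric] d_le]) simp
    then have "convergent (\<lambda>n. \<Sum>k<n. d k x)"
      by (simp add: summable_iff_convergent)
    then have "convergent (\<lambda>n. f (r 0) x + (\<Sum>k<n. d k x))"
      by (rule convergent_add[OF convergent_const])
    moreover have "f (r 0) x + (\<Sum>k<n. d k x) = f (r n) x" for n
      unfolding d_def by (subst sum_lessThan_telescope) simp
    ultimately show "convergent (\<lambda>n. f (r n) x)" by simp
  qed
  define g where "g x = lim (\<lambda>n. f (r n) x)" for x
  have [measurable]: "g \<in> borel_measurable borel"
    unfolding g_def by measurable
  have lim: "AE x in lborel. (\<lambda>n. f (r n) x) \<longlonglongrightarrow> g x"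
    using conv unfolding g_def by eventually_elim (rule convergent_LIMSEQ_iff[THEN iffD1])
  have est: "(\<integral>\<^sup>+x. ennreal ((cmod (f k x - g x))\<^sup>2) \<partial>lborel) \<le> ennreal (((1/4)^n)\<^sup>2)" if k: "k \<ge> N n" for k n
  proof -
    have "(\<integral>\<^sup>+x. ennreal ((cmod (f k x - g x))\<^sup>2) \<partial>lborel)
        = (\<integral>\<^sup>+x. liminf (\<lambda>m. ennreal ((cmod (f k x - f (r m) x))\<^sup>2)) \<partial>lborel)"
    proof (rule nn_integral_cong_AE)
      show "AE x in lborel. ennreal ((cmod (f k x - g x))\<^sup>2)
          = liminf (\<lambda>m. ennreal ((cmod (f k x - f (r m) x))\<^sup>2))"
        using lim
      proof eventually_elim
        fix x assume "(\<lambda>n. f (r n) x) \<longlonglongrightarrow> g x"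
        then have "(\<lambda>m. ennreal ((cmod (f k x - f (r m) x))\<^sup>2)) \<longlonglongrightarrow> ennreal ((cmod (f k x - g x))\<^sup>2)"
          by (intro tendsto_ennrealI tendsto_power tendsto_norm tendsto_diff tendsto_const)
        then show "ennreal ((cmod (f k x - g x))\<^sup>2)
          = liminf (\<lambda>m. ennreal ((cmod (f k x - f (r m) x))\<^sup>2))"
          by (rule lim_imp_Liminf[symmetric, OF trivial_limit_sequentially])
      qed
    qed
    also have "\<dots> \<le> liminf (\<lambda>m. \<integral>\<^sup>+x. ennreal ((cmod (f k x - f (r m) x))\<^sup>2) \<partial>lborel)"
      by (rule nn_integral_liminf) measurable
    also have "\<dots> \<le> ennreal (((1/4)^n)\<^sup>2)"
    proof (rule Liminf_le)
      show "\<forall>\<^sub>F m in sequentially. (\<integral>\<^sup>+x. ennreal ((cmod (f k x - f (r m) x))\<^sup>2) \<partial>lborel) \<le> ennreal (((1/4)^n)\<^sup>2)"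
      proof (rule eventually_sequentiallyI)
        fix m assume "m \<ge> n"
        then have "N n \<le> r m"
          using rN[of n] mono[THEN strict_mono_mono, THEN monoD, of n m] by simp
        then have "(norm (F k - F (r m)))\<^sup>2 \<le> ((1/4)^n)\<^sup>2"
          using N[of n k "r m"] k by (intro power_mono) auto
        then show "(\<integral>\<^sup>+x. ennreal ((cmod (f k x - f (r m) x))\<^sup>2) \<partial>lborel) \<le> ennreal (((1/4)^n)\<^sup>2)"
          using f by (simp add: diff_abs_l2 norm_abs_l2[symmetric] square_integrable_diff ennreal_leI)
      qed
    qed simp
    finally show ?thesis .
  qed
  have sq: "square_integrable g"
  proof -
    have "square_integrable (\<lambda>x. f (N 0) x - g x)"
      using le_less_trans[OF est[of 0 "N 0"]] by (simp add: square_integrable_iff_nn_integral)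
    then have "square_integrable (\<lambda>x. f (N 0) x - (f (N 0) x - g x))"
      by (rule square_integrable_diff[OF f(1)])
    then show ?thesis by simp
  qed
  have "F \<longlonglongrightarrow> abs_l2 g"
  proof (rule LIMSEQ_I)
    fix e :: real assume "e > 0"
    then obtain n where n: "(1/4)^n < e"
      using real_arch_pow_inv[of e "1/4"] by auto
    show "\<exists>no. \<forall>k\<ge>no. norm (F k - abs_l2 g) < e"
    proof (intro exI allI impI)
      fix k assume "k \<ge> N n"
      then have "(norm (F k - abs_l2 g))\<^sup>2 \<le> ((1/4)^n)\<^sup>2"
        using est[of n k] f sq
        by (simp add: diff_abs_l2 norm_abs_l2[symmetric] square_integrable_diff ennreal_le_iff)
      then have "norm (F k - abs_l2 g) \<le> (1/4)^n"
        by (rule power2_le_imp_le) simp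
      with n show "norm (F k - abs_l2 g) < e" by simp
    qed
  qed
  then show "\<exists>l\<in>UNIV. F \<longlonglongrightarrow> l" by blast
qed

text \<open>The representing vector minimises \<open>J\<close> over \<open>S\<close>. The
  parallelogram identity makes a minimising sequence Cauchy, and the first variation of
  \<open>J\<close> at the minimum is the claimed identity. Working on a complete subspace covers
  both the representation of functionals on the whole space and orthogonal projection.\<close>

lemma Riesz_representation_on_complete_subspace:
  fixes S :: "'a::real_inner set" and l :: "'a \<Rightarrow> real"
  assumes S: "complete S" "subspace S"
    and l: "linear l" and bound: "\<And>x. \<bar>l x\<bar> \<le> K * norm x"
  shows "\<exists>z\<in>S. \<forall>x\<in>S. l x = inner x z"
proof -
  interpret l: linear l by (rule l)
  define J where "J x = (norm x)\<^sup>2 / 2 - l x" for x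
  have J_ge: "J x \<ge> - K\<^sup>2 / 2" for x
  proof -
    have "l x \<le> K * norm x" using bound[of x] by simp
    moreover have "0 \<le> (norm x - K)\<^sup>2" by simp
    ultimately show ?thesis by (simp add: J_def power2_eq_square algebra_simps)
  qed
  define i where "i = Inf (J ` S)"
  have bdd: "bdd_below (J ` S)" using J_ge by (auto intro!: bdd_belowI)
  have i_le: "i \<le> J x" if "x \<in> S" for x
    unfolding i_def using that bdd by (intro cInf_lower) auto
  have "0 \<in> S" using S(2) by (rule subspace_0)
  then have "\<exists>x\<in>S. J x < i + 1 / Suc n" for n
    using cInf_lessD[of "J ` S" "i + 1 / Suc n"] by (auto simp: i_def)
  then obtain x where x: "\<And>n. x n \<in> S" "\<And>n. J (x n) < i + 1 / Suc n"
    by metis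
  have near: "(norm (u - v))\<^sup>2 \<le> 4 * (J u - i) + 4 * (J v - i)" if "u \<in> S" "v \<in> S" for u v
  proof -
    have "(1/2) *\<^sub>R (u + v) \<in> S"
      using S(2) that by (intro subspace_mul subspace_add)
    from i_le[OF this] have "i \<le> J ((1/2) *\<^sub>R (u + v))" .
    moreover have "J u + J v = 2 * J ((1/2) *\<^sub>R (u + v)) + (norm (u - v))\<^sup>2 / 4"
      by (simp add: J_def l.add l.scale power_divide power2_norm_eq_inner)
        (simp add: inner_simps inner_commute field_simps)
    ultimately show ?thesis by (simp add: field_simps)
  qed
  have "Cauchy x"
  proof (rule CauchyI)
    fix e :: real assume e: "e > 0"
    then obtain N where N: "inverse (real (Suc N)) < e\<^sup>2 / 8"
      using reals_Archimedean[of "e\<^sup>2 / 8"] by auto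
    have "norm (x m - x n) < e" if "m \<ge> N" "n \<ge> N" for m n
    proof -
      have "1 / real (Suc m) \<le> 1 / real (Suc N)" "1 / real (Suc n) \<le> 1 / real (Suc N)"
        using that by (auto simp: frac_le)
      then have "(norm (x m - x n))\<^sup>2 < e\<^sup>2"
        using near[OF x(1) x(1), of m n] x(2)[of m] x(2)[of n] N
        by (simp add: inverse_eq_divide)
      then show ?thesis using e by (simp add: power2_less_imp_less)
    qed
    then show "\<exists>M. \<forall>m\<ge>M. \<forall>n\<ge>M. norm (x m - x n) < e" by blast
  qed
  then obtain z where z: "z \<in> S" "x \<longlonglongrightarrow> z"
    using S(1) x(1) by (auto simp: complete_def)
  have "bounded_linear l"
    using bound by (intro bounded_linear_intro[where K = K])
      (simp_all add: l.add l.scale mult.commute)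
  then have "(\<lambda>n. l (x n)) \<longlonglongrightarrow> l z"
    using z(2) by (rule bounded_linear.tendsto)
  then have "(\<lambda>n. J (x n)) \<longlonglongrightarrow> J z"
    unfolding J_def using z(2) by (intro tendsto_intros) auto
  moreover have "(\<lambda>n. i + 1 / Suc n) \<longlonglongrightarrow> i + 0"
    using LIMSEQ_inverse_real_of_nat
    by (intro tendsto_add tendsto_const) (simp add: inverse_eq_divide)
  ultimately have "J z \<le> i + 0"
    by (rule LIMSEQ_le) (use x(2) less_imp_le in blast)
  then have min: "J z \<le> J y" if "y \<in> S" for y
    using i_le[OF that] by simp
  show ?thesis
  proof (intro bexI[OF _ z(1)] ballI)
    fix y assume y: "y \<in> S"
    define c where "c = inner y z - l y"
    \<comment> \<open>The step \<open>t\<close> minimises \<open>t * c + t^2 * q / 2\<close>; the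
      summand 1 keeps \<open>q\<close> positive also when \<open>y = 0\<close>.\<close>
    define q where "q = 1 + (norm y)\<^sup>2"
    define t where "t = - c / q"
    have pos: "q > 0" by (simp add: q_def add_pos_nonneg)
    have "z + t *\<^sub>R y \<in> S" using S(2) z(1) y by (intro subspace_add subspace_mul)
    from min[OF this] have "0 \<le> t * c + t\<^sup>2 * (norm y)\<^sup>2 / 2"
      by (simp add: J_def l.add l.scale c_def power2_norm_eq_inner)
        (simp add: inner_simps inner_commute power2_eq_square algebra_simps)
    also have "\<dots> \<le> t * c + t\<^sup>2 * q / 2"
      by (simp add: q_def algebra_simps)
    also have "\<dots> = - c\<^sup>2 / (2 * q)"
      using pos unfolding t_def by (simp add: field_simps power2_eq_square)
    finally have "c\<^sup>2 \<le> 0" using pos by (simp add: divide_simps split: if_splits)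
    then show "l y = inner y z" by (simp add: c_def)
  qed
qed

text \<open>The real Riesz representation handles \<open>Re (B f)\<close>. Multiplying the argument
  by the imaginary unit multiplies \<open>B f\<close> by its conjugate, so real parts there are the
  imaginary parts of \<open>B f\<close>.\<close>

lemma sesquilinear_form_representation:
  fixes B :: "'a::euclidean_space l2 \<Rightarrow> complex"
  assumes add: "\<And>f g. B (f + g) = B f + B g"
    and scale: "\<And>c f. B (scaleC c f) = cnj c * B f"
    and bound: "\<And>f. cmod (B f) \<le> K * norm f"
  shows "\<exists>z. \<forall>f. B f = cinner z f"
proof -
  have "\<exists>z\<in>UNIV. \<forall>f\<in>UNIV. Re (B f) = inner f z"
  proof (rule Riesz_representation_on_complete_subspace[where K = K])
    show "linear (\<lambda>f. Re (B f))"
      by (rule linearI) (simp_all add: add scale scaleR_scaleC)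
    show "\<And>f. \<bar>Re (B f)\<bar> \<le> K * norm f"
      by (rule order_trans[OF abs_Re_le_cmod bound])
  qed (use complete_l2 in auto)
  then obtain z where z': "\<And>f. Re (B f) = inner f z" by blast
  have z: "Re (B f) = Re (cinner z f)" for f
    using z'[of f] inner_commute[of f z] by (simp add: inner_l2_def)
  have "Im (B f) = Im (cinner z f)" for f
    using z[of "scaleC \<i> f"] by (simp add: scale)
  with z show ?thesis by (intro exI[of _ z]) (simp add: complex_eq_iff)
qed

lemma subspace_closure_real_normed:
  fixes S :: "'a::real_normed_vector set"
  assumes "subspace S"
  shows "subspace (closure S)"
  unfolding subspace_def
proof (intro conjI ballI allI)
  show "0 \<in> closure S"
    using subspace_0[OF assms] closure_subset by blast
  fix x assume "x \<in> closure S"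
  then obtain u where u: "\<And>n. u n \<in> S" "u \<longlonglongrightarrow> x" by (auto simp: closure_sequential)
  show "c *\<^sub>R x \<in> closure S" for c
    unfolding closure_sequential
    by (intro exI[of _ "\<lambda>n. c *\<^sub>R u n"])
      (use u assms in \<open>auto intro: subspace_scale tendsto_scaleR[OF tendsto_const]\<close>)
  fix y assume "y \<in> closure S"
  then obtain v where v: "\<And>n. v n \<in> S" "v \<longlonglongrightarrow> y" by (auto simp: closure_sequential)
  show "x + y \<in> closure S"
    unfolding closure_sequential
    by (intro exI[of _ "\<lambda>n. u n + v n"])
      (use u v assms in \<open>auto intro: subspace_add tendsto_add\<close>)
qed

text \<open>Representing \<open>inner x f\<close> on the complete subspace \<open>closure S\<close>
  produces the orthogonal projection \<open>z\<close> of \<open>f\<close>. The difference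
  \<open>f - z\<close> is orthogonal to \<open>S\<close>, hence zero.\<close>

lemma dense_if_orthogonal_trivial:
  fixes S :: "'a::euclidean_space l2 set"
  assumes S: "subspace S" and orth: "\<And>h. (\<And>s. s \<in> S \<Longrightarrow> inner s h = 0) \<Longrightarrow> h = 0"
  shows "closure S = UNIV"
proof -
  have "f \<in> closure S" for f
  proof -
    have "\<exists>z\<in>closure S. \<forall>x\<in>closure S. inner x f = inner x z"
    proof (rule Riesz_representation_on_complete_subspace[where K = "norm f"])
      show "complete (closure S)"
        using complete_closed_subset[OF closed_closure subset_UNIV complete_l2] .
      show "linear (\<lambda>x. inner x f)"
        by (rule linearI) (simp_all add: inner_simps)
      show "\<bar>inner x f\<bar> \<le> norm f * norm x" for x
        using Cauchy_Schwarz_ineq2[of x f] by (simp add: mult.commute)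
    qed (rule subspace_closure_real_normed[OF S])
    then obtain z where z: "z \<in> closure S" "\<And>x. x \<in> closure S \<Longrightarrow> inner x f = inner x z" by blast
    have "inner s (f - z) = 0" if "s \<in> S" for s
      using z(2)[OF subsetD[OF closure_subset that]] by (simp only: inner_diff_right diff_self)
    then have "f - z = 0" by (rule orth)
    with z show ?thesis by simp
  qed
  then show ?thesis by blast
qed

section \<open>Operators with p-summable diagonals\<close>

text \<open>A family instead of a set, so that one finite set of vectors can index both itself,
  through \<open>\<lambda>u. u\<close>, and a second orthonormal system paired with it.\<close>

definition orthonormal_on :: "'i set \<Rightarrow> ('i \<Rightarrow> 'a::euclidean_space l2) \<Rightarrow> bool" where
  "orthonormal_on I v \<longleftrightarrow> (\<forall>i\<in>I. \<forall>j\<in>I. cinner (v i) (v j) = (if i = j then 1 else 0))"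

lemma orthonormal_on_insert:
  assumes "orthonormal_on I v" "\<And>j. j \<in> I \<Longrightarrow> v' j = v j"
    and "cinner (v' i) (v' i) = 1" "\<And>j. j \<in> I \<Longrightarrow> cinner (v' i) (v j) = 0"
  shows "orthonormal_on (insert i I) v'"
proof -
  have "cinner (v j) (v' i) = 0" if "j \<in> I" for j
    using assms(4)[OF that] cinner_commute[of "v j" "v' i"] by simp
  then show ?thesis
    using assms unfolding orthonormal_on_def by (metis insert_iff)
qed

lemma orthonormal_expansion:
  fixes f :: "'a::euclidean_space l2"
  assumes I: "finite I" "orthonormal_on I v"
  defines "q \<equiv> f - (\<Sum>i\<in>I. scaleC (cinner f (v i)) (v i))"
  shows orthonormal_remainder_orthogonal: "\<And>j. j \<in> I \<Longrightarrow> cinner q (v j) = 0"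
    and orthonormal_remainder_norm: "(norm q)\<^sup>2 = (norm f)\<^sup>2 - (\<Sum>i\<in>I. (cmod (cinner f (v i)))\<^sup>2)"
    and Bessel_inequality: "(\<Sum>i\<in>I. (cmod (cinner f (v i)))\<^sup>2) \<le> (norm f)\<^sup>2"
proof -
  let ?p = "\<Sum>i\<in>I. scaleC (cinner f (v i)) (v i)"
  show orth: "cinner q (v j) = 0" if j: "j \<in> I" for j
  proof -
    have "cinner ?p (v j) = (\<Sum>i\<in>I. if i = j then cinner f (v i) else 0)"
      unfolding cinner_sum_left using I(2) j by (intro sum.cong) (auto simp: orthonormal_on_def)
    also have "\<dots> = cinner f (v j)"
      using I(1) j by (simp add: sum.delta)
    finally show ?thesis by (simp add: q_def cinner_diff_left)
  qed
  have "cinner q ?p = 0"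
    using orth by (simp add: cinner_sum_right)
  then have "cinner q q = cinner q f"
    by (simp add: q_def cinner_diff_right)
  also have "\<dots> = cinner f f - (\<Sum>i\<in>I. cinner f (v i) * cinner (v i) f)"
    by (simp add: q_def cinner_diff_left cinner_sum_left)
  also have "(\<Sum>i\<in>I. cinner f (v i) * cinner (v i) f)
      = complex_of_real (\<Sum>i\<in>I. (cmod (cinner f (v i)))\<^sup>2)"
  proof -
    have "cinner f (v i) * cinner (v i) f = complex_of_real ((cmod (cinner f (v i)))\<^sup>2)" for i
      by (subst cinner_commute[of "v i" f]) (rule complex_norm_square[symmetric])
    then show ?thesis by simp
  qed
  finally show norm: "(norm q)\<^sup>2 = (norm f)\<^sup>2 - (\<Sum>i\<in>I. (cmod (cinner f (v i)))\<^sup>2)"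
    unfolding cinner_self of_real_diff[symmetric] of_real_eq_iff .
  have "0 \<le> (norm q)\<^sup>2" by simp
  with norm show "(\<Sum>i\<in>I. (cmod (cinner f (v i)))\<^sup>2) \<le> (norm f)\<^sup>2" by linarith
qed

lemma normalized_vector:
  fixes f :: "'a::euclidean_space l2"
  assumes "f \<noteq> 0"
  shows "cinner (scaleC (1 / norm f) f) (scaleC (1 / norm f) f) = 1"
  using assms by (simp add: cinner_self norm_divide power2_eq_square)

lemma cinner_self_eq_1_iff: "cinner u u = 1 \<longleftrightarrow> norm u = 1"
proof -
  have "cinner u u = 1 \<longleftrightarrow> complex_of_real ((norm u)\<^sup>2) = complex_of_real 1"
    by (simp only: cinner_self of_real_1)
  also have "\<dots> \<longleftrightarrow> (norm u)\<^sup>2 = 1" by (rule of_real_eq_iff)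
  also have "\<dots> \<longleftrightarrow> norm u = 1" by (simp add: abs_square_eq_1)
  finally show ?thesis .
qed

text \<open>The conclusion compares orthogonal complements in place of spans.
  \<open>compact_M\<close> uses it in this form: smallness of the operator is known on the
  complement of \<open>V\<close>, while finite expansions are available for
  \<open>E\<close>.\<close>

lemma Gram_Schmidt:
  fixes V :: "'a::euclidean_space l2 set"
  assumes "finite V"
  shows "\<exists>E. finite E \<and> orthonormal_on E (\<lambda>e. e)
    \<and> (\<forall>u. (\<forall>e\<in>E. cinner u e = 0) \<longrightarrow> (\<forall>w\<in>V. cinner u w = 0))"
  using assms
proof (induction V)
  case empty
  show ?case by (intro exI[of _ "{}"]) (simp add: orthonormal_on_def)
next
  case (insert w V)
  then obtain E where E: "finite E" "orthonormal_on E (\<lambda>e. e)"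
    and E_V: "\<forall>u. (\<forall>e\<in>E. cinner u e = 0) \<longrightarrow> (\<forall>w\<in>V. cinner u w = 0)"
    by blast
  define q where "q = w - (\<Sum>e\<in>E. scaleC (cinner w e) e)"
  define E' where "E' = (if q = 0 then E else insert (scaleC (1 / norm q) q) E)"
  have w: "w = q + (\<Sum>e\<in>E. scaleC (cinner w e) e)" by (simp add: q_def)
  have "cinner q e = 0" if "e \<in> E" for e
    unfolding q_def by (rule orthonormal_remainder_orthogonal[OF E(1,2) that])
  then have "orthonormal_on (insert (scaleC (1 / norm q) q) E) (\<lambda>e. e)" if "q \<noteq> 0"
    by (intro orthonormal_on_insert[OF E(2)] normalized_vector that) simp_all
  then have E'_on: "orthonormal_on E' (\<lambda>e. e)"
    using E(2) by (simp add: E'_def)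
  have E'_V: "cinner u w' = 0" if u: "\<forall>e\<in>E'. cinner u e = 0" and w': "w' \<in> insert w V" for u w'
  proof (cases "w' = w")
    case True
    have "cinner u q = 0"
      using u by (cases "q = 0") (auto simp: E'_def)
    moreover have "\<forall>e\<in>E. cinner u e = 0"
      using u by (auto simp: E'_def split: if_splits)
    ultimately show ?thesis
      unfolding True by (subst w) (simp add: cinner_add_right cinner_sum_right)
  next
    case False
    then show ?thesis
      using u w' E_V by (auto simp: E'_def split: if_splits)
  qed
  have "finite E'" using E(1) by (simp add: E'_def)
  then show ?case using E'_on E'_V by blast
qed

lemma bounded_linear_scaleC_left: "bounded_linear (\<lambda>c. scaleC c (f :: 'a::euclidean_space l2))"
  by (rule bounded_linear_intro[where K = "norm f"])
    (simp_all add: l2.scale_left_distrib scaleR_scaleC scaleR_conv_of_real)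

text \<open>Contains the finite-dimensional part of the image of the unit ball in
  \<open>compact_M\<close>. Each inserted vector contributes the compact image of a disc, and sums
  of compact sets are compact.\<close>

lemma compact_coefficient_set:
  fixes M :: "'i \<Rightarrow> 'a::euclidean_space l2"
  assumes "finite E"
  shows "compact {\<Sum>e\<in>E. scaleC (c e) (M e) | c. \<forall>e\<in>E. cmod (c e) \<le> 1}"
  using assms
proof (induction E)
  case empty
  show ?case by simp
next
  case (insert a E)
  let ?S = "\<lambda>E. {\<Sum>e\<in>E. scaleC (c e) (M e) | c. \<forall>e\<in>E. cmod (c e) \<le> 1}"
  have "?S (insert a E) = {x + y | x y. x \<in> (\<lambda>c. scaleC c (M a)) ` cball 0 1 \<and> y \<in> ?S E}"
  proof (intro equalityI subsetI)
    fix x assume "x \<in> ?S (insert a E)"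
    then obtain c where c: "x = (\<Sum>e\<in>insert a E. scaleC (c e) (M e))" "\<forall>e\<in>insert a E. cmod (c e) \<le> 1"
      by blast
    have "x = scaleC (c a) (M a) + (\<Sum>e\<in>E. scaleC (c e) (M e))"
      using insert.hyps c(1) by simp
    moreover have "scaleC (c a) (M a) \<in> (\<lambda>c. scaleC c (M a)) ` cball 0 1"
      using c(2) by (intro imageI) simp
    moreover have "(\<Sum>e\<in>E. scaleC (c e) (M e)) \<in> ?S E"
      using c(2) by blast
    ultimately show "x \<in> {x + y | x y. x \<in> (\<lambda>c. scaleC c (M a)) ` cball 0 1 \<and> y \<in> ?S E}"
      by blast
  next
    fix x assume "x \<in> {x + y | x y. x \<in> (\<lambda>c. scaleC c (M a)) ` cball 0 1 \<and> y \<in> ?S E}"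
    then obtain d c where d: "cmod d \<le> 1" and c: "\<forall>e\<in>E. cmod (c e) \<le> 1"
      and x: "x = scaleC d (M a) + (\<Sum>e\<in>E. scaleC (c e) (M e))" by auto
    have "(\<Sum>e\<in>E. scaleC (c e) (M e)) = (\<Sum>e\<in>E. scaleC ((c(a := d)) e) (M e))"
      using insert.hyps by (intro sum.cong) auto
    then have "x = (\<Sum>e\<in>insert a E. scaleC ((c(a := d)) e) (M e))"
      using insert.hyps x by simp
    moreover have "\<forall>e\<in>insert a E. cmod ((c(a := d)) e) \<le> 1" using c d by auto
    ultimately show "x \<in> ?S (insert a E)" by blast
  qed
  moreover have "compact ((\<lambda>c. scaleC c (M a)) ` cball 0 1)"
    by (intro compact_continuous_image linear_continuous_on bounded_linear_scaleC_left compact_cball)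
  then have "compact {x + y | x y. x \<in> (\<lambda>c. scaleC c (M a)) ` cball 0 1 \<and> y \<in> ?S E}"
    using insert.IH by (rule compact_sums)
  ultimately show ?case by simp
qed

text \<open>The multiplicities are arranged in a decreasing sequence by assigning to \<open>\<sigma>\<close> the block of
  indices that starts at the number of values above \<open>\<sigma>\<close>.\<close>

lemma decreasing_enumeration_of_multiplicities:
  fixes k :: "real \<Rightarrow> nat"
  assumes fin: "\<And>e. 0 < e \<Longrightarrow> finite {\<sigma>. e \<le> \<sigma> \<and> 0 < k \<sigma>}"
  obtains s :: "nat \<Rightarrow> real" where "decseq s" "\<And>n. 0 \<le> s n"
    and "\<And>\<sigma>. 0 < \<sigma> \<Longrightarrow> finite {n. s n = \<sigma>} \<and> card {n. s n = \<sigma>} = k \<sigma>"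
proof -
  define A where "A \<sigma> = (\<Sum>\<tau> | \<sigma> < \<tau> \<and> 0 < k \<tau>. k \<tau>)" for \<sigma>
  define I where "I \<sigma> = {A \<sigma>..<A \<sigma> + k \<sigma>}" for \<sigma>
  have fin': "finite {\<tau>. \<sigma> < \<tau> \<and> 0 < k \<tau>}" if "0 < \<sigma>" for \<sigma>
    by (rule finite_subset[OF _ fin[OF that]]) auto
  have A_step: "A \<tau> + k \<tau> \<le> A \<sigma>" if "0 < \<sigma>" "\<sigma> < \<tau>" for \<sigma> \<tau>
  proof (cases "k \<tau> = 0")
    case True
    have "A \<tau> \<le> A \<sigma>" unfolding A_def
      using that fin'[of \<sigma>] by (intro sum_mono2) auto
    then show ?thesis using True by simp
  next
    case False
    have "A \<tau> + k \<tau> = (\<Sum>\<tau>' \<in> insert \<tau> {\<tau>'. \<tau> < \<tau>' \<and> 0 < k \<tau>'}. k \<tau>')"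
      unfolding A_def using fin'[of \<tau>] that by (subst sum.insert) auto
    also have "\<dots> \<le> A \<sigma>" unfolding A_def
      using that fin'[of \<sigma>] False by (intro sum_mono2) auto
    finally show ?thesis .
  qed
  have I_inj: "\<sigma> = \<tau>" if "0 < \<sigma>" "0 < \<tau>" "n \<in> I \<sigma>" "n \<in> I \<tau>" for \<sigma> \<tau> n
    using A_step[of \<sigma> \<tau>] A_step[of \<tau> \<sigma>] that by (cases \<sigma> \<tau> rule: linorder_cases) (auto simp: I_def)
  define s where "s n = (if \<exists>\<sigma>>0. n \<in> I \<sigma> then THE \<sigma>. 0 < \<sigma> \<and> n \<in> I \<sigma> else 0)" for n
  have s_eq: "s n = \<sigma>" if "0 < \<sigma>" "n \<in> I \<sigma>" for n \<sigma>
  proof -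
    have "(THE \<sigma>. 0 < \<sigma> \<and> n \<in> I \<sigma>) = \<sigma>"
      using that I_inj by (intro the_equality) auto
    with that show ?thesis by (auto simp: s_def)
  qed
  have s_cases: "s n = 0 \<or> 0 < s n \<and> n \<in> I (s n)" for n
  proof (cases "\<exists>\<sigma>>0. n \<in> I \<sigma>")
    case True
    then show ?thesis using s_eq by blast
  next
    case False
    then have "s n = 0" unfolding s_def by (rule if_not_P)
    then show ?thesis by simp
  qed
  have nonneg: "0 \<le> s n" for n using s_cases[of n] by auto
  have "s m \<le> s n" if nm: "n \<le> m" for n m
  proof (cases "s m = 0")
    case False
    define \<tau> where "\<tau> = s m"
    have \<tau>: "0 < \<tau>" "m \<in> I \<tau>" using s_cases[of m] False by (auto simp: \<tau>_def)
    \<comment> \<open>The candidates for the value at \<open>n\<close> are those at or above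
      \<open>\<tau>\<close> whose block ends after \<open>n\<close>. The largest candidate also
      starts at or before \<open>n\<close>, because the block of the next larger value ends exactly
      where its own block begins.\<close>
    define S where "S = {\<sigma>. \<tau> \<le> \<sigma> \<and> 0 < k \<sigma> \<and> n < A \<sigma> + k \<sigma>}"
    have S: "finite S" "\<tau> \<in> S"
      using \<tau> nm by (auto simp: S_def I_def intro: finite_subset[OF _ fin[OF \<tau>(1)]])
    define \<sigma> where "\<sigma> = Max S"
    have \<sigma>: "\<sigma> \<in> S" "\<tau> \<le> \<sigma>" unfolding \<sigma>_def using S by (auto intro: Max_in)
    have "A \<sigma> \<le> n"
    proof (rule ccontr)
      assume less: "\<not> A \<sigma> \<le> n"
      let ?T = "{\<rho>. \<sigma> < \<rho> \<and> 0 < k \<rho>}"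
      have T: "finite ?T" "?T \<noteq> {}"
        using less fin'[of \<sigma>] \<sigma> \<tau> by (auto simp: A_def simp del: Collect_empty_eq)
      define \<rho> where "\<rho> = Min ?T"
      have \<rho>: "\<rho> \<in> ?T" unfolding \<rho>_def using T by (rule Min_in)
      have "?T = insert \<rho> {\<rho>'. \<rho> < \<rho>' \<and> 0 < k \<rho>'}"
        using \<rho> Min_le[OF T(1)] by (auto simp: \<rho>_def[symmetric] le_less)
      moreover have "0 < \<rho>" using \<rho> \<sigma> \<tau> by simp
      ultimately have "A \<sigma> = A \<rho> + k \<rho>"
        using fin'[of \<rho>] by (simp add: A_def)
      then have "\<rho> \<in> S" using less \<rho> \<sigma> by (auto simp: S_def)
      then have "\<rho> \<le> \<sigma>" unfolding \<sigma>_def using S by simp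
      with \<rho> show False by simp
    qed
    then have "s n = \<sigma>" using \<sigma> \<tau> by (intro s_eq) (auto simp: I_def S_def)
    with \<sigma> show ?thesis by (simp add: \<tau>_def)
  qed (simp add: nonneg)
  then have "decseq s" by (simp add: decseq_def)
  moreover have "finite {n. s n = \<sigma>} \<and> card {n. s n = \<sigma>} = k \<sigma>" if "0 < \<sigma>" for \<sigma>
  proof -
    have "{n. s n = \<sigma>} = I \<sigma>"
    proof (intro set_eqI iffI)
      fix n assume "n \<in> {n. s n = \<sigma>}"
      then show "n \<in> I \<sigma>" using s_cases[of n] that by auto
    next
      fix n assume "n \<in> I \<sigma>"
      then show "n \<in> {n. s n = \<sigma>}" using s_eq[OF that] by simp
    qed
    then show ?thesis by (simp add: I_def)
  qed
  ultimately show thesis using that nonneg by blast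
qed

text \<open>Picks orthonormal systems of maximal size; a vector that could extend one then yields a
  contradiction, with no recursive choice of vectors.\<close>

lemma bounded_nat_predicate_max:
  fixes P :: "nat \<Rightarrow> bool"
  assumes "P 0" "\<And>n. P n \<Longrightarrow> n \<le> b"
  shows "\<exists>n. P n \<and> (\<forall>m. P m \<longrightarrow> m \<le> n)"
  using GreatestI_nat[of P 0 b] Greatest_le_nat[of P _ b] assms by blast

text \<open>Linearity of both operators is a consequence of the adjoint relation alone, so it is
  derived below from \<open>adjoint\<close>.\<close>

locale summable_diagonals =
  fixes M N :: "'a::euclidean_space l2 \<Rightarrow> 'a l2" and p K :: real
  assumes adjoint: "\<And>f g. cinner (M f) g = cinner f (N g)"
    and diagonal: "\<And>F v. finite F \<Longrightarrow> orthonormal_on F (\<lambda>u. u) \<Longrightarrow> orthonormal_on F v \<Longrightarrow>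
      (\<Sum>u\<in>F. cmod (cinner (M u) (v u)) powr p) \<le> K"
    and p: "0 < p"
begin

lemma M_add: "M (f + g) = M f + M g"
  by (rule cinner_ext_left) (simp add: adjoint cinner_add_left)

lemma M_scaleC: "M (scaleC c f) = scaleC c (M f)"
  by (rule cinner_ext_left) (simp add: adjoint)

lemma adjoint': "cinner (N f) g = cinner f (M g)"
  using adjoint[of g f] cinner_commute[of "N f" g] cinner_commute[of f "M g"] by simp

lemma N_add: "N (f + g) = N f + N g"
  by (rule cinner_ext_left) (simp add: adjoint' cinner_add_left)

lemma N_scaleC: "N (scaleC c f) = scaleC c (N f)"
  by (rule cinner_ext_left) (simp add: adjoint')

lemma M_0: "M 0 = 0" and N_0: "N 0 = 0"
  using M_scaleC[of 0 0] N_scaleC[of 0 0] by simp_all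

lemma M_diff: "M (f - g) = M f - M g"
  by (rule cinner_ext_left) (simp add: adjoint cinner_diff_left)

lemma N_diff: "N (f - g) = N f - N g"
  by (rule cinner_ext_left) (simp add: adjoint' cinner_diff_left)

lemma M_sum: "M (\<Sum>i\<in>I. f i) = (\<Sum>i\<in>I. M (f i))"
  by (induction I rule: infinite_finite_induct) (auto simp: M_add M_0)

lemma linear_M: "Vector_Spaces.linear scaleC scaleC M"
  by (intro Vector_Spaces.linear_iff[THEN iffD2] conjI allI vector_space_l2 M_add M_scaleC)

lemma cadjoint_M: "cadjoint M = N"
proof -
  have "\<forall>f g. cinner (M f) g = cinner f (cadjoint M g)"
    unfolding cadjoint_def by (rule someI[of _ N]) (simp add: adjoint)
  then show ?thesis
    by (intro ext cinner_ext_right) (metis adjoint)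
qed

section \<open>Compactness from bounded orthonormal chains\<close>

lemma orthonormal_chain_bound:
  assumes "finite F" "orthonormal_on F (\<lambda>u. u)" "orthonormal_on F v"
    and e: "0 < e" "\<And>u. u \<in> F \<Longrightarrow> e \<le> cmod (cinner (M u) (v u))"
  shows "real (card F) * e powr p \<le> K"
proof -
  have "real (card F) * e powr p = (\<Sum>u\<in>F. e powr p)" by simp
  also have "\<dots> \<le> (\<Sum>u\<in>F. cmod (cinner (M u) (v u)) powr p)"
    using e p by (intro sum_mono powr_mono2) auto
  also have "\<dots> \<le> K" using assms by (intro diagonal)
  finally show ?thesis .
qed

lemma card_bound_nat:
  assumes "0 < e" "real n * e powr p \<le> K"
  shows "n \<le> nat \<lceil>K / e powr p\<rceil>"
proof -
  have "real n \<le> K / e powr p" using assms by (simp add: field_simps)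
  then show ?thesis by linarith
qed

text \<open>Otherwise one could choose \<open>u\<^sub>0, u\<^sub>1, \<dots>\<close> successively, each orthogonal to all earlier \<open>u\<^sub>i\<close> and
  \<open>N v\<^sub>i\<close>, with \<open>v\<^sub>i\<close> the normalisation of \<open>M u\<^sub>i\<close>; the \<open>v\<^sub>i\<close> are then orthonormal as well, and the
  diagonal sums would be unbounded.\<close>

lemma small_off_finite_set:
  assumes e: "0 < e"
  shows "\<exists>V. finite V \<and> (\<forall>u. (\<forall>w\<in>V. cinner u w = 0) \<longrightarrow> norm (M u) \<le> e * norm u)"
proof -
  define P where "P n \<longleftrightarrow> (\<exists>F v. finite F \<and> card F = n \<and> orthonormal_on F (\<lambda>u. u) \<and> orthonormal_on F v
      \<and> (\<forall>u\<in>F. e \<le> cmod (cinner (M u) (v u))))" for n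
  have "P 0" unfolding P_def by (intro exI[of _ "{}"]) (simp add: orthonormal_on_def)
  moreover have "n \<le> nat \<lceil>K / e powr p\<rceil>" if "P n" for n
    using that orthonormal_chain_bound[OF _ _ _ e] card_bound_nat[OF e] unfolding P_def by blast
  ultimately have "\<exists>n. P n \<and> (\<forall>m. P m \<longrightarrow> m \<le> n)"
    by (rule bounded_nat_predicate_max)
  then obtain n where n: "P n" "\<And>m. P m \<Longrightarrow> m \<le> n" by blast
  from n(1) obtain F v where F: "finite F" "card F = n" "orthonormal_on F (\<lambda>u. u)" "orthonormal_on F v"
    "\<And>u. u \<in> F \<Longrightarrow> e \<le> cmod (cinner (M u) (v u))"
    unfolding P_def by blast
  have "norm (M u) \<le> e * norm u" if orth: "\<forall>w \<in> F \<union> N ` v ` F. cinner u w = 0" for u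
  proof (rule ccontr)
    assume less: "\<not> norm (M u) \<le> e * norm u"
    then have Mu0: "M u \<noteq> 0" using e by auto
    then have u0: "u \<noteq> 0" using M_0 by auto
    define u' where "u' = scaleC (1 / norm u) u"
    define w where "w = scaleC (1 / norm (M u)) (M u)"
    have u'_1: "cinner u' u' = 1" and w_1: "cinner w w = 1"
      unfolding u'_def w_def by (intro normalized_vector u0 Mu0)+
    have u'_orth: "cinner u' x = 0" if "x \<in> F" for x
      using orth that by (simp add: u'_def)
    have u'_new: "u' \<notin> F"
      using u'_orth[of u'] u'_1 by auto
    have "cinner (M u) (v x) = 0" if "x \<in> F" for x
      using orth that by (simp add: adjoint)
    then have w_orth: "cinner w (v x) = 0" if "x \<in> F" for x
      using that by (simp add: w_def)
    have Mu'w: "cmod (cinner (M u') w) = norm (M u) / norm u"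
      using Mu0 by (simp add: u'_def w_def M_scaleC cinner_self norm_mult norm_divide power2_eq_square)
    have "e \<le> norm (M u) / norm u"
      using less u0 by (simp add: pos_le_divide_eq)
    then have "P (Suc n)"
      unfolding P_def
    proof (intro exI[of _ "insert u' F"] exI[of _ "v(u' := w)"] conjI)
      show "orthonormal_on (insert u' F) (\<lambda>u. u)"
        using u'_1 u'_orth by (intro orthonormal_on_insert[OF F(3)]) auto
      show "orthonormal_on (insert u' F) (v(u' := w))"
        using w_1 w_orth u'_new by (intro orthonormal_on_insert[OF F(4)]) auto
    qed (use F u'_new Mu'w in auto)
    then show False using n(2)[of "Suc n"] by simp
  qed
  then show ?thesis using F(1) by (intro exI[of _ "F \<union> N ` v ` F"]) blast
qed

text \<open>Total boundedness at scale \<open>e\<close>: the component of a unit-ball vector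
  orthogonal to a finite orthonormal set \<open>E\<close> has image of norm at most
  \<open>e / 2\<close>, and the images of the remaining components lie in a compact set, which
  finitely many balls of radius \<open>e / 2\<close> cover.\<close>

lemma compact_M: "compact_operator M"
proof -
  have cover: "\<exists>T. finite T \<and> M ` cball 0 1 \<subseteq> (\<Union>x\<in>T. ball x e)" if e: "0 < e" for e
  proof -
    obtain V where V: "finite V" "\<And>u. (\<forall>w\<in>V. cinner u w = 0) \<Longrightarrow> norm (M u) \<le> e / 2 * norm u"
      using small_off_finite_set[of "e / 2"] e by auto
    obtain E where E: "finite E" "orthonormal_on E (\<lambda>u. u)"
      "\<And>u. (\<forall>w\<in>E. cinner u w = 0) \<Longrightarrow> (\<forall>w\<in>V. cinner u w = 0)"
      using Gram_Schmidt[OF V(1)] by blast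
    define C where "C = {\<Sum>u\<in>E. scaleC (c u) (M u) | c. \<forall>u\<in>E. cmod (c u) \<le> 1}"
    have "compact C" unfolding C_def by (rule compact_coefficient_set[OF E(1)])
    then obtain T where T: "finite T" "C \<subseteq> (\<Union>x\<in>T. ball x (e / 2))"
      unfolding compact_eq_totally_bounded using e by (meson half_gt_zero)
    have "M f \<in> (\<Union>x\<in>T. ball x e)" if f: "f \<in> cball 0 1" for f
    proof -
      define q where "q = f - (\<Sum>u\<in>E. scaleC (cinner f u) u)"
      have "cinner q u = 0" if "u \<in> E" for u
        unfolding q_def by (rule orthonormal_remainder_orthogonal[OF E(1,2) that])
      then have "norm (M q) \<le> e / 2 * norm q" using V(2) E(3) by blast
      moreover have q_le: "norm q \<le> 1"
      proof -
        have "(norm q)\<^sup>2 \<le> (norm f)\<^sup>2"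
          unfolding q_def orthonormal_remainder_norm[OF E(1,2)] by (simp add: sum_nonneg)
        then show ?thesis using f power2_le_imp_le[of "norm q" "norm f"] by simp
      qed
      moreover have "e / 2 * norm q \<le> e / 2 * 1"
        using e q_le by (intro mult_left_mono) auto
      ultimately have Mq: "norm (M q) \<le> e / 2" by linarith
      have coeff: "cmod (cinner f u) \<le> 1" if "u \<in> E" for u
      proof -
        have "norm u = 1"
          using E(2) that unfolding orthonormal_on_def cinner_self_eq_1_iff[symmetric] by simp
        then show ?thesis using cinner_Cauchy_Schwarz[of f u] f by simp
      qed
      have Mf: "M f = M q + (\<Sum>u\<in>E. scaleC (cinner f u) (M u))"
        by (simp add: q_def M_diff M_sum M_scaleC)
      have "(\<Sum>u\<in>E. scaleC (cinner f u) (M u)) \<in> C"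
        unfolding C_def using coeff by blast
      then obtain x where x: "x \<in> T" "dist x (\<Sum>u\<in>E. scaleC (cinner f u) (M u)) < e / 2"
        using T(2) by auto
      have "dist x (M f) < e"
        using x(2) Mq unfolding Mf dist_norm
        using norm_triangle_ineq4[of "x - (\<Sum>u\<in>E. scaleC (cinner f u) (M u))" "M q"]
        by (simp add: algebra_simps)
      with x(1) show ?thesis by auto
    qed
    with T(1) show ?thesis by blast
  qed
  \<comment> \<open>A cover of the image by open balls need not cover its closure. Closed balls of
    half the radius do, and they fit into the open balls of radius \<open>e\<close>.\<close>
  have "\<exists>T. finite T \<and> closure (M ` cball 0 1) \<subseteq> (\<Union>x\<in>T. ball x e)" if e: "0 < e" for e
  proof -
    obtain T where T: "finite T" "M ` cball 0 1 \<subseteq> (\<Union>x\<in>T. ball x (e / 2))"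
      using cover[of "e / 2"] e by auto
    have "closure (M ` cball 0 1) \<subseteq> (\<Union>x\<in>T. cball x (e / 2))"
    proof (rule closure_minimal)
      show "M ` cball 0 1 \<subseteq> (\<Union>x\<in>T. cball x (e / 2))"
        by (rule order_trans[OF T(2)]) (intro UN_mono subset_refl ball_subset_cball)
      show "closed (\<Union>x\<in>T. cball x (e / 2))"
        by (intro closed_UN T(1) ballI closed_cball)
    qed
    also have "\<dots> \<subseteq> (\<Union>x\<in>T. ball x e)" using e by auto
    finally show ?thesis using T(1) by blast
  qed
  moreover have "complete (closure (M ` cball 0 1))"
    using complete_closed_subset[OF closed_closure subset_UNIV complete_l2] .
  ultimately show ?thesis
    unfolding compact_operator_def compact_eq_totally_bounded by (simp add: linear_M)
qed

section \<open>Singular vectors and their multiplicities\<close>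

definition eig :: "real \<Rightarrow> 'a l2 set" where
  "eig \<sigma> = {f. N (M f) = scaleC (of_real (\<sigma>\<^sup>2)) f}"

lemma cinner_M_eig: "g \<in> eig \<sigma> \<Longrightarrow> cinner (M f) (M g) = of_real (\<sigma>\<^sup>2) * cinner f g"
  by (simp add: adjoint eig_def)

lemma norm_M_eig:
  assumes "u \<in> eig \<sigma>" "0 < \<sigma>" "cinner u u = 1"
  shows "norm (M u) = \<sigma>"
proof -
  have "complex_of_real ((norm (M u))\<^sup>2) = complex_of_real (\<sigma>\<^sup>2)"
    using cinner_M_eig[OF assms(1), of u] assms(3) by (simp add: cinner_self)
  then have "(norm (M u))\<^sup>2 = \<sigma>\<^sup>2" using of_real_eq_iff by blast
  then show ?thesis using assms(2) by (simp add: power2_eq_iff_nonneg)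
qed

lemma eig_orthogonal:
  assumes "f \<in> eig \<sigma>" "g \<in> eig \<tau>" "0 < \<sigma>" "0 < \<tau>" "\<sigma> \<noteq> \<tau>"
  shows "cinner f g = 0"
proof -
  have "of_real (\<tau>\<^sup>2) * cinner f g = cinner (M f) (M g)"
    using cinner_M_eig[OF assms(2)] by simp
  also have "\<dots> = cnj (of_real (\<sigma>\<^sup>2) * cinner g f)"
    using cinner_M_eig[OF assms(1), of g] cinner_commute[of "M f" "M g"] by simp
  also have "\<dots> = of_real (\<sigma>\<^sup>2) * cinner f g"
    using cinner_commute[of f g] by simp
  finally have "of_real (\<tau>\<^sup>2) * cinner f g = of_real (\<sigma>\<^sup>2) * cinner f g" .
  then have "\<tau>\<^sup>2 = \<sigma>\<^sup>2 \<or> cinner f g = 0"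
    by (metis mult_cancel_right of_real_eq_iff)
  with assms show ?thesis by (auto simp: power2_eq_iff)
qed

text \<open>On eigenvectors \<open>M\<close> preserves orthogonality, whether or not their
  eigenvalues agree. The normalised images thus form a second orthonormal system, for which the
  diagonal entries are exactly the norms \<open>norm (M u)\<close>.\<close>

lemma eig_sum_bound:
  assumes F: "finite F" "orthonormal_on F (\<lambda>u. u)"
    and eig: "\<And>u. u \<in> F \<Longrightarrow> \<exists>\<sigma>>0. u \<in> eig \<sigma>"
  shows "(\<Sum>u\<in>F. norm (M u) powr p) \<le> K"
proof -
  define v where "v u = scaleC (1 / norm (M u)) (M u)" for u
  have pos: "0 < norm (M u)" if u: "u \<in> F" for u
  proof -
    obtain \<sigma> where "0 < \<sigma>" "u \<in> eig \<sigma>" using eig[OF u] by blast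
    moreover have "cinner u u = 1" using F(2) u by (simp add: orthonormal_on_def)
    ultimately show ?thesis using norm_M_eig[of u \<sigma>] by simp
  qed
  have "cinner (v u) (v w) = (if u = w then 1 else 0)" if u: "u \<in> F" "w \<in> F" for u w
  proof (cases "u = w")
    case True
    then show ?thesis using normalized_vector[of "M u"] pos[OF u(1)] by (auto simp: v_def)
  next
    case False
    obtain \<sigma> where "w \<in> eig \<sigma>" using eig[OF u(2)] by blast
    from cinner_M_eig[OF this, of u] have "cinner (M u) (M w) = 0"
      using F(2) u False by (simp add: orthonormal_on_def)
    then show ?thesis using False by (simp add: v_def)
  qed
  then have "orthonormal_on F v" by (simp add: orthonormal_on_def)
  from diagonal[OF F this] have "(\<Sum>u\<in>F. cmod (cinner (M u) (v u)) powr p) \<le> K" .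
  moreover have "cmod (cinner (M u) (v u)) = norm (M u)" if "u \<in> F" for u
    using pos[OF that] by (simp add: v_def cinner_self norm_mult norm_divide power2_eq_square)
  ultimately show ?thesis by simp
qed

lemma eig_diff: "f \<in> eig \<sigma> \<Longrightarrow> g \<in> eig \<sigma> \<Longrightarrow> f - g \<in> eig \<sigma>"
  by (simp add: eig_def M_diff N_diff l2.scale_right_diff_distrib)

lemma eig_scaleC: "f \<in> eig \<sigma> \<Longrightarrow> scaleC c f \<in> eig \<sigma>"
  by (simp add: eig_def M_scaleC N_scaleC mult.commute)

lemma eig_add: "f \<in> eig \<sigma> \<Longrightarrow> g \<in> eig \<sigma> \<Longrightarrow> f + g \<in> eig \<sigma>"
  by (simp add: eig_def M_add N_add l2.scale_right_distrib)

lemma eig_sum: "(\<And>i. i \<in> I \<Longrightarrow> f i \<in> eig \<sigma>) \<Longrightarrow> (\<Sum>i\<in>I. f i) \<in> eig \<sigma>"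
proof (induction I rule: infinite_finite_induct)
  case (insert x F)
  then show ?case by (simp add: eig_add)
qed (simp_all add: eig_def M_0 N_0)

text \<open>\<open>eig_sum_bound\<close> limits the size of an orthonormal system in the eigenspace
  by \<open>K / \<sigma> powr p\<close>. In a system of maximal size the remainder of an eigenvector
  must vanish, since otherwise its normalisation would enlarge the system; so the system
  spans.\<close>

lemma eig_basis:
  assumes \<sigma>: "0 < \<sigma>"
  shows "\<exists>B. finite B \<and> B \<subseteq> eig \<sigma> \<and> orthonormal_on B (\<lambda>u. u) \<and> l2.dim (eig \<sigma>) = card B"
proof -
  define P where "P n \<longleftrightarrow> (\<exists>B. finite B \<and> card B = n \<and> B \<subseteq> eig \<sigma> \<and> orthonormal_on B (\<lambda>u. u))" for n
  have "P 0" unfolding P_def by (intro exI[of _ "{}"]) (simp add: orthonormal_on_def)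
  moreover have "n \<le> nat \<lceil>K / \<sigma> powr p\<rceil>" if "P n" for n
  proof -
    from that obtain B where B: "finite B" "card B = n" "B \<subseteq> eig \<sigma>" "orthonormal_on B (\<lambda>u. u)"
      unfolding P_def by blast
    have "norm (M u) = \<sigma>" if "u \<in> B" for u
      using that B \<sigma> by (intro norm_M_eig) (auto simp: orthonormal_on_def)
    then have "real n * \<sigma> powr p = (\<Sum>u\<in>B. norm (M u) powr p)"
      using B(2) by simp
    also have "\<dots> \<le> K" using B \<sigma> by (intro eig_sum_bound) auto
    finally show ?thesis by (rule card_bound_nat[OF \<sigma>])
  qed
  ultimately have "\<exists>n. P n \<and> (\<forall>m. P m \<longrightarrow> m \<le> n)"
    by (rule bounded_nat_predicate_max)
  then obtain n where n: "P n" "\<And>m. P m \<Longrightarrow> m \<le> n" by blast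
  then obtain B where B: "finite B" "card B = n" "B \<subseteq> eig \<sigma>" "orthonormal_on B (\<lambda>u. u)"
    unfolding P_def by blast
  have "f \<in> l2.span B" if f: "f \<in> eig \<sigma>" for f
  proof -
    define q where "q = f - (\<Sum>u\<in>B. scaleC (cinner f u) u)"
    have orth: "cinner q u = 0" if "u \<in> B" for u
      unfolding q_def by (rule orthonormal_remainder_orthogonal[OF B(1,4) that])
    have q_eig: "q \<in> eig \<sigma>"
      unfolding q_def using B(3) f by (intro eig_diff eig_sum eig_scaleC) auto
    have "q = 0"
    proof (rule ccontr)
      assume q: "q \<noteq> 0"
      define q' where "q' = scaleC (1 / norm q) q"
      have q'_orth: "cinner q' u = 0" if "u \<in> B" for u
        using orth[OF that] by (simp add: q'_def)
      have q'_1: "cinner q' q' = 1" using normalized_vector[OF q] by (simp add: q'_def)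
      have "q' \<notin> B" using q'_orth[of q'] q'_1 by auto
      moreover have "orthonormal_on (insert q' B) (\<lambda>u. u)"
        using q'_orth q'_1 by (intro orthonormal_on_insert[OF B(4)]) auto
      moreover have "q' \<in> eig \<sigma>" using q_eig by (simp add: q'_def eig_scaleC)
      ultimately have "P (Suc n)"
        unfolding P_def using B by (intro exI[of _ "insert q' B"]) auto
      then show False using n(2)[of "Suc n"] by simp
    qed
    then have "f = (\<Sum>u\<in>B. scaleC (cinner f u) u)" by (simp add: q_def)
    also have "\<dots> \<in> l2.span B"
      by (intro l2.span_sum l2.span_scale l2.span_base)
    finally show ?thesis .
  qed
  moreover have "l2.independent B"
  proof (rule l2.independent_if_scalars_zero[OF B(1)])
    fix c u assume sum: "(\<Sum>x\<in>B. scaleC (c x) x) = 0" and u: "u \<in> B"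
    have "0 = cinner (\<Sum>x\<in>B. scaleC (c x) x) u" by (simp add: sum)
    also have "\<dots> = (\<Sum>x\<in>B. if x = u then c x else 0)"
      unfolding cinner_sum_left using B(4) u by (intro sum.cong) (auto simp: orthonormal_on_def)
    also have "\<dots> = c u" using B(1) u by simp
    finally show "c u = 0" by simp
  qed
  ultimately have "l2.dim (eig \<sigma>) = card B"
    using B(3) by (intro l2.dim_unique) auto
  then show ?thesis using B by blast
qed

theorem M_in_schatten_class: "M \<in> schatten_class p"
proof -
  have "\<forall>\<sigma>. \<exists>B. 0 < \<sigma> \<longrightarrow> finite B \<and> B \<subseteq> eig \<sigma> \<and> orthonormal_on B (\<lambda>u. u) \<and> l2.dim (eig \<sigma>) = card B"
    using eig_basis by blast
  from choice[OF this] obtain B where "\<forall>\<sigma>. 0 < \<sigma> \<longrightarrow> finite (B \<sigma>) \<and> B \<sigma> \<subseteq> eig \<sigma>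
      \<and> orthonormal_on (B \<sigma>) (\<lambda>u. u) \<and> l2.dim (eig \<sigma>) = card (B \<sigma>)" ..
  then have B: "\<And>\<sigma>. 0 < \<sigma> \<Longrightarrow> finite (B \<sigma>)" "\<And>\<sigma>. 0 < \<sigma> \<Longrightarrow> B \<sigma> \<subseteq> eig \<sigma>"
    "\<And>\<sigma>. 0 < \<sigma> \<Longrightarrow> orthonormal_on (B \<sigma>) (\<lambda>u. u)" "\<And>\<sigma>. 0 < \<sigma> \<Longrightarrow> l2.dim (eig \<sigma>) = card (B \<sigma>)"
    by blast+
  \<comment> \<open>Eigenvectors for distinct positive singular values are orthogonal. The chosen
    bases therefore unite to one orthonormal system, and a single constant \<open>K\<close> bounds
    the sum over all of \<open>T\<close>.\<close>
  have est: "(\<Sum>\<sigma>\<in>T. real (card (B \<sigma>)) * \<sigma> powr p) \<le> K" if T: "finite T" "\<And>\<sigma>. \<sigma> \<in> T \<Longrightarrow> 0 < \<sigma>" for T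
  proof -
    have one: "cinner u u = 1" if "0 < \<sigma>" "u \<in> B \<sigma>" for u \<sigma>
      using B(3)[OF that(1)] that(2) by (simp add: orthonormal_on_def)
    have orth: "cinner u w = 0" if "0 < \<sigma>" "0 < \<tau>" "\<sigma> \<noteq> \<tau>" "u \<in> B \<sigma>" "w \<in> B \<tau>" for u w \<sigma> \<tau>
      using that B(2) by (intro eig_orthogonal[of u \<sigma> w \<tau>]) auto
    have "orthonormal_on (\<Union>(B ` T)) (\<lambda>u. u)"
      unfolding orthonormal_on_def
    proof (intro ballI)
      fix u w assume "u \<in> \<Union>(B ` T)" "w \<in> \<Union>(B ` T)"
      then obtain \<sigma> \<tau> where *: "\<sigma> \<in> T" "\<tau> \<in> T" "u \<in> B \<sigma>" "w \<in> B \<tau>" by blast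
      show "cinner u w = (if u = w then 1 else 0)"
      proof (cases "\<sigma> = \<tau>")
        case True
        then show ?thesis using B(3)[OF T(2)[OF *(1)]] * by (simp add: orthonormal_on_def)
      next
        case False
        then show ?thesis using orth[of \<sigma> \<tau> u w] one[of \<sigma> u] * T(2) by auto
      qed
    qed
    then have "(\<Sum>u\<in>\<Union>(B ` T). norm (M u) powr p) \<le> K"
      using T B by (intro eig_sum_bound) blast+
    also have "(\<Sum>u\<in>\<Union>(B ` T). norm (M u) powr p) = (\<Sum>\<sigma>\<in>T. \<Sum>u\<in>B \<sigma>. norm (M u) powr p)"
    proof (rule sum.UNION_disjoint[OF T(1)])
      show "\<forall>\<sigma>\<in>T. finite (B \<sigma>)" using B(1) T(2) by blast
      show "\<forall>\<sigma>\<in>T. \<forall>\<tau>\<in>T. \<sigma> \<noteq> \<tau> \<longrightarrow> B \<sigma> \<inter> B \<tau> = {}"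
      proof (intro ballI impI equals0I)
        fix \<sigma> \<tau> u assume *: "\<sigma> \<in> T" "\<tau> \<in> T" "\<sigma> \<noteq> \<tau>" "u \<in> B \<sigma> \<inter> B \<tau>"
        then show False
          using orth[of \<sigma> \<tau> u u] one[of \<sigma> u] T(2) by auto
      qed
    qed
    also have "\<dots> = (\<Sum>\<sigma>\<in>T. \<Sum>u\<in>B \<sigma>. \<sigma> powr p)"
    proof (intro sum.cong refl)
      fix \<sigma> u assume "\<sigma> \<in> T" "u \<in> B \<sigma>"
      then have "norm (M u) = \<sigma>" using norm_M_eig[of u \<sigma>] B(2) one T(2) by blast
      then show "norm (M u) powr p = \<sigma> powr p" by simp
    qed
    finally show ?thesis by simp
  qed
  \<comment> \<open>Every such value contributes at least \<open>e powr p\<close> to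
    \<open>est\<close>. This finiteness is what allows the values to be listed in decreasing
    order.\<close>
  have fin: "finite {\<sigma>. e \<le> \<sigma> \<and> 0 < card (B \<sigma>)}" if e: "0 < e" for e
  proof (rule ccontr)
    assume "infinite {\<sigma>. e \<le> \<sigma> \<and> 0 < card (B \<sigma>)}"
    then obtain T where T: "T \<subseteq> {\<sigma>. e \<le> \<sigma> \<and> 0 < card (B \<sigma>)}" "finite T"
      "card T = Suc (nat \<lceil>K / e powr p\<rceil>)"
      using infinite_arbitrarily_large by blast
    have "real (card T) * e powr p = (\<Sum>\<sigma>\<in>T. 1 * e powr p)" by simp
    also have "\<dots> \<le> (\<Sum>\<sigma>\<in>T. real (card (B \<sigma>)) * \<sigma> powr p)"
      using T(1) e p by (intro sum_mono mult_mono powr_mono2) (auto simp: Suc_le_eq)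
    also have "\<dots> \<le> K" using T e by (intro est) auto
    finally have "card T \<le> nat \<lceil>K / e powr p\<rceil>" by (rule card_bound_nat[OF e])
    with T(3) show False by simp
  qed
  obtain s where s: "decseq s" "\<And>n. 0 \<le> s n"
    "\<And>\<sigma>. 0 < \<sigma> \<Longrightarrow> finite {n. s n = \<sigma>} \<and> card {n. s n = \<sigma>} = card (B \<sigma>)"
    using decreasing_enumeration_of_multiplicities[OF fin] by blast
  have "singular_value_sequence M s"
    unfolding singular_value_sequence_def cadjoint_M
    using s B(4) by (auto simp: eig_def)
  moreover have "summable (\<lambda>n. s n powr p)"
  proof (rule bounded_imp_summable)
    show "0 \<le> s n powr p" for n by simp
    fix n
    \<comment> \<open>Zero terms drop out because \<open>0 powr p = 0\<close>. The other terms are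
      grouped by value, and each group is at most as large as the multiplicity of its value.\<close>
    define T where "T = s ` {..n} - {0}"
    have T: "finite T" "\<And>\<sigma>. \<sigma> \<in> T \<Longrightarrow> 0 < \<sigma>"
      using s(2) by (auto simp: T_def le_less)
    have "(\<Sum>k\<le>n. s k powr p) = (\<Sum>k | k \<le> n \<and> s k \<in> T. s k powr p)"
      by (rule sum.mono_neutral_right) (auto simp: T_def)
    also have "\<dots> = (\<Sum>\<sigma>\<in>T. \<Sum>k\<in>{k \<in> {k. k \<le> n \<and> s k \<in> T}. s k = \<sigma>}. s k powr p)"
      by (rule sum.group[symmetric]) (use T in auto)
    also have "\<dots> \<le> (\<Sum>\<sigma>\<in>T. real (card (B \<sigma>)) * \<sigma> powr p)"
    proof (rule sum_mono)
      fix \<sigma> assume \<sigma>: "\<sigma> \<in> T"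
      have "(\<Sum>k\<in>{k \<in> {k. k \<le> n \<and> s k \<in> T}. s k = \<sigma>}. s k powr p)
          = real (card {k \<in> {k. k \<le> n \<and> s k \<in> T}. s k = \<sigma>}) * \<sigma> powr p" by simp
      also have "\<dots> \<le> real (card {k. s k = \<sigma>}) * \<sigma> powr p"
        using s(3)[OF T(2)[OF \<sigma>]] by (intro mult_right_mono of_nat_mono card_mono) auto
      finally show "(\<Sum>k\<in>{k \<in> {k. k \<le> n \<and> s k \<in> T}. s k = \<sigma>}. s k powr p)
          \<le> real (card (B \<sigma>)) * \<sigma> powr p"
        using s(3)[OF T(2)[OF \<sigma>]] by simp
    qed
    also have "\<dots> \<le> K" using T by (rule est)
    finally show "(\<Sum>k\<le>n. s k powr p) \<le> K" .
  qed
  ultimately show ?thesis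
    unfolding schatten_class_def using compact_M by blast
qed

end

section \<open>Multipliers of Bessel families\<close>

text \<open>Makes the integrand \<open>B f g\<close> dominated by \<open>|m|^p w + w\<close>, both
  summands of which are integrable.\<close>

lemma le_powr_add_1:
  fixes x p :: real
  assumes "1 \<le> p" "0 \<le> x"
  shows "x \<le> x powr p + 1"
proof (cases "x \<le> 1")
  case True
  then show ?thesis using powr_ge_zero[of x p] by linarith
next
  case False
  then have "x powr 1 \<le> x powr p" using assms by (intro powr_mono) auto
  then show ?thesis using False by simp
qed

text \<open>Young's inequality with a free scale \<open>t\<close>; choosing \<open>t\<close> proportional to the quantity to be
  estimated replaces Hoelder's inequality below.\<close>

lemma tangent_line_powr:
  fixes x t p :: real
  assumes p: "1 \<le> p" and x: "0 \<le> x" and t: "0 < t"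
  shows "x \<le> t powr (1 - p) / p * x powr p + (1 - 1 / p) * t"
proof (cases "x = 0")
  case True
  then show ?thesis using p t by simp
next
  case False
  with x have x: "0 < x" by simp
  define a where "a = x powr p * t powr (1 - p)"
  have a: "0 < a" using x t by (simp add: a_def)
  have "a powr (1 / p) * t powr (1 - 1 / p) \<le> (1 / p) * a + (1 - 1 / p) * t"
    using p a t by (intro Youngs_inequality_0) auto
  moreover have "a powr (1 / p) * t powr (1 - 1 / p) = x"
  proof -
    have "a powr (1 / p) = x * t powr ((1 - p) * (1 / p))"
      unfolding a_def using x t p by (simp add: powr_mult powr_powr)
    moreover have "t powr ((1 - p) * (1 / p)) * t powr (1 - 1 / p) = 1"
      using t p by (simp add: powr_add[symmetric] field_simps)
    ultimately show ?thesis by (simp add: mult.assoc)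
  qed
  ultimately show ?thesis by (simp add: a_def mult_ac)
qed

text \<open>At \<open>t = s / C\<close> the second term equals \<open>(1 - 1 / p) * s\<close> and is
  absorbed into the left side; what remains is a computation with powers. This is the Hoelder bound
  with the constant \<open>C powr (p - 1)\<close>.\<close>

lemma powr_le_of_tangent_lines:
  fixes s A C p :: real
  assumes p: "1 \<le> p" and s: "0 \<le> s" and C: "0 < C" and A: "0 \<le> A"
    and le: "\<And>t. 0 < t \<Longrightarrow> s \<le> t powr (1 - p) / p * A + (1 - 1 / p) * t * C"
  shows "s powr p \<le> C powr (p - 1) * A"
proof (cases "s = 0")
  case True
  then show ?thesis using A by simp
next
  case False
  with s have s: "0 < s" by simp
  define q where "q = (s / C) powr (1 - p)"
  have "s \<le> q / p * A + (1 - 1 / p) * (s / C) * C"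
    unfolding q_def using s C by (intro le) simp
  also have "(1 - 1 / p) * (s / C) * C = (1 - 1 / p) * s" using C by simp
  finally have "s / p \<le> q / p * A" by (simp add: algebra_simps)
  then have "s \<le> q * A" using p by (simp add: divide_right_mono field_simps)
  then have "s powr (p - 1) * s \<le> s powr (p - 1) * (q * A)"
    by (rule mult_left_mono[OF _ powr_ge_zero])
  moreover have "s powr (p - 1) * s = s powr p"
    using s powr_add[of s "p - 1" 1] by simp
  moreover have "s powr (p - 1) * q = C powr (p - 1)"
  proof -
    have "q = s powr (1 - p) / C powr (1 - p)"
      unfolding q_def using s C by (simp add: powr_divide)
    then have "s powr (p - 1) * q = (s powr (p - 1) * s powr (1 - p)) / C powr (1 - p)" by simp
    also have "s powr (p - 1) * s powr (1 - p) = 1"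
      using s by (simp add: powr_add[symmetric])
    also have "1 / C powr (1 - p) = C powr (p - 1)"
      using powr_minus_divide[of C "1 - p"] by simp
    finally show ?thesis .
  qed
  ultimately show ?thesis by (simp add: mult.assoc[symmetric])
qed

text \<open>Norms are at most 1, not equal to 1, because \<open>pi_aff\<close> with dilation
  parameter 0 gives the zero vector and the index type contains such points. The hypotheses are
  symmetric in \<open>e\<close> and \<open>h\<close>, so the locale can be interpreted a second time
  with the families exchanged.\<close>

locale Bessel_multiplier =
  fixes \<mu> :: "'x measure" and e h :: "'x \<Rightarrow> 'a::euclidean_space l2" and C :: real
    and m :: "'x \<Rightarrow> complex" and p :: real
  assumes e_measurable [measurable]: "\<And>f. (\<lambda>x. cinner f (e x)) \<in> borel_measurable \<mu>"
    and h_measurable [measurable]: "\<And>f. (\<lambda>x. cinner f (h x)) \<in> borel_measurable \<mu>"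
    and e_norm: "\<And>x. norm (e x) \<le> 1" and h_norm: "\<And>x. norm (h x) \<le> 1"
    and e_Bessel: "\<And>f. (\<integral>\<^sup>+x. ennreal ((cmod (cinner f (e x)))\<^sup>2) \<partial>\<mu>) \<le> ennreal (C * (norm f)\<^sup>2)"
    and h_Bessel: "\<And>f. (\<integral>\<^sup>+x. ennreal ((cmod (cinner f (h x)))\<^sup>2) \<partial>\<mu>) \<le> ennreal (C * (norm f)\<^sup>2)"
    and C: "0 < C"
    and m_measurable [measurable]: "m \<in> borel_measurable \<mu>"
    and m_p: "integrable \<mu> (\<lambda>x. cmod (m x) powr p)" and p: "1 \<le> p"
begin

definition w :: "'a l2 \<Rightarrow> 'a l2 \<Rightarrow> 'x \<Rightarrow> real" where
  "w f g x = cmod (cinner f (e x)) * cmod (cinner g (h x))"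

definition B :: "'a l2 \<Rightarrow> 'a l2 \<Rightarrow> 'x \<Rightarrow> complex" where
  "B f g x = m x * cinner f (e x) * cinner (h x) g"

lemma h_measurable' [measurable]: "(\<lambda>x. cinner (h x) g) \<in> borel_measurable \<mu>"
  unfolding cinner_commute[of "h _" g] by measurable

lemma w_measurable [measurable]: "w f g \<in> borel_measurable \<mu>"
  unfolding w_def by measurable

lemma B_measurable [measurable]: "B f g \<in> borel_measurable \<mu>"
  unfolding B_def by measurable

lemma w_nonneg: "0 \<le> w f g x"
  by (simp add: w_def)

lemma cmod_B: "cmod (B f g x) = cmod (m x) * w f g x"
  by (simp add: B_def w_def norm_mult cinner_commute[of "h x" g] mult_ac)

lemma w_le_norm: "w f g x \<le> norm f * norm g"
proof -
  have "cmod (cinner f (e x)) \<le> norm f * 1"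
    by (rule order_trans[OF cinner_Cauchy_Schwarz]) (intro mult_left_mono e_norm norm_ge_zero)
  moreover have "cmod (cinner g (h x)) \<le> norm g * 1"
    by (rule order_trans[OF cinner_Cauchy_Schwarz]) (intro mult_left_mono h_norm norm_ge_zero)
  ultimately show ?thesis
    unfolding w_def by (intro mult_mono) auto
qed

text \<open>The arithmetic-geometric mean inequality reduces the product to the two Bessel
  integrals; on unit vectors the resulting bound is \<open>C\<close>, as from
  Cauchy-Schwarz.\<close>

lemma w_integral:
  shows w_integrable: "integrable \<mu> (w f g)"
    and w_integral_le: "(LINT x|\<mu>. w f g x) \<le> C * ((norm f)\<^sup>2 + (norm g)\<^sup>2) / 2"
proof -
  let ?e = "\<lambda>x. (cmod (cinner f (e x)))\<^sup>2" and ?h = "\<lambda>x. (cmod (cinner g (h x)))\<^sup>2"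
  have e: "integrable \<mu> ?e"
    using le_less_trans[OF e_Bessel[of f] ennreal_less_top] by (simp add: integrable_iff_bounded)
  have h: "integrable \<mu> ?h"
    using le_less_trans[OF h_Bessel[of g] ennreal_less_top] by (simp add: integrable_iff_bounded)
  have e_le: "(LINT x|\<mu>. ?e x) \<le> C * (norm f)\<^sup>2"
    using e_Bessel[of f] nn_integral_eq_integral[OF e] C by (simp add: ennreal_le_iff)
  have h_le: "(LINT x|\<mu>. ?h x) \<le> C * (norm g)\<^sup>2"
    using h_Bessel[of g] nn_integral_eq_integral[OF h] C by (simp add: ennreal_le_iff)
  have le: "w f g x \<le> (?e x + ?h x) / 2" for x
    using sum_squares_bound[of "cmod (cinner f (e x))" "cmod (cinner g (h x))"]
    by (simp add: w_def)
  have eh: "integrable \<mu> (\<lambda>x. (?e x + ?h x) / 2)" using e h by simp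
  show w: "integrable \<mu> (w f g)"
    by (rule Bochner_Integration.integrable_bound[OF eh])
      (use le w_nonneg in \<open>auto intro: order_trans[OF _ abs_ge_self]\<close>)
  have "(LINT x|\<mu>. w f g x) \<le> (LINT x|\<mu>. (?e x + ?h x) / 2)"
    by (rule integral_mono[OF w eh le])
  also have "\<dots> = ((LINT x|\<mu>. ?e x) + (LINT x|\<mu>. ?h x)) / 2"
    using e h by simp
  also have "\<dots> \<le> C * ((norm f)\<^sup>2 + (norm g)\<^sup>2) / 2"
    using e_le h_le by (simp add: distrib_left)
  finally show "(LINT x|\<mu>. w f g x) \<le> C * ((norm f)\<^sup>2 + (norm g)\<^sup>2) / 2" .
qed

lemma powr_w_integrable: "integrable \<mu> (\<lambda>x. cmod (m x) powr p * w f g x)"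
proof (rule Bochner_Integration.integrable_bound)
  show "integrable \<mu> (\<lambda>x. cmod (m x) powr p * (norm f * norm g))"
    using m_p by simp
  show "AE x in \<mu>. norm (cmod (m x) powr p * w f g x) \<le> norm (cmod (m x) powr p * (norm f * norm g))"
    using w_nonneg w_le_norm by (intro AE_I2) (simp add: abs_mult mult_left_mono)
qed measurable

lemma B_integrable: "integrable \<mu> (B f g)"
proof (rule Bochner_Integration.integrable_bound)
  show "integrable \<mu> (\<lambda>x. cmod (m x) powr p * w f g x + w f g x)"
    by (intro Bochner_Integration.integrable_add powr_w_integrable w_integrable)
  show "AE x in \<mu>. norm (B f g x) \<le> norm (cmod (m x) powr p * w f g x + w f g x)"
  proof (rule AE_I2)
    fix x
    have "cmod (m x) * w f g x \<le> (cmod (m x) powr p + 1) * w f g x"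
      by (intro mult_right_mono le_powr_add_1 p w_nonneg norm_ge_zero)
    then show "norm (B f g x) \<le> norm (cmod (m x) powr p * w f g x + w f g x)"
      by (simp add: cmod_B distrib_right)
  qed
qed measurable

text \<open>The tangent line inequality at \<open>cmod (m x)\<close>, integrated against the weight
  \<open>w f g\<close>, whose mass is at most \<open>C\<close> for vectors in the unit ball. The
  scale \<open>t\<close> stays free so that it can be chosen after integration, separately for each
  pair of vectors.\<close>

lemma B_integral_tangent:
  assumes t: "0 < t" and f: "norm f \<le> 1" and g: "norm g \<le> 1"
  shows "cmod (LINT x|\<mu>. B f g x)
    \<le> t powr (1 - p) / p * (LINT x|\<mu>. cmod (m x) powr p * w f g x) + (1 - 1 / p) * t * C"
proof -
  have "cmod (LINT x|\<mu>. B f g x) \<le> (LINT x|\<mu>. cmod (B f g x))"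
    by (rule integral_norm_bound)
  also have "\<dots> \<le> (LINT x|\<mu>. t powr (1 - p) / p * (cmod (m x) powr p * w f g x) + (1 - 1 / p) * t * w f g x)"
  proof (rule integral_mono)
    show "integrable \<mu> (\<lambda>x. cmod (B f g x))" by (intro integrable_norm B_integrable)
    show "integrable \<mu> (\<lambda>x. t powr (1 - p) / p * (cmod (m x) powr p * w f g x) + (1 - 1 / p) * t * w f g x)"
      by (intro Bochner_Integration.integrable_add integrable_mult_right powr_w_integrable w_integrable)
    fix x
    have "cmod (m x) * w f g x \<le> (t powr (1 - p) / p * cmod (m x) powr p + (1 - 1 / p) * t) * w f g x"
      by (intro mult_right_mono tangent_line_powr p t w_nonneg norm_ge_zero)
    then show "cmod (B f g x) \<le> t powr (1 - p) / p * (cmod (m x) powr p * w f g x) + (1 - 1 / p) * t * w f g x"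
      unfolding cmod_B by (simp add: distrib_right mult.assoc)
  qed
  also have "\<dots> = t powr (1 - p) / p * (LINT x|\<mu>. cmod (m x) powr p * w f g x) + (1 - 1 / p) * t * (LINT x|\<mu>. w f g x)"
    using powr_w_integrable w_integrable by (subst Bochner_Integration.integral_add) auto
  also have "\<dots> \<le> t powr (1 - p) / p * (LINT x|\<mu>. cmod (m x) powr p * w f g x) + (1 - 1 / p) * t * C"
  proof -
    have "(norm f)\<^sup>2 \<le> 1" "(norm g)\<^sup>2 \<le> 1"
      using f g by (simp_all add: power_le_one)
    then have "C * ((norm f)\<^sup>2 + (norm g)\<^sup>2) / 2 \<le> C * (1 + 1) / 2"
      using C by (intro divide_right_mono mult_left_mono add_mono) auto
    with w_integral_le[of f g] have "(LINT x|\<mu>. w f g x) \<le> C" by simp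
    then show ?thesis using p t by (intro add_left_mono mult_left_mono) auto
  qed
  finally show ?thesis .
qed

lemma B_sesquilinear:
  shows "B f (g + g') x = B f g x + B f g' x"
    and "B f (scaleC c g) x = cnj c * B f g x"
    and "B (scaleC c f) g x = c * B f g x"
  by (simp_all add: B_def cinner_add_right algebra_simps)

text \<open>On unit vectors \<open>B_integral_tangent\<close> at \<open>t = 1\<close> and
  \<open>w f g x \<le> 1\<close> give a uniform bound, which homogeneity extends. This is the
  boundedness that the Riesz representation requires.\<close>

lemma B_integral_bound: "\<exists>K. \<forall>g. cmod (LINT x|\<mu>. B f g x) \<le> K * norm g"
proof -
  define I where "I = (LINT x|\<mu>. cmod (m x) powr p)"
  define K where "K = 1 / p * I + (1 - 1 / p) * C"
  have unit: "cmod (LINT x|\<mu>. B f g x) \<le> K" if "norm f = 1" "norm g = 1" for f g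
  proof -
    have "(LINT x|\<mu>. cmod (m x) powr p * w f g x) \<le> I"
      unfolding I_def
    proof (rule integral_mono[OF powr_w_integrable m_p])
      fix x
      have "cmod (m x) powr p * w f g x \<le> cmod (m x) powr p * 1"
        using w_le_norm[of f g x] that by (intro mult_left_mono) auto
      then show "cmod (m x) powr p * w f g x \<le> cmod (m x) powr p" by simp
    qed
    then have "1 / p * (LINT x|\<mu>. cmod (m x) powr p * w f g x) \<le> 1 / p * I"
      using p by (intro mult_left_mono) auto
    then show ?thesis
      using B_integral_tangent[of 1 f g] that by (simp add: K_def)
  qed
  have "cmod (LINT x|\<mu>. B f g x) \<le> K * norm f * norm g" for g
  proof (cases "f = 0 \<or> g = 0")
    case True
    then have "B f g = (\<lambda>x. 0)" by (auto simp: B_def)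
    then show ?thesis using True by auto
  next
    case False
    define f' where "f' = scaleC (1 / norm f) f"
    define g' where "g' = scaleC (1 / norm g) g"
    have f: "f = scaleC (norm f) f'" and g: "g = scaleC (norm g) g'"
      using False by (simp_all add: f'_def g'_def)
    have "B f g x = norm f * norm g * B f' g' x" for x
      by (subst f, subst g) (simp add: B_sesquilinear)
    then have "(LINT x|\<mu>. B f g x) = norm f * norm g * (LINT x|\<mu>. B f' g' x)"
      by simp
    then have "cmod (LINT x|\<mu>. B f g x) = norm f * norm g * cmod (LINT x|\<mu>. B f' g' x)"
      by (simp add: norm_mult)
    also have "\<dots> \<le> norm f * norm g * K"
      using False by (intro mult_left_mono unit) (simp_all add: f'_def g'_def norm_divide)
    finally show ?thesis by (simp add: mult_ac)
  qed
  then show ?thesis by blast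
qed

lemma multiplier_exists:
  obtains M where "\<And>f g. (LINT x|\<mu>. B f g x) = cinner (M f) g"
proof -
  have "\<exists>z. \<forall>g. (LINT x|\<mu>. B f g x) = cinner z g" for f
  proof -
    obtain K where K: "\<And>g. cmod (LINT x|\<mu>. B f g x) \<le> K * norm g"
      using B_integral_bound[of f] by blast
    show ?thesis
    proof (rule sesquilinear_form_representation[OF _ _ K])
      show "(LINT x|\<mu>. B f (g + g') x) = (LINT x|\<mu>. B f g x) + (LINT x|\<mu>. B f g' x)" for g g'
        unfolding B_sesquilinear by (intro Bochner_Integration.integral_add B_integrable)
      show "(LINT x|\<mu>. B f (scaleC c g) x) = cnj c * (LINT x|\<mu>. B f g x)" for c g
        unfolding B_sesquilinear by simp
    qed
  qed
  then have "\<forall>f. \<exists>z. \<forall>g. (LINT x|\<mu>. B f g x) = cinner z g" by blast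
  from choice[OF this] show thesis using that by blast
qed

text \<open>At a fixed \<open>x\<close>, the arithmetic-geometric mean inequality splits the sum
  into two Bessel sums, one for the vector \<open>e x\<close> and one for \<open>h x\<close>, each
  at most 1.\<close>

lemma w_orthonormal_sum:
  assumes "finite F" "orthonormal_on F (\<lambda>u. u)" "orthonormal_on F v"
  shows "(\<Sum>u\<in>F. w u (v u) x) \<le> 1"
proof -
  have "(\<Sum>u\<in>F. w u (v u) x)
      \<le> (\<Sum>u\<in>F. ((cmod (cinner (e x) u))\<^sup>2 + (cmod (cinner (h x) (v u)))\<^sup>2) / 2)"
  proof (rule sum_mono)
    fix u
    show "w u (v u) x \<le> ((cmod (cinner (e x) u))\<^sup>2 + (cmod (cinner (h x) (v u)))\<^sup>2) / 2"
      using sum_squares_bound[of "cmod (cinner (e x) u)" "cmod (cinner (h x) (v u))"]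
      by (simp add: w_def cinner_commute[of u "e x"] cinner_commute[of "v u" "h x"])
  qed
  also have "\<dots> = ((\<Sum>u\<in>F. (cmod (cinner (e x) u))\<^sup>2) + (\<Sum>u\<in>F. (cmod (cinner (h x) (v u)))\<^sup>2)) / 2"
    by (simp add: sum.distrib sum_divide_distrib[symmetric])
  also have "\<dots> \<le> ((norm (e x))\<^sup>2 + (norm (h x))\<^sup>2) / 2"
    by (intro divide_right_mono add_mono Bessel_inequality assms) simp
  also have "\<dots> \<le> (1 + 1) / 2"
    using e_norm[of x] h_norm[of x] by (intro divide_right_mono add_mono power_le_one) auto
  finally show ?thesis by simp
qed

lemma multiplier_diagonal_sum:
  assumes M: "\<And>f g. (LINT x|\<mu>. B f g x) = cinner (M f) g"
    and F: "finite F" "orthonormal_on F (\<lambda>u. u)" "orthonormal_on F v"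
  shows "(\<Sum>u\<in>F. cmod (cinner (M u) (v u)) powr p) \<le> C powr (p - 1) * (LINT x|\<mu>. cmod (m x) powr p)"
proof -
  define A where "A u = (LINT x|\<mu>. cmod (m x) powr p * w u (v u) x)" for u
  have "cmod (cinner (M u) (v u)) powr p \<le> C powr (p - 1) * A u" if u: "u \<in> F" for u
  proof (rule powr_le_of_tangent_lines[OF p norm_ge_zero C])
    show "0 \<le> A u" unfolding A_def by (rule Bochner_Integration.integral_nonneg) (simp add: w_nonneg)
    have "cinner u u = 1" "cinner (v u) (v u) = 1"
      using F u by (simp_all add: orthonormal_on_def)
    then have "norm u = 1" "norm (v u) = 1" by (simp_all only: cinner_self_eq_1_iff)
    then show "cmod (cinner (M u) (v u)) \<le> t powr (1 - p) / p * A u + (1 - 1 / p) * t * C"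
      if "0 < t" for t
      unfolding A_def M[symmetric] using that by (intro B_integral_tangent) auto
  qed
  then have "(\<Sum>u\<in>F. cmod (cinner (M u) (v u)) powr p) \<le> (\<Sum>u\<in>F. C powr (p - 1) * A u)"
    by (rule sum_mono)
  also have "\<dots> = C powr (p - 1) * (LINT x|\<mu>. (\<Sum>u\<in>F. cmod (m x) powr p * w u (v u) x))"
  proof -
    have "(LINT x|\<mu>. (\<Sum>u\<in>F. cmod (m x) powr p * w u (v u) x)) = (\<Sum>u\<in>F. A u)"
      unfolding A_def by (rule Bochner_Integration.integral_sum) (rule powr_w_integrable)
    then show ?thesis by (simp only: sum_distrib_left)
  qed
  also have "\<dots> \<le> C powr (p - 1) * (LINT x|\<mu>. cmod (m x) powr p)"
  proof (intro mult_left_mono integral_mono m_p Bochner_Integration.integrable_sum powr_w_integrable)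
    fix x
    have "cmod (m x) powr p * (\<Sum>u\<in>F. w u (v u) x) \<le> cmod (m x) powr p * 1"
      by (intro mult_left_mono w_orthonormal_sum F) simp
    then show "(\<Sum>u\<in>F. cmod (m x) powr p * w u (v u) x) \<le> cmod (m x) powr p"
      by (simp add: sum_distrib_left)
  qed simp
  finally show ?thesis .
qed

theorem multiplier_schatten:
  shows "\<exists>!M. \<forall>f g. has_bochner_integral \<mu> (B f g) (cinner (M f) g)"
    and "\<And>M. \<forall>f g. has_bochner_integral \<mu> (B f g) (cinner (M f) g) \<Longrightarrow> M \<in> schatten_class p"
proof -
  have iff: "(\<forall>f g. has_bochner_integral \<mu> (B f g) (cinner (M f) g))
      \<longleftrightarrow> (\<forall>f g. (LINT x|\<mu>. B f g x) = cinner (M f) g)" for M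
    by (simp add: has_bochner_integral_iff B_integrable)
  show "\<exists>!M. \<forall>f g. has_bochner_integral \<mu> (B f g) (cinner (M f) g)"
    unfolding iff
  proof (rule ex_ex1I)
    show "\<exists>M. \<forall>f g. (LINT x|\<mu>. B f g x) = cinner (M f) g"
      using multiplier_exists by blast
    fix M M'
    assume "\<forall>f g. (LINT x|\<mu>. B f g x) = cinner (M f) g" "\<forall>f g. (LINT x|\<mu>. B f g x) = cinner (M' f) g"
    then have "cinner (M f) g = cinner (M' f) g" for f g by simp
    then show "M = M'" by (intro ext cinner_ext_left)
  qed
  fix M assume "\<forall>f g. has_bochner_integral \<mu> (B f g) (cinner (M f) g)"
  then have M: "\<And>f g. (LINT x|\<mu>. B f g x) = cinner (M f) g" unfolding iff by blast
  \<comment> \<open>The adjoint is the multiplier with conjugate symbol and exchanged families: its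
    integrand at \<open>(g, f)\<close> is the complex conjugate of \<open>B f g\<close>.\<close>
  interpret swapped: Bessel_multiplier \<mu> h e C "\<lambda>x. cnj (m x)" p
    by unfold_locales (use e_norm h_norm e_Bessel h_Bessel C p m_p in simp_all)
  obtain N where N: "\<And>f g. (LINT x|\<mu>. swapped.B f g x) = cinner (N f) g"
    using swapped.multiplier_exists by blast
  have adj: "cinner (M f) g = cinner f (N g)" for f g
  proof -
    have "cnj (swapped.B g f x) = B f g x" for x
      by (simp add: B_def swapped.B_def cinner_commute[of f "e x"] cinner_commute[of g "h x"]
          flip: cinner_commute[of "e x" f] cinner_commute[of "h x" g])
    then have "cinner (M f) g = (LINT x|\<mu>. cnj (swapped.B g f x))"
      by (simp add: M)
    also have "\<dots> = cinner f (N g)"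
      by (simp add: N flip: cinner_commute)
    finally show ?thesis .
  qed
  interpret summable_diagonals M N p "C powr (p - 1) * (LINT x|\<mu>. cmod (m x) powr p)"
    by unfold_locales (use adj multiplier_diagonal_sum[OF M] p in auto)
  show "M \<in> schatten_class p" by (rule M_in_schatten_class)
qed

end

section \<open>Plancherel inequalities\<close>

lemma nn_integral_lborel_affine:
  fixes f :: "'a::euclidean_space \<Rightarrow> ennreal"
  assumes [measurable]: "f \<in> borel_measurable borel" and c: "c \<noteq> 0"
  shows "(\<integral>\<^sup>+x. f x \<partial>lborel) = ennreal (\<bar>c\<bar> ^ DIM('a)) * (\<integral>\<^sup>+x. f (t + c *\<^sub>R x) \<partial>lborel)"
  by (subst lborel_affine[OF c, of t])
     (simp add: nn_integral_density nn_integral_distr nn_integral_cmult)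

lemma integral_lborel_affine:
  fixes f :: "'a::euclidean_space \<Rightarrow> 'b::{banach, second_countable_topology}"
  assumes [measurable]: "f \<in> borel_measurable borel" and c: "c \<noteq> 0"
  shows "(LINT x|lborel. f x) = \<bar>c\<bar> ^ DIM('a) *\<^sub>R (LINT x|lborel. f (t + c *\<^sub>R x))"
  by (subst lborel_affine[OF c, of t]) (simp add: integral_density integral_distr)

lemma integrable_lborel_affine:
  fixes f :: "'a::euclidean_space \<Rightarrow> 'b::{banach, second_countable_topology}"
  assumes f: "integrable lborel f" and c: "c \<noteq> 0"
  shows "integrable lborel (\<lambda>x. f (t + c *\<^sub>R x))"
proof -
  have [measurable]: "f \<in> borel_measurable borel" using borel_measurable_integrable[OF f] by simp
  have "ennreal (\<bar>c\<bar> ^ DIM('a)) * (\<integral>\<^sup>+x. ennreal (norm (f (t + c *\<^sub>R x))) \<partial>lborel) < \<infinity>"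
    using f c by (subst nn_integral_lborel_affine[symmetric, where c = c and t = t])
      (simp_all add: integrable_iff_bounded)
  then show ?thesis
    using c by (auto simp: integrable_iff_bounded ennreal_mult_less_top)
qed

lemma norm_integral_le_nn_integral:
  fixes f :: "'a \<Rightarrow> 'b::{banach, second_countable_topology}"
  shows "ennreal (norm (integral\<^sup>L M f)) \<le> (\<integral>\<^sup>+x. ennreal (norm (f x)) \<partial>M)"
proof (cases "integrable M f")
  case True
  then show ?thesis by (rule integral_norm_bound_ennreal)
qed (simp add: not_integrable_integral_eq)

text \<open>Normalised so that its integral is 1 and it is its own Fourier transform in the
  convention of \<open>fourier\<close>.\<close>

definition gauss :: "'a::euclidean_space \<Rightarrow> real" where
  "gauss x = exp (- (pi * (norm x)\<^sup>2))"

lemma gauss_measurable [measurable]: "gauss \<in> borel_measurable borel"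
  unfolding gauss_def by measurable

lemma gauss_nonneg: "0 \<le> gauss x" and gauss_le_1: "gauss x \<le> 1"
  by (simp_all add: gauss_def)

lemma gauss_prod: "gauss x = (\<Prod>b\<in>Basis. gauss (x \<bullet> b))"
  unfolding gauss_def norm_eq_sqrt_inner[of x]
  by (subst euclidean_inner)
    (simp add: sum_nonneg exp_sum[symmetric] sum_negf sum_distrib_left power2_eq_square)

lemma cis_measurable [measurable]: "cis \<in> borel_measurable borel"
  by (intro borel_measurable_continuous_onI continuous_on_cis continuous_on_id)

text \<open>A rescaled characteristic function: substituting \<open>c * t\<close> with
  \<open>c = sqrt (2 * pi)\<close> turns the standard normal density into
  \<open>gauss t / c\<close>, and the frequency \<open>x\<close> into the argument \<open>s\<close>
  of \<open>char\<close>.\<close>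

lemma gauss_fourier_real:
  fixes x :: real
  shows "integrable lborel (\<lambda>t::real. complex_of_real (gauss t) * cis (- (2 * pi * (t * x))))"
    and "(LINT t|lborel. complex_of_real (gauss t) * cis (- (2 * pi * (t * x)))) = gauss x"
proof -
  define c where "c = sqrt (2 * pi)"
  have c: "c > 0" "c\<^sup>2 = 2 * pi" by (simp_all add: c_def)
  define s where "s = - (2 * pi * x) / c"
  let ?f = "\<lambda>u. complex_of_real (std_normal_density u) * iexp (s * u)"
  have f_c: "?f (0 + c * t) = complex_of_real (1 / c) * (complex_of_real (gauss t) * cis (- (2 * pi * (t * x))))" for t
  proof -
    have "std_normal_density (c * t) = 1 / c * gauss t"
      using c by (simp add: std_normal_density_def gauss_def c_def[symmetric] power_mult_distrib)
    moreover have "iexp (s * (c * t)) = cis (- (2 * pi * (t * x)))"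
      using c by (simp add: cis_conv_exp s_def mult_ac)
    ultimately show ?thesis by simp
  qed
  have int: "integrable lborel ?f"
  proof -
    interpret prob_space std_normal_distribution by (rule prob_space_normal_density) simp
    have "integrable std_normal_distribution (\<lambda>u. iexp (s * u))" by (rule integrable_iexp) auto
    then show ?thesis
      by (subst (asm) integrable_density) (auto simp: scaleR_conv_of_real)
  qed
  then have "integrable lborel (\<lambda>t. ?f (0 + c * t))"
    using c by (intro lborel_integrable_real_affine) auto
  then show "integrable lborel (\<lambda>t::real. complex_of_real (gauss t) * cis (- (2 * pi * (t * x))))"
  proof -
    assume "integrable lborel (\<lambda>t. ?f (0 + c * t))"
    then have "integrable lborel (\<lambda>t. complex_of_real c * ?f (0 + c * t))" by simp
    moreover have "complex_of_real c * ?f (0 + c * t) = complex_of_real (gauss t) * cis (- (2 * pi * (t * x)))" for t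
      unfolding f_c using c(1) by simp
    ultimately show ?thesis by simp
  qed
  have "char std_normal_distribution s = (LINT u|lborel. ?f u)"
    unfolding char_def by (subst integral_density) (auto simp: scaleR_conv_of_real)
  also have "\<dots> = \<bar>c\<bar> *\<^sub>R (LINT t|lborel. ?f (0 + c * t))"
    using c by (intro lborel_integral_real_affine) auto
  also have "\<dots> = (LINT t|lborel. complex_of_real (gauss t) * cis (- (2 * pi * (t * x))))"
    unfolding f_c using c by (simp add: scaleR_conv_of_real)
  finally have "(LINT t|lborel. complex_of_real (gauss t) * cis (- (2 * pi * (t * x)))) = exp (- (s\<^sup>2) / 2)"
    by (simp add: char_std_normal_distribution)
  also have "s\<^sup>2 / 2 = pi * x\<^sup>2"
    using c by (simp add: s_def power_divide power_mult_distrib power2_eq_square)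
  then have "exp (- (s\<^sup>2) / 2) = gauss x" by (simp add: gauss_def)
  finally show "(LINT t|lborel. complex_of_real (gauss t) * cis (- (2 * pi * (t * x)))) = gauss x" .
qed

text \<open>\<open>lborel\<close> is the image of a finite product of one-dimensional Lebesgue
  measures under the coordinate map, so the product rule for such measures applies.\<close>

lemma lborel_integral_prod_Basis:
  fixes f :: "'a::euclidean_space \<Rightarrow> real \<Rightarrow> complex"
  assumes f: "\<And>b. b \<in> Basis \<Longrightarrow> integrable lborel (f b)"
  shows "integrable lborel (\<lambda>x. \<Prod>b\<in>Basis. f b (x \<bullet> b))"
    and "(LINT x|lborel. (\<Prod>b\<in>Basis. f b (x \<bullet> b))) = (\<Prod>b\<in>Basis. LINT t|lborel. f b t)"
proof -
  interpret product_sigma_finite "\<lambda>_::'a. lborel :: real measure" ..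
  have [measurable]: "f b \<in> borel_measurable borel" if "b \<in> Basis" for b
    using borel_measurable_integrable[OF f[OF that]] by simp
  have T [measurable]: "(\<lambda>g. \<Sum>b\<in>Basis. g b *\<^sub>R b) \<in> (\<Pi>\<^sub>M b\<in>(Basis::'a set). (lborel :: real measure)) \<rightarrow>\<^sub>M borel"
    by measurable
  have eq: "(\<Prod>b\<in>Basis. f b ((\<Sum>b\<in>Basis. g b *\<^sub>R b) \<bullet> b)) = (\<Prod>b\<in>Basis. f b (g b))" for g
    by (intro prod.cong refl) simp
  show "integrable lborel (\<lambda>x. \<Prod>b\<in>Basis. f b (x \<bullet> b))"
    unfolding lborel_eq[where 'a = 'a]
    by (subst integrable_distr_eq[OF T]) (auto simp: eq f intro!: product_integrable_prod)
  show "(LINT x|lborel. (\<Prod>b\<in>Basis. f b (x \<bullet> b))) = (\<Prod>b\<in>Basis. LINT t|lborel. f b t)"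
    unfolding lborel_eq[where 'a = 'a]
    by (subst integral_distr[OF T]) (auto simp: eq f intro!: product_integral_prod)
qed

lemma cis_sum: "finite I \<Longrightarrow> cis (\<Sum>i\<in>I. f i) = (\<Prod>i\<in>I. cis (f i))"
  by (induction I rule: finite_induct) (simp_all add: cis_mult[symmetric])

lemma gauss_fourier:
  fixes x :: "'a::euclidean_space"
  shows gauss_fourier_integrable: "integrable lborel (\<lambda>t::'a. complex_of_real (gauss t) * cis (- (2 * pi * (t \<bullet> x))))"
    and gauss_fourier_integral: "(LINT t|lborel. complex_of_real (gauss t) * cis (- (2 * pi * (t \<bullet> x)))) = gauss x"
proof -
  let ?f = "\<lambda>b t. complex_of_real (gauss t) * cis (- (2 * pi * (t * (x \<bullet> b))))"
  have eq: "complex_of_real (gauss t) * cis (- (2 * pi * (t \<bullet> x))) = (\<Prod>b\<in>Basis. ?f b (t \<bullet> b))" for t :: 'a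
  proof -
    have "- (2 * pi * (t \<bullet> x)) = (\<Sum>b\<in>Basis. - (2 * pi * (t \<bullet> b * (x \<bullet> b))))"
      by (subst euclidean_inner) (simp add: sum_distrib_left sum_negf)
    then have "cis (- (2 * pi * (t \<bullet> x))) = (\<Prod>b\<in>Basis. cis (- (2 * pi * (t \<bullet> b * (x \<bullet> b)))))"
      by (simp only: cis_sum finite_Basis)
    then show ?thesis by (simp add: gauss_prod[of t] prod.distrib)
  qed
  show "integrable lborel (\<lambda>t::'a. complex_of_real (gauss t) * cis (- (2 * pi * (t \<bullet> x))))"
    unfolding eq by (rule lborel_integral_prod_Basis(1)) (rule gauss_fourier_real)
  have "(LINT t|lborel. complex_of_real (gauss t) * cis (- (2 * pi * (t \<bullet> x)))) = (\<Prod>b\<in>Basis. LINT t|lborel. ?f b t)"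
    unfolding eq by (rule lborel_integral_prod_Basis(2)) (rule gauss_fourier_real)
  also have "\<dots> = gauss x"
    by (simp add: gauss_fourier_real(2) gauss_prod[of x])
  finally show "(LINT t|lborel. complex_of_real (gauss t) * cis (- (2 * pi * (t \<bullet> x)))) = gauss x" .
qed

lemma gauss_integral:
  shows gauss_integrable: "integrable lborel (gauss :: 'a::euclidean_space \<Rightarrow> real)"
    and gauss_integral_eq_1: "(LINT t|lborel. gauss (t::'a)) = 1"
proof -
  have "integrable lborel (\<lambda>t::'a. complex_of_real (gauss t))"
    using gauss_fourier_integrable[of "0::'a"] by simp
  then show "integrable lborel (gauss :: 'a \<Rightarrow> real)"
    by (simp add: complex_of_real_integrable_eq)
  have "complex_of_real (LINT t|lborel. gauss (t::'a)) = of_real 1"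
    using gauss_fourier_integral[of "0::'a"] by (simp add: gauss_def)
  then show "(LINT t|lborel. gauss (t::'a)) = 1"
    using of_real_eq_iff by blast
qed

lemma gauss_scaled_integrable: "c \<noteq> 0 \<Longrightarrow> integrable lborel (\<lambda>x::'a::euclidean_space. gauss (c *\<^sub>R x))"
  using integrable_lborel_affine[OF gauss_integrable, of c 0] by simp

text \<open>The Gaussian approximate identity of width \<open>e\<close>. By
  \<open>heat_eq_fourier\<close> it is the transform of the damping factor
  \<open>gauss (e *\<^sub>R \<omega>)\<close>.\<close>

definition heat :: "real \<Rightarrow> 'a::euclidean_space \<Rightarrow> real" where
  "heat e x = gauss (x /\<^sub>R e) / e ^ DIM('a)"

lemma heat_measurable [measurable]: "heat e \<in> borel_measurable borel"
  unfolding heat_def by measurable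

lemma heat_nonneg: "0 < e \<Longrightarrow> 0 \<le> heat e x"
  by (simp add: heat_def gauss_nonneg)

lemma heat_nn_integral:
  fixes s t :: "'a::euclidean_space"
  assumes e: "0 < e"
  shows "(\<integral>\<^sup>+s. ennreal (heat e (s - t)) \<partial>lborel) = 1"
    and "(\<integral>\<^sup>+t. ennreal (heat e (s - t)) \<partial>lborel) = 1"
proof -
  have g: "(\<integral>\<^sup>+x. ennreal (gauss (x::'a)) \<partial>lborel) = 1"
    using nn_integral_eq_integral[OF gauss_integrable[where 'a='a]]
    by (simp add: gauss_nonneg gauss_integral_eq_1)
  have e_n: "ennreal (e ^ DIM('a)) * ennreal (gauss x / e ^ DIM('a)) = ennreal (gauss x)" for x :: 'a
    using e by (simp add: ennreal_mult'[symmetric])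
  \<comment> \<open>The values \<open>c = 1\<close> and \<open>c = -1\<close> give the integral in
    the first and in the second variable of \<open>heat e (s - t)\<close>.\<close>
  have *: "(\<integral>\<^sup>+s. ennreal (heat e (c *\<^sub>R (s - t))) \<partial>lborel) = 1" if c: "\<bar>c\<bar> = 1" for c and t :: 'a
  proof -
    have "(\<integral>\<^sup>+s. ennreal (heat e (c *\<^sub>R (s - t))) \<partial>lborel)
        = ennreal (\<bar>c * e\<bar> ^ DIM('a)) * (\<integral>\<^sup>+x. ennreal (heat e (c *\<^sub>R (t + (c * e) *\<^sub>R x - t))) \<partial>lborel)"
      using e c by (intro nn_integral_lborel_affine) auto
    also have "\<dots> = (\<integral>\<^sup>+x. ennreal (e ^ DIM('a)) * ennreal (gauss (x::'a) / e ^ DIM('a)) \<partial>lborel)"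
    proof -
      have "c * c = 1" using c by (metis abs_mult_self_eq mult_1)
      then have "heat e (c *\<^sub>R (t + (c * e) *\<^sub>R x - t)) = gauss x / e ^ DIM('a)" for x
        using e by (simp add: heat_def mult.assoc[symmetric])
      moreover have "\<bar>c * e\<bar> = e" using c e by (simp add: abs_mult)
      ultimately show ?thesis by (simp add: nn_integral_cmult)
    qed
    finally show ?thesis by (simp add: e_n g)
  qed
  show "(\<integral>\<^sup>+s. ennreal (heat e (s - t)) \<partial>lborel) = 1"
    using *[of 1 t] by simp
  show "(\<integral>\<^sup>+t. ennreal (heat e (s - t)) \<partial>lborel) = 1"
    using *[of "-1" s] by simp
qed

lemma heat_eq_fourier:
  assumes e: "0 < e"
  shows "(LINT \<omega>|lborel. complex_of_real (gauss (e *\<^sub>R \<omega>)) * cis (- (2 * pi * (z \<bullet> \<omega>)))) = heat e (z :: 'a::euclidean_space)"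
proof -
  let ?f = "\<lambda>\<omega>::'a. complex_of_real (gauss (e *\<^sub>R \<omega>)) * cis (- (2 * pi * (z \<bullet> \<omega>)))"
  have "(LINT \<omega>|lborel. ?f \<omega>) = \<bar>inverse e\<bar> ^ DIM('a) *\<^sub>R (LINT \<omega>|lborel. ?f (0 + inverse e *\<^sub>R \<omega>))"
    using e by (intro integral_lborel_affine) auto
  also have "(\<lambda>\<omega>. ?f (0 + inverse e *\<^sub>R \<omega>)) = (\<lambda>\<omega>. complex_of_real (gauss \<omega>) * cis (- (2 * pi * (\<omega> \<bullet> (z /\<^sub>R e)))))"
    using e by (simp add: fun_eq_iff inner_commute)
  finally show ?thesis
    unfolding gauss_fourier_integral using e
    by (simp add: heat_def scaleR_conv_of_real divide_inverse power_inverse mult.commute)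
qed

section \<open>Damped Fourier inversion and the two Plancherel estimates\<close>

lemma fourier_cis: "fourier g \<omega> = (LINT t|lborel. g t * cis (- (2 * pi * (t \<bullet> \<omega>))))"
  unfolding fourier_def cis_conv_exp by (simp add: mult_ac)

lemma fourier_measurable [measurable]:
  assumes [measurable]: "g \<in> borel_measurable borel"
  shows "fourier g \<in> borel_measurable borel"
proof -
  have "(\<lambda>\<omega>. LINT t|lborel. g t * cis (- (2 * pi * (t \<bullet> \<omega>)))) \<in> borel_measurable borel"
    by measurable
  then show ?thesis unfolding fourier_cis[abs_def] .
qed

lemma fourier_bound: "cmod (fourier g \<omega>) \<le> (LINT t|lborel. cmod (g t))"
  unfolding fourier_cis by (rule order_trans[OF integral_norm_bound]) (simp add: norm_mult)

text \<open>Supplies the absolute integrability for the two interchanges of integration below, in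
  which \<open>k\<close> is a unimodular phase.\<close>

lemma integrable_product_times_bounded:
  fixes u :: "'a::euclidean_space \<Rightarrow> complex" and v :: "'b::euclidean_space \<Rightarrow> complex"
  assumes u: "integrable lborel u" and v: "integrable lborel v"
    and k [measurable]: "(\<lambda>(x, y). k x y) \<in> borel_measurable (lborel \<Otimes>\<^sub>M lborel)"
    and k_le: "\<And>x y. cmod (k x y) \<le> 1"
  shows "integrable (lborel \<Otimes>\<^sub>M lborel) (\<lambda>(x, y). u x * v y * k x y)"
proof -
  have [measurable]: "u \<in> borel_measurable borel" "v \<in> borel_measurable borel"
    using borel_measurable_integrable[OF u] borel_measurable_integrable[OF v] by simp_all
  have "integrable (lborel \<Otimes>\<^sub>M lborel) (\<lambda>(x, y). u x * v y)"
    using u v by (intro lborel_pair.Fubini_integrable) (auto simp: norm_mult)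
  then show ?thesis
  proof (rule Bochner_Integration.integrable_bound)
    show "AE z in lborel \<Otimes>\<^sub>M lborel. cmod (case z of (x, y) \<Rightarrow> u x * v y * k x y) \<le> cmod (case z of (x, y) \<Rightarrow> u x * v y)"
      by (rule AE_I2) (auto simp: norm_mult mult_left_le k_le)
  qed measurable
qed

text \<open>The Gaussian damping makes the double integral absolutely convergent. Carrying out the
  frequency integral first leaves the kernel \<open>heat\<close>.\<close>

lemma fourier_gauss_inverse:
  assumes u: "integrable lborel u" and e: "0 < e"
  shows "(LINT \<omega>|lborel. fourier u \<omega> * complex_of_real (gauss (e *\<^sub>R \<omega>)) * cis (2 * pi * (t \<bullet> \<omega>)))
    = (LINT s|lborel. u s * complex_of_real (heat e (s - t)))"
proof -
  have [measurable]: "u \<in> borel_measurable borel"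
    using borel_measurable_integrable[OF u] by simp
  let ?k = "\<lambda>s \<omega>. cis (- (2 * pi * ((s - t) \<bullet> \<omega>)))"
  have int: "integrable (lborel \<Otimes>\<^sub>M lborel) (\<lambda>(s, \<omega>). u s * complex_of_real (gauss (e *\<^sub>R \<omega>)) * ?k s \<omega>)"
  proof (rule integrable_product_times_bounded[OF u])
    show "integrable lborel (\<lambda>\<omega>. complex_of_real (gauss (e *\<^sub>R \<omega>)))"
      using gauss_scaled_integrable[of e] e by (simp add: complex_of_real_integrable_eq)
  qed (simp_all add: split_beta')
  have "(LINT \<omega>|lborel. fourier u \<omega> * complex_of_real (gauss (e *\<^sub>R \<omega>)) * cis (2 * pi * (t \<bullet> \<omega>)))
      = (LINT \<omega>|lborel. LINT s|lborel. u s * complex_of_real (gauss (e *\<^sub>R \<omega>)) * ?k s \<omega>)"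
  proof (intro Bochner_Integration.integral_cong refl)
    fix \<omega>
    have "fourier u \<omega> * complex_of_real (gauss (e *\<^sub>R \<omega>)) * cis (2 * pi * (t \<bullet> \<omega>))
        = (LINT s|lborel. u s * cis (- (2 * pi * (s \<bullet> \<omega>)))) * (complex_of_real (gauss (e *\<^sub>R \<omega>)) * cis (2 * pi * (t \<bullet> \<omega>)))"
      by (simp add: fourier_cis mult.assoc)
    also have "\<dots> = (LINT s|lborel. u s * cis (- (2 * pi * (s \<bullet> \<omega>))) * (complex_of_real (gauss (e *\<^sub>R \<omega>)) * cis (2 * pi * (t \<bullet> \<omega>))))"
      by (rule integral_mult_left_zero[symmetric])
    also have "\<dots> = (LINT s|lborel. u s * complex_of_real (gauss (e *\<^sub>R \<omega>)) * ?k s \<omega>)"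
    proof (intro Bochner_Integration.integral_cong refl)
      fix s
      have "?k s \<omega> = cis (- (2 * pi * (s \<bullet> \<omega>))) * cis (2 * pi * (t \<bullet> \<omega>))"
        by (simp add: cis_mult inner_diff_left algebra_simps)
      then show "u s * cis (- (2 * pi * (s \<bullet> \<omega>))) * (complex_of_real (gauss (e *\<^sub>R \<omega>)) * cis (2 * pi * (t \<bullet> \<omega>)))
          = u s * complex_of_real (gauss (e *\<^sub>R \<omega>)) * ?k s \<omega>"
        by (simp add: mult_ac)
    qed
    finally show "fourier u \<omega> * complex_of_real (gauss (e *\<^sub>R \<omega>)) * cis (2 * pi * (t \<bullet> \<omega>))
        = (LINT s|lborel. u s * complex_of_real (gauss (e *\<^sub>R \<omega>)) * ?k s \<omega>)" .
  qed
  also have "\<dots> = (LINT s|lborel. LINT \<omega>|lborel. u s * complex_of_real (gauss (e *\<^sub>R \<omega>)) * ?k s \<omega>)"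
    by (rule lborel_pair.Fubini_integral[OF int])
  also have "\<dots> = (LINT s|lborel. u s * complex_of_real (heat e (s - t)))"
  proof (intro Bochner_Integration.integral_cong refl)
    fix s
    have "(LINT \<omega>|lborel. u s * complex_of_real (gauss (e *\<^sub>R \<omega>)) * ?k s \<omega>)
        = u s * (LINT \<omega>|lborel. complex_of_real (gauss (e *\<^sub>R \<omega>)) * ?k s \<omega>)"
      by (subst integral_mult_right_zero[symmetric]) (simp add: mult.assoc)
    then show "(LINT \<omega>|lborel. u s * complex_of_real (gauss (e *\<^sub>R \<omega>)) * ?k s \<omega>)
        = u s * complex_of_real (heat e (s - t))"
      by (simp only: heat_eq_fourier[OF e])
  qed
  finally show ?thesis .
qed

text \<open>A regularised Plancherel identity: only the conjugate factor of
  \<open>|fourier u|^2\<close> is expanded as an integral, and the other factor is recovered by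
  damped inversion. Letting \<open>e\<close> tend to 0 yields both Plancherel estimates.\<close>

lemma fourier_gauss_energy:
  assumes u: "integrable lborel u" and e: "0 < e"
  shows "complex_of_real (LINT \<omega>|lborel. (cmod (fourier u \<omega>))\<^sup>2 * gauss (e *\<^sub>R \<omega>))
    = (LINT t|lborel. cnj (u t) * (LINT s|lborel. u s * complex_of_real (heat e (s - t))))"
    and "integrable lborel (\<lambda>\<omega>. (cmod (fourier u \<omega>))\<^sup>2 * gauss (e *\<^sub>R \<omega>))"
proof -
  have [measurable]: "u \<in> borel_measurable borel"
    using borel_measurable_integrable[OF u] by simp
  define c where "c = (LINT t|lborel. cmod (u t))"
  have c: "0 \<le> c" "\<And>\<omega>. cmod (fourier u \<omega>) \<le> c"
    by (simp_all add: c_def fourier_bound)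
  let ?v = "\<lambda>\<omega>. fourier u \<omega> * complex_of_real (gauss (e *\<^sub>R \<omega>))"
  have gi: "integrable lborel (\<lambda>\<omega>::'a. gauss (e *\<^sub>R \<omega>))"
    using gauss_scaled_integrable[of e] e by simp
  have v: "integrable lborel ?v"
  proof (rule Bochner_Integration.integrable_bound)
    show "integrable lborel (\<lambda>\<omega>::'a. c * gauss (e *\<^sub>R \<omega>))" using gi by simp
    show "AE \<omega> in lborel. cmod (?v \<omega>) \<le> norm (c * gauss (e *\<^sub>R \<omega>))"
      using c by (intro AE_I2) (simp add: norm_mult gauss_nonneg mult_right_mono)
  qed measurable
  show "integrable lborel (\<lambda>\<omega>. (cmod (fourier u \<omega>))\<^sup>2 * gauss (e *\<^sub>R \<omega>))"
  proof (rule Bochner_Integration.integrable_bound)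
    show "integrable lborel (\<lambda>\<omega>::'a. c\<^sup>2 * gauss (e *\<^sub>R \<omega>))" using gi by simp
    show "AE \<omega> in lborel. norm ((cmod (fourier u \<omega>))\<^sup>2 * gauss (e *\<^sub>R \<omega>)) \<le> norm (c\<^sup>2 * gauss (e *\<^sub>R \<omega>))"
      using c by (intro AE_I2) (simp add: gauss_nonneg mult_right_mono power_mono)
  qed measurable
  let ?k = "\<lambda>t \<omega>. cis (2 * pi * (t \<bullet> \<omega>))"
  have int: "integrable (lborel \<Otimes>\<^sub>M lborel) (\<lambda>(t, \<omega>). cnj (u t) * ?v \<omega> * ?k t \<omega>)"
    using u v by (intro integrable_product_times_bounded) (simp_all add: split_beta')
  have "complex_of_real (LINT \<omega>|lborel. (cmod (fourier u \<omega>))\<^sup>2 * gauss (e *\<^sub>R \<omega>))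
      = (LINT \<omega>|lborel. complex_of_real ((cmod (fourier u \<omega>))\<^sup>2 * gauss (e *\<^sub>R \<omega>)))"
    by (rule integral_complex_of_real[symmetric])
  also have "\<dots> = (LINT \<omega>|lborel. LINT t|lborel. cnj (u t) * ?v \<omega> * ?k t \<omega>)"
  proof (intro Bochner_Integration.integral_cong refl)
    fix \<omega>
    have "complex_of_real ((cmod (fourier u \<omega>))\<^sup>2 * gauss (e *\<^sub>R \<omega>)) = cnj (fourier u \<omega>) * ?v \<omega>"
      by (simp only: of_real_mult complex_norm_square mult_ac)
    also have "cnj (fourier u \<omega>) = (LINT t|lborel. cnj (u t * cis (- (2 * pi * (t \<bullet> \<omega>)))))"
      by (simp only: fourier_cis Bochner_Integration.integral_cnj)
    also have "\<dots> = (LINT t|lborel. cnj (u t) * ?k t \<omega>)"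
      by (simp add: cis_cnj)
    also have "\<dots> * ?v \<omega> = (LINT t|lborel. cnj (u t) * ?k t \<omega> * ?v \<omega>)"
      by (rule integral_mult_left_zero[symmetric])
    finally show "complex_of_real ((cmod (fourier u \<omega>))\<^sup>2 * gauss (e *\<^sub>R \<omega>))
        = (LINT t|lborel. cnj (u t) * ?v \<omega> * ?k t \<omega>)"
      by (simp add: mult_ac)
  qed
  also have "\<dots> = (LINT t|lborel. LINT \<omega>|lborel. cnj (u t) * ?v \<omega> * ?k t \<omega>)"
    by (rule lborel_pair.Fubini_integral[OF int])
  also have "\<dots> = (LINT t|lborel. cnj (u t) * (LINT \<omega>|lborel. ?v \<omega> * ?k t \<omega>))"
    by (simp add: mult.assoc)
  also have "\<dots> = (LINT t|lborel. cnj (u t) * (LINT s|lborel. u s * complex_of_real (heat e (s - t))))"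
    using fourier_gauss_inverse[OF u e] by simp
  finally show "complex_of_real (LINT \<omega>|lborel. (cmod (fourier u \<omega>))\<^sup>2 * gauss (e *\<^sub>R \<omega>))
    = (LINT t|lborel. cnj (u t) * (LINT s|lborel. u s * complex_of_real (heat e (s - t))))" .
qed

lemma gauss_scaled_tendsto: "(\<lambda>n. gauss ((1 / real (Suc n)) *\<^sub>R x)) \<longlonglongrightarrow> 1"
proof -
  have "(\<lambda>n. 1 / real (Suc n)) \<longlonglongrightarrow> 0"
    using LIMSEQ_inverse_real_of_nat by (simp add: inverse_eq_divide)
  then have "(\<lambda>n. exp (- (pi * (norm ((1 / real (Suc n)) *\<^sub>R x))\<^sup>2))) \<longlonglongrightarrow> exp (- (pi * (norm (0 *\<^sub>R x))\<^sup>2))"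
    by (intro tendsto_intros)
  then show ?thesis by (simp add: gauss_def)
qed

text \<open>The right side of the energy identity is at most the squared norm of \<open>u\<close>
  for every \<open>e\<close>: split the product \<open>|u t| |u s|\<close> by the
  arithmetic-geometric mean inequality and use that \<open>heat\<close> has unit mass in each
  variable. Fatou's lemma then removes the damping.\<close>

lemma fourier_L2_le:
  assumes u: "integrable lborel u"
  shows "(\<integral>\<^sup>+\<omega>. ennreal ((cmod (fourier u \<omega>))\<^sup>2) \<partial>lborel) \<le> (\<integral>\<^sup>+t. ennreal ((cmod (u t))\<^sup>2) \<partial>lborel)"
proof -
  have [measurable]: "u \<in> borel_measurable borel"
    using borel_measurable_integrable[OF u] by simp
  let ?R = "\<integral>\<^sup>+t. ennreal ((cmod (u t))\<^sup>2) \<partial>lborel"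
  have le: "(\<integral>\<^sup>+\<omega>. ennreal ((cmod (fourier u \<omega>))\<^sup>2 * gauss (e *\<^sub>R \<omega>)) \<partial>lborel) \<le> ?R" if e: "0 < e" for e
  proof -
    have "(\<integral>\<^sup>+\<omega>. ennreal ((cmod (fourier u \<omega>))\<^sup>2 * gauss (e *\<^sub>R \<omega>)) \<partial>lborel)
        = ennreal (LINT \<omega>|lborel. (cmod (fourier u \<omega>))\<^sup>2 * gauss (e *\<^sub>R \<omega>))"
      by (intro nn_integral_eq_integral fourier_gauss_energy(2)[OF u e]) (simp add: gauss_nonneg)
    also have "\<dots> \<le> ennreal (cmod (complex_of_real (LINT \<omega>|lborel. (cmod (fourier u \<omega>))\<^sup>2 * gauss (e *\<^sub>R \<omega>))))"
      by (intro ennreal_leI) simp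
    also have "\<dots> \<le> (\<integral>\<^sup>+t. ennreal (cmod (cnj (u t) * (LINT s|lborel. u s * complex_of_real (heat e (s - t))))) \<partial>lborel)"
      unfolding fourier_gauss_energy(1)[OF u e] by (rule norm_integral_le_nn_integral)
    also have "\<dots> \<le> (\<integral>\<^sup>+t. \<integral>\<^sup>+s. (ennreal ((cmod (u t))\<^sup>2 / 2) + ennreal ((cmod (u s))\<^sup>2 / 2)) * ennreal (heat e (s - t)) \<partial>lborel \<partial>lborel)"
    proof (rule nn_integral_mono)
      fix t
      have "ennreal (cmod (cnj (u t) * (LINT s|lborel. u s * complex_of_real (heat e (s - t)))))
          = ennreal (cmod (LINT s|lborel. u t * (u s * complex_of_real (heat e (s - t)))))"
        by (simp add: norm_mult)
      also have "\<dots> \<le> (\<integral>\<^sup>+s. ennreal (cmod (u t * (u s * complex_of_real (heat e (s - t))))) \<partial>lborel)"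
        by (rule norm_integral_le_nn_integral)
      also have "\<dots> \<le> (\<integral>\<^sup>+s. (ennreal ((cmod (u t))\<^sup>2 / 2) + ennreal ((cmod (u s))\<^sup>2 / 2)) * ennreal (heat e (s - t)) \<partial>lborel)"
      proof (rule nn_integral_mono)
        fix s
        have "cmod (u t * (u s * complex_of_real (heat e (s - t)))) = cmod (u t) * cmod (u s) * heat e (s - t)"
          using heat_nonneg[OF e, of "s - t"] by (simp add: norm_mult)
        also have "\<dots> \<le> ((cmod (u t))\<^sup>2 / 2 + (cmod (u s))\<^sup>2 / 2) * heat e (s - t)"
          using sum_squares_bound[of "cmod (u t)" "cmod (u s)"]
          by (intro mult_right_mono heat_nonneg e) simp
        finally have "ennreal (cmod (u t * (u s * complex_of_real (heat e (s - t)))))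
            \<le> ennreal (((cmod (u t))\<^sup>2 / 2 + (cmod (u s))\<^sup>2 / 2) * heat e (s - t))"
          by (rule ennreal_leI)
        also have "\<dots> = (ennreal ((cmod (u t))\<^sup>2 / 2) + ennreal ((cmod (u s))\<^sup>2 / 2)) * ennreal (heat e (s - t))"
          using heat_nonneg[OF e, of "s - t"] by (simp add: ennreal_mult)
        finally show "ennreal (cmod (u t * (u s * complex_of_real (heat e (s - t)))))
            \<le> (ennreal ((cmod (u t))\<^sup>2 / 2) + ennreal ((cmod (u s))\<^sup>2 / 2)) * ennreal (heat e (s - t))" .
      qed
      finally show "ennreal (cmod (cnj (u t) * (LINT s|lborel. u s * complex_of_real (heat e (s - t)))))
          \<le> (\<integral>\<^sup>+s. (ennreal ((cmod (u t))\<^sup>2 / 2) + ennreal ((cmod (u s))\<^sup>2 / 2)) * ennreal (heat e (s - t)) \<partial>lborel)" .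
    qed
    also have "\<dots> = (\<integral>\<^sup>+t. ennreal ((cmod (u t))\<^sup>2 / 2) + (\<integral>\<^sup>+s. ennreal ((cmod (u s))\<^sup>2 / 2) * ennreal (heat e (s - t)) \<partial>lborel) \<partial>lborel)"
      by (intro nn_integral_cong)
        (simp add: distrib_right nn_integral_add nn_integral_cmult heat_nn_integral[OF e])
    also have "\<dots> = (\<integral>\<^sup>+t. ennreal ((cmod (u t))\<^sup>2 / 2) \<partial>lborel)
        + (\<integral>\<^sup>+t. \<integral>\<^sup>+s. ennreal ((cmod (u s))\<^sup>2 / 2) * ennreal (heat e (s - t)) \<partial>lborel \<partial>lborel)"
      by (rule nn_integral_add) measurable
    also have "(\<integral>\<^sup>+t. \<integral>\<^sup>+s. ennreal ((cmod (u s))\<^sup>2 / 2) * ennreal (heat e (s - t)) \<partial>lborel \<partial>lborel)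
        = (\<integral>\<^sup>+s. \<integral>\<^sup>+t. ennreal ((cmod (u s))\<^sup>2 / 2) * ennreal (heat e (s - t)) \<partial>lborel \<partial>lborel)"
      by (rule lborel_pair.Fubini') measurable
    also have "\<dots> = (\<integral>\<^sup>+t. ennreal ((cmod (u t))\<^sup>2 / 2) \<partial>lborel)"
      by (simp add: nn_integral_cmult heat_nn_integral[OF e])
    also have "(\<integral>\<^sup>+t. ennreal ((cmod (u t))\<^sup>2 / 2) \<partial>lborel) + (\<integral>\<^sup>+t. ennreal ((cmod (u t))\<^sup>2 / 2) \<partial>lborel) = ?R"
      by (subst nn_integral_add[symmetric]) (auto simp: ennreal_plus[symmetric] simp del: ennreal_plus)
    finally show ?thesis .
  qed
  have "(\<integral>\<^sup>+\<omega>. ennreal ((cmod (fourier u \<omega>))\<^sup>2) \<partial>lborel)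
      = (\<integral>\<^sup>+\<omega>. liminf (\<lambda>n. ennreal ((cmod (fourier u \<omega>))\<^sup>2 * gauss ((1 / real (Suc n)) *\<^sub>R \<omega>))) \<partial>lborel)"
  proof (rule nn_integral_cong)
    fix \<omega> :: 'a
    have "(\<lambda>n. ennreal ((cmod (fourier u \<omega>))\<^sup>2 * gauss ((1 / real (Suc n)) *\<^sub>R \<omega>))) \<longlonglongrightarrow> ennreal ((cmod (fourier u \<omega>))\<^sup>2 * 1)"
      by (intro tendsto_ennrealI tendsto_mult tendsto_const gauss_scaled_tendsto)
    then have "liminf (\<lambda>n. ennreal ((cmod (fourier u \<omega>))\<^sup>2 * gauss ((1 / real (Suc n)) *\<^sub>R \<omega>))) = ennreal ((cmod (fourier u \<omega>))\<^sup>2 * 1)"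
      by (rule lim_imp_Liminf[OF trivial_limit_sequentially])
    then show "ennreal ((cmod (fourier u \<omega>))\<^sup>2)
        = liminf (\<lambda>n. ennreal ((cmod (fourier u \<omega>))\<^sup>2 * gauss ((1 / real (Suc n)) *\<^sub>R \<omega>)))" by simp
  qed
  also have "\<dots> \<le> liminf (\<lambda>n. \<integral>\<^sup>+\<omega>. ennreal ((cmod (fourier u \<omega>))\<^sup>2 * gauss ((1 / real (Suc n)) *\<^sub>R \<omega>)) \<partial>lborel)"
    by (rule nn_integral_liminf) measurable
  also have "\<dots> \<le> ?R"
    by (rule Liminf_le) (auto intro!: always_eventually le)
  finally show ?thesis .
qed

text \<open>Here the right side of the energy identity must converge to the squared norm of
  \<open>k\<close>. Continuity and boundedness make the heat averages converge pointwise and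
  boundedly, so dominated convergence applies.\<close>

lemma L2_le_fourier:
  fixes k :: "'a::euclidean_space \<Rightarrow> complex"
  assumes k: "integrable lborel k" and cont: "continuous_on UNIV k" and bound: "\<And>t. cmod (k t) \<le> K"
  shows "(\<integral>\<^sup>+t. ennreal ((cmod (k t))\<^sup>2) \<partial>lborel) \<le> (\<integral>\<^sup>+\<omega>. ennreal ((cmod (fourier k \<omega>))\<^sup>2) \<partial>lborel)"
proof -
  have [measurable]: "k \<in> borel_measurable borel"
    using borel_measurable_integrable[OF k] by simp
  have K: "0 \<le> K" by (rule order_trans[OF norm_ge_zero bound[of 0]])
  have int_gauss: "integrable lborel (\<lambda>z::'a. K * gauss z)" using gauss_integrable[where 'a = 'a] by simp
  have k_gauss: "cmod (k x * complex_of_real (gauss z)) \<le> K * gauss z" for x z :: 'a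
    using mult_right_mono[OF bound[of x] gauss_nonneg[of z]] by (simp add: norm_mult gauss_nonneg)
  define a where "a n = (LINT \<omega>|lborel. (cmod (fourier k \<omega>))\<^sup>2 * gauss ((1 / real (Suc n)) *\<^sub>R \<omega>))" for n
  \<comment> \<open>The heat average at width \<open>1 / Suc n\<close> after rescaling the variable:
    the kernel is now independent of \<open>n\<close>, so dominated convergence can act on
    \<open>k\<close> alone.\<close>
  define S where "S n t = (LINT z|lborel. k (t + (1 / real (Suc n)) *\<^sub>R z) * complex_of_real (gauss z))" for n t
  have S_eq: "(LINT s|lborel. k s * complex_of_real (heat (1 / real (Suc n)) (s - t))) = S n t" for n t
  proof -
    let ?e = "1 / real (Suc n)"
    have "(LINT s|lborel. k s * complex_of_real (heat ?e (s - t)))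
        = \<bar>?e\<bar> ^ DIM('a) *\<^sub>R (LINT z|lborel. k (t + ?e *\<^sub>R z) * complex_of_real (heat ?e (t + ?e *\<^sub>R z - t)))"
      by (rule integral_lborel_affine) auto
    also have "\<dots> = (LINT z|lborel. \<bar>?e\<bar> ^ DIM('a) *\<^sub>R (k (t + ?e *\<^sub>R z) * complex_of_real (heat ?e (t + ?e *\<^sub>R z - t))))"
      by (rule integral_scaleR_right[symmetric])
    also have "\<dots> = S n t"
      unfolding S_def
    proof (intro Bochner_Integration.integral_cong refl)
      fix z
      have g: "gauss z = \<bar>?e\<bar> ^ DIM('a) * heat ?e (t + ?e *\<^sub>R z - t)"
        by (simp add: heat_def)
      show "\<bar>?e\<bar> ^ DIM('a) *\<^sub>R (k (t + ?e *\<^sub>R z) * complex_of_real (heat ?e (t + ?e *\<^sub>R z - t)))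
          = k (t + ?e *\<^sub>R z) * complex_of_real (gauss z)"
        unfolding g scaleR_conv_of_real of_real_mult by (simp only: mult_ac)
    qed
    finally show ?thesis .
  qed
  have a_eq: "complex_of_real (a n) = (LINT t|lborel. cnj (k t) * S n t)" for n
    unfolding a_def S_eq[symmetric] by (rule fourier_gauss_energy(1)[OF k]) simp
  have S_bound: "cmod (S n t) \<le> K" for n t
  proof -
    have "integrable lborel (\<lambda>z. k (t + (1 / real (Suc n)) *\<^sub>R z) * complex_of_real (gauss z))"
      by (rule Bochner_Integration.integrable_bound[OF int_gauss])
        (measurable, intro AE_I2 order_trans[OF k_gauss], simp add: K gauss_nonneg)
    then have "(LINT z|lborel. cmod (k (t + (1 / real (Suc n)) *\<^sub>R z) * complex_of_real (gauss z)))
        \<le> (LINT z|lborel. K * gauss (z::'a))"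
      by (intro integral_mono integrable_norm int_gauss k_gauss)
    also have "\<dots> = K" by (simp add: gauss_integral_eq_1)
    finally show ?thesis unfolding S_def by (rule order_trans[OF integral_norm_bound])
  qed
  have S_lim: "(\<lambda>n. S n t) \<longlonglongrightarrow> k t" for t
  proof -
    have "(\<lambda>n. S n t) \<longlonglongrightarrow> (LINT z|lborel. k t * complex_of_real (gauss (z::'a)))"
      unfolding S_def
    proof (rule integral_dominated_convergence[where w = "\<lambda>z. K * gauss z"])
      show "integrable lborel (\<lambda>z::'a. K * gauss z)" by (rule int_gauss)
      show "AE z in lborel. (\<lambda>n. k (t + (1 / real (Suc n)) *\<^sub>R z) * complex_of_real (gauss z)) \<longlonglongrightarrow> k t * complex_of_real (gauss z)"
      proof (rule AE_I2)
        fix z :: 'a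
        have "(\<lambda>n. 1 / real (Suc n)) \<longlonglongrightarrow> 0"
          using LIMSEQ_inverse_real_of_nat by (simp add: inverse_eq_divide)
        then have "(\<lambda>n. t + (1 / real (Suc n)) *\<^sub>R z) \<longlonglongrightarrow> t + 0 *\<^sub>R z"
          by (intro tendsto_add tendsto_scaleR tendsto_const)
        then have "(\<lambda>n. k (t + (1 / real (Suc n)) *\<^sub>R z)) \<longlonglongrightarrow> k (t + 0 *\<^sub>R z)"
          using cont by (intro continuous_on_tendsto_compose[OF cont]) auto
        then show "(\<lambda>n. k (t + (1 / real (Suc n)) *\<^sub>R z) * complex_of_real (gauss z)) \<longlonglongrightarrow> k t * complex_of_real (gauss z)"
          by (intro tendsto_mult tendsto_const) simp
      qed
      show "AE z in lborel. cmod (k (t + (1 / real (Suc n)) *\<^sub>R z) * complex_of_real (gauss z)) \<le> K * gauss z" for n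
        by (intro AE_I2 k_gauss)
    qed measurable
    also have "(LINT z|lborel. k t * complex_of_real (gauss (z::'a))) = k t"
      by (simp add: gauss_integral_eq_1)
    finally show ?thesis .
  qed
  have [measurable]: "S n \<in> borel_measurable borel" for n
    unfolding S_def by measurable
  have ksq: "integrable lborel (\<lambda>t. (cmod (k t))\<^sup>2)"
  proof (rule Bochner_Integration.integrable_bound)
    show "integrable lborel (\<lambda>t. K * cmod (k t))" using k by simp
    show "AE t in lborel. norm ((cmod (k t))\<^sup>2) \<le> norm (K * cmod (k t))"
      using bound K by (intro AE_I2) (simp add: power2_eq_square mult_right_mono)
  qed measurable
  have "(\<lambda>n. LINT t|lborel. cnj (k t) * S n t) \<longlonglongrightarrow> (LINT t|lborel. cnj (k t) * k t)"
  proof (rule integral_dominated_convergence[where w = "\<lambda>t. cmod (k t) * K"])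
    show "integrable lborel (\<lambda>t. cmod (k t) * K)" using k by simp
    show "AE t in lborel. (\<lambda>n. cnj (k t) * S n t) \<longlonglongrightarrow> cnj (k t) * k t"
      by (intro AE_I2 tendsto_mult tendsto_const S_lim)
    show "AE t in lborel. cmod (cnj (k t) * S n t) \<le> cmod (k t) * K" for n
      by (intro AE_I2) (simp add: norm_mult mult_left_mono S_bound)
  qed measurable
  also have "(LINT t|lborel. cnj (k t) * k t) = complex_of_real (LINT t|lborel. (cmod (k t))\<^sup>2)"
    by (simp add: integral_complex_of_real[symmetric] complex_norm_square mult.commute del: of_real_power)
  finally have "(\<lambda>n. complex_of_real (a n)) \<longlonglongrightarrow> complex_of_real (LINT t|lborel. (cmod (k t))\<^sup>2)"
    unfolding a_eq .
  then have "a \<longlonglongrightarrow> (LINT t|lborel. (cmod (k t))\<^sup>2)"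
    by (simp only: tendsto_of_real_iff)
  then have lim: "(\<lambda>n. ennreal (a n)) \<longlonglongrightarrow> ennreal (LINT t|lborel. (cmod (k t))\<^sup>2)"
    by (rule tendsto_ennrealI)
  have "ennreal (a n) \<le> (\<integral>\<^sup>+\<omega>. ennreal ((cmod (fourier k \<omega>))\<^sup>2) \<partial>lborel)" for n
  proof -
    have "ennreal (a n) = (\<integral>\<^sup>+\<omega>. ennreal ((cmod (fourier k \<omega>))\<^sup>2 * gauss ((1 / real (Suc n)) *\<^sub>R \<omega>)) \<partial>lborel)"
      unfolding a_def by (rule nn_integral_eq_integral[symmetric])
        (auto intro!: fourier_gauss_energy(2)[OF k] simp: gauss_nonneg)
    also have "\<dots> \<le> (\<integral>\<^sup>+\<omega>. ennreal ((cmod (fourier k \<omega>))\<^sup>2) \<partial>lborel)"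
      by (intro nn_integral_mono ennreal_leI) (simp add: mult_left_le gauss_le_1)
    finally show ?thesis .
  qed
  with lim have "ennreal (LINT t|lborel. (cmod (k t))\<^sup>2) \<le> (\<integral>\<^sup>+\<omega>. ennreal ((cmod (fourier k \<omega>))\<^sup>2) \<partial>lborel)"
    by (intro LIMSEQ_le_const2[OF lim] exI[of _ 0]) blast
  then show ?thesis
    by (subst nn_integral_eq_integral[OF ksq]) auto
qed

section \<open>Averaging over rotations and dilations\<close>

text \<open>Uniqueness of Haar measure: both sides are compared with the integral of the indicator of the unit
  ball, which is invariant under \<open>T\<close>.\<close>

lemma nn_integral_lborel_orthogonal:
  fixes T S :: "'a::euclidean_space \<Rightarrow> 'a" and f :: "'a \<Rightarrow> ennreal"
  assumes T: "linear T" "\<And>x. norm (T x) = norm x" and TS: "\<And>y. T (S y) = y"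
    and [measurable]: "f \<in> borel_measurable borel"
  shows "(\<integral>\<^sup>+x. f (T x) \<partial>lborel) = (\<integral>\<^sup>+x. f x \<partial>lborel)"
proof -
  have [measurable]: "T \<in> borel \<rightarrow>\<^sub>M borel"
    by (intro borel_measurable_continuous_onI linear_continuous_on linear_conv_bounded_linear[THEN iffD1] T(1))
  define g :: "'a \<Rightarrow> ennreal" where "g = indicator (ball 0 1)"
  have [measurable]: "g \<in> borel_measurable borel"
    unfolding g_def by (intro borel_measurable_indicator) simp
  have g_T: "g (T x) = g x" for x
    by (simp add: g_def indicator_def T(2))
  define c where "c = (\<integral>\<^sup>+x. g x \<partial>lborel)"
  have c_eq: "c = emeasure lborel (ball (0::'a) 1)" by (simp add: c_def g_def)
  have c: "c \<noteq> 0" "c \<noteq> top"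
    using content_ball_gt_0_iff[of "0::'a" 1] emeasure_bounded_finite[OF bounded_ball, of "0::'a" 1]
    unfolding c_eq measure_def by (auto simp: less_top[symmetric])
  have shift: "(\<integral>\<^sup>+x. F (x + v) \<partial>lborel) = (\<integral>\<^sup>+x. F x \<partial>lborel)"
    if [measurable]: "F \<in> borel_measurable borel" for F :: "'a \<Rightarrow> ennreal" and v
    using nn_integral_lborel_affine[OF that, of 1 v] by (simp add: add.commute)
  have "(\<integral>\<^sup>+x. f (T x) \<partial>lborel) * c = (\<integral>\<^sup>+y. g y * (\<integral>\<^sup>+x. f (T x) \<partial>lborel) \<partial>lborel)"
    unfolding c_def by (subst nn_integral_multc) (simp_all add: mult.commute)
  also have "\<dots> = (\<integral>\<^sup>+y. \<integral>\<^sup>+x. g y * f (T x + y) \<partial>lborel \<partial>lborel)"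
  proof (intro nn_integral_cong)
    fix y
    have "(\<integral>\<^sup>+x. f (T x) \<partial>lborel) = (\<integral>\<^sup>+x. f (T (x + S y)) \<partial>lborel)"
      by (rule shift[symmetric]) measurable
    then show "g y * (\<integral>\<^sup>+x. f (T x) \<partial>lborel) = (\<integral>\<^sup>+x. g y * f (T x + y) \<partial>lborel)"
      by (simp add: nn_integral_cmult linear_add[OF T(1)] TS)
  qed
  also have "\<dots> = (\<integral>\<^sup>+x. \<integral>\<^sup>+y. g y * f (T x + y) \<partial>lborel \<partial>lborel)"
    by (rule lborel_pair.Fubini') measurable
  also have "\<dots> = (\<integral>\<^sup>+x. \<integral>\<^sup>+y. g (y - T x) * f y \<partial>lborel \<partial>lborel)"
  proof (rule nn_integral_cong)
    fix x
    have "(\<integral>\<^sup>+y. g (y - T x) * f y \<partial>lborel) = (\<integral>\<^sup>+y. g (y + T x - T x) * f (y + T x) \<partial>lborel)"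
      by (rule shift[symmetric]) measurable
    then show "(\<integral>\<^sup>+y. g y * f (T x + y) \<partial>lborel) = (\<integral>\<^sup>+y. g (y - T x) * f y \<partial>lborel)"
      by (simp add: add.commute)
  qed
  also have "\<dots> = (\<integral>\<^sup>+y. \<integral>\<^sup>+x. g (y - T x) * f y \<partial>lborel \<partial>lborel)"
    by (rule lborel_pair.Fubini'[symmetric]) measurable
  also have "\<dots> = (\<integral>\<^sup>+y. c * f y \<partial>lborel)"
  proof (rule nn_integral_cong)
    fix y
    have "g (y - T x) = g (S y - x)" for x
      using g_T[of "S y - x"] by (simp add: linear_diff[OF T(1)] TS)
    moreover have "(\<integral>\<^sup>+x. g x \<partial>lborel) = (\<integral>\<^sup>+x. g (S y - x) \<partial>lborel)"
      using nn_integral_lborel_affine[of g "-1" "S y"] by simp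
    ultimately show "(\<integral>\<^sup>+x. g (y - T x) * f y \<partial>lborel) = c * f y"
      by (simp add: nn_integral_multc c_def)
  qed
  also have "\<dots> = (\<integral>\<^sup>+x. f x \<partial>lborel) * c"
    by (subst nn_integral_cmult) (simp_all add: mult.commute)
  finally show ?thesis
    using c by (simp add: mult.commute[of _ c] ennreal_mult_cancel_left)
qed

section \<open>Orthogonal matrices and Lebesgue measure\<close>

lemma matrix_vector_measurable [measurable]:
  "(*v) (R :: real ^ 'n ^ 'n) \<in> borel \<rightarrow>\<^sub>M borel"
  by (intro borel_measurable_continuous_onI linear_continuous_on
      linear_conv_bounded_linear[THEN iffD1] matrix_vector_mul_linear)

lemma orthogonal_matrix_inner:
  fixes R :: "real ^ 'n ^ 'n"
  assumes "orthogonal_matrix R"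
  shows "inner (R *v x) (R *v y) = inner x y" and "norm (R *v x) = norm x"
    and "R *v (transpose R *v x) = x"
proof -
  have R: "transpose R ** R = mat 1" "R ** transpose R = mat 1"
    using assms by (simp_all add: orthogonal_matrix_def)
  have "R *v (transpose R *v x) = (R ** transpose R) *v x"
    by (rule matrix_vector_mul_assoc)
  then show "R *v (transpose R *v x) = x" by (simp only: R matrix_vector_mul_lid)
  have *: "inner (R *v x) (R *v y) = inner x y" for x y
  proof -
    have "inner (R *v x) (R *v y) = inner ((R *v x) v* R) y"
      by (rule dot_lmul_matrix[symmetric])
    also have "(R *v x) v* R = transpose R *v (R *v x)"
      by (rule transpose_matrix_vector[symmetric])
    also have "\<dots> = (transpose R ** R) *v x" by (rule matrix_vector_mul_assoc)
    finally show ?thesis by (simp only: R matrix_vector_mul_lid)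
  qed
  show "inner (R *v x) (R *v y) = inner x y" by (rule *)
  show "norm (R *v x) = norm x" by (simp add: norm_eq_sqrt_inner *)
qed

lemma lborel_distr_orthogonal_matrix:
  fixes R :: "real ^ 'n ^ 'n"
  assumes R: "orthogonal_matrix R"
  shows "distr lborel borel ((*v) R) = lborel"
proof (rule measure_eqI)
  fix A :: "(real ^ 'n) set" assume "A \<in> sets (distr lborel borel ((*v) R))"
  then have [measurable]: "A \<in> sets borel" by simp
  have "emeasure (distr lborel borel ((*v) R)) A = (\<integral>\<^sup>+x. indicator A x \<partial>distr lborel borel ((*v) R))"
    by simp
  also have "\<dots> = (\<integral>\<^sup>+x. indicator A (R *v x) \<partial>lborel)"
    by (rule nn_integral_distr) measurable
  also have "\<dots> = (\<integral>\<^sup>+x. indicator A x \<partial>lborel)"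
    by (rule nn_integral_lborel_orthogonal[where S = "(*v) (transpose R)"])
      (simp_all add: orthogonal_matrix_inner[OF R] del: transpose_matrix_vector)
  finally show "emeasure (distr lborel borel ((*v) R)) A = emeasure lborel A" by simp
qed simp

lemma nn_integral_rotation:
  fixes R :: "real ^ 'n ^ 'n" and f :: "real ^ 'n \<Rightarrow> ennreal"
  assumes "orthogonal_matrix R" and [measurable]: "f \<in> borel_measurable borel"
  shows "(\<integral>\<^sup>+x. f (R *v x) \<partial>lborel) = (\<integral>\<^sup>+x. f x \<partial>lborel)"
  by (subst (2) lborel_distr_orthogonal_matrix[OF assms(1), symmetric]) (simp add: nn_integral_distr)

lemma integral_rotation:
  fixes R :: "real ^ 'n ^ 'n" and f :: "real ^ 'n \<Rightarrow> complex"
  assumes "orthogonal_matrix R" and [measurable]: "f \<in> borel_measurable borel"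
  shows "(LINT x|lborel. f (R *v x)) = (LINT x|lborel. f x)"
  by (subst (2) lborel_distr_orthogonal_matrix[OF assms(1), symmetric]) (simp add: integral_distr)

lemma integrable_rotation:
  fixes R :: "real ^ 'n ^ 'n" and f :: "real ^ 'n \<Rightarrow> complex"
  assumes R: "orthogonal_matrix R" and f: "integrable lborel f"
  shows "integrable lborel (\<lambda>x. f (R *v x))"
proof -
  have "integrable (distr lborel borel ((*v) R)) f"
    using f by (simp only: lborel_distr_orthogonal_matrix[OF R])
  then show ?thesis by (rule integrable_distr[rotated]) measurable
qed

text \<open>In dimension at least 2 rotations act transitively on spheres. In dimension 1 the
  identity is the only rotation, so a change of sign has to come from the dilation; this is why only
  \<open>\<bar>c\<bar>\<close> is prescribed.\<close>

lemma rotation_dilation_transitive: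
  fixes e y :: "real ^ 'n"
  assumes e: "norm e = 1" and y: "y \<noteq> 0"
  obtains R c where "rotation_matrix R" "\<bar>c\<bar> = norm y" "y = c *\<^sub>R (R *v e)"
proof (cases "2 \<le> CARD('n)")
  case True
  have "norm e = norm ((1 / norm y) *\<^sub>R y)" using e y by simp
  from rotation_exists[OF True this] obtain f where f: "orthogonal_transformation f"
    "det (matrix f) = 1" "f e = (1 / norm y) *\<^sub>R y" .
  have lin: "linear f" using f(1) orthogonal_transformation_linear by blast
  show thesis
  proof (rule that)
    show "rotation_matrix (matrix f)"
      using f orthogonal_transformation_matrix by (auto simp: rotation_matrix_def)
    show "y = norm y *\<^sub>R (matrix f *v e)"
      using f(3) y fun_cong[OF matrix_vector_mul(2)[OF lin], of e] by simp
  qed simp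
next
  case False
  then have "CARD('n) = 1" using zero_less_card_finite[where 'a='n] by linarith
  then obtain i where i: "(UNIV :: 'n set) = {i}" by (auto simp: card_1_singleton_iff)

  have norm: "norm x = \<bar>x $ i\<bar>" for x :: "real ^ 'n"
    by (simp add: norm_vec_def L2_set_def i)
  show thesis
  proof (rule that)
    show "rotation_matrix (mat 1 :: real ^ 'n ^ 'n)"
      by (simp add: rotation_matrix_def orthogonal_matrix_def)
    show "\<bar>y $ i / e $ i\<bar> = norm y" using e by (simp add: norm)
    show "y = (y $ i / e $ i) *\<^sub>R (mat 1 *v e)"
      unfolding vec_eq_iff
    proof
      fix j
      have "j \<in> {i}" unfolding i[symmetric] by (rule UNIV_I)
      then have "j = i" by simp
      then show "y $ j = ((y $ i / e $ i) *\<^sub>R (mat 1 *v e)) $ j"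
        using e by (auto simp: norm)
    qed
  qed
qed

text \<open>Such a function is constant almost everywhere, but only an upper bound is needed.  By transitivity,
  the integral \<open>avg r y\<close> of \<open>G\<close> over \<open>{x. norm (x - y) < r * norm y}\<close> depends on \<open>y\<close> only through
  \<open>norm y\<close>; integrating over a shell bounds it, and letting \<open>r\<close> tend to \<open>0\<close> recovers \<open>G\<close>.\<close>

locale rotation_dilation_invariant =
  fixes G :: "real ^ 'n \<Rightarrow> ennreal"
  assumes G_measurable [measurable]: "G \<in> borel_measurable borel"
    and dilation: "\<And>c x. c \<noteq> 0 \<Longrightarrow> G (c *\<^sub>R x) = G x"
    and rotation: "\<And>R :: real ^ 'n ^ 'n. rotation_matrix R \<Longrightarrow> AE x in lborel. G (R *v x) = G x"
    and shell_finite: "(\<integral>\<^sup>+x. G x * indicator {x. 1 / 2 < norm x \<and> norm x < 4} x \<partial>lborel) < \<infinity>"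
begin

section \<open>Averages of an invariant function over relatively small balls\<close>

definition near :: "real \<Rightarrow> real ^ 'n \<Rightarrow> real ^ 'n \<Rightarrow> bool" where
  "near r x y \<longleftrightarrow> norm (x - y) < r * norm y"

definition avg :: "real \<Rightarrow> real ^ 'n \<Rightarrow> ennreal" where
  "avg r y = (\<integral>\<^sup>+x. G x * indicator {x. near r x y} x \<partial>lborel)"

text \<open>The factor \<open>1 / norm y ^ CARD('n)\<close> cancels the growth of
  \<open>avg r y\<close> in \<open>norm y\<close> found in \<open>avg_eq\<close>. Pairing
  \<open>J\<close> with \<open>G\<close> therefore leaves one average times the integral of
  \<open>\<phi>\<close>, while for small \<open>r\<close> and fixed \<open>x\<close> the value of
  \<open>J\<close> is comparable to \<open>r ^ CARD('n) * \<phi> x\<close>.\<close>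

definition J :: "real \<Rightarrow> (real ^ 'n \<Rightarrow> real) \<Rightarrow> real ^ 'n \<Rightarrow> ennreal" where
  "J r \<phi> x = (\<integral>\<^sup>+y. ennreal (\<phi> y / norm y ^ CARD('n)) * indicator {y. near r x y} y \<partial>lborel)"

lemma near_measurable [measurable]:
  "Measurable.pred borel (\<lambda>x. near r x y)" "Measurable.pred borel (\<lambda>y. near r x y)"
  "Measurable.pred (borel \<Otimes>\<^sub>M borel) (\<lambda>z. near r (fst z) (snd z))"
  unfolding near_def by measurable

lemma avg_rotation:
  assumes R: "rotation_matrix R"
  shows "avg r (R *v y) = avg r y"
proof -
  have R': "orthogonal_matrix R" using R by (simp add: rotation_matrix_def)
  have near: "near r (R *v x) (R *v y) \<longleftrightarrow> near r x y" for x
    by (simp add: near_def orthogonal_matrix_inner(2)[OF R'] flip: matrix_vector_mult_diff_distrib)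
  have "avg r (R *v y) = (\<integral>\<^sup>+x. G (R *v x) * indicator {x. near r x (R *v y)} (R *v x) \<partial>lborel)"
    unfolding avg_def by (rule nn_integral_rotation[OF R', symmetric]) measurable
  also have "\<dots> = avg r y"
    unfolding avg_def
  proof (rule nn_integral_cong_AE)
    show "AE x in lborel. G (R *v x) * indicator {x. near r x (R *v y)} (R *v x) = G x * indicator {x. near r x y} x"
      using rotation[OF R] by eventually_elim (simp add: near indicator_def)
  qed
  finally show ?thesis .
qed

lemma avg_dilation:
  assumes c: "c \<noteq> 0"
  shows "avg r (c *\<^sub>R y) = ennreal (\<bar>c\<bar> ^ CARD('n)) * avg r y"
proof -
  have near: "near r (c *\<^sub>R x) (c *\<^sub>R y) \<longleftrightarrow> near r x y" for x
  proof -
    have "near r (c *\<^sub>R x) (c *\<^sub>R y) \<longleftrightarrow> \<bar>c\<bar> * norm (x - y) < \<bar>c\<bar> * (r * norm y)"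
      unfolding near_def scaleR_diff_right[symmetric] norm_scaleR by (simp only: mult.left_commute)
    then show ?thesis using c by (simp add: near_def)
  qed
  have "avg r (c *\<^sub>R y) = ennreal (\<bar>c\<bar> ^ DIM(real ^ 'n))
      * (\<integral>\<^sup>+x. G (0 + c *\<^sub>R x) * indicator {x. near r x (c *\<^sub>R y)} (0 + c *\<^sub>R x) \<partial>lborel)"
    unfolding avg_def by (rule nn_integral_lborel_affine) (use c in measurable)
  also have "\<dots> = ennreal (\<bar>c\<bar> ^ CARD('n)) * avg r y"
    using c by (simp add: avg_def dilation near indicator_def)
  finally show ?thesis .
qed

lemma avg_eq:
  assumes e: "norm e = 1" and y: "y \<noteq> 0"
  shows "avg r y = ennreal (norm y ^ CARD('n)) * avg r e"
proof -
  obtain R c where R: "rotation_matrix R" "\<bar>c\<bar> = norm y" "y = c *\<^sub>R (R *v e)"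
    using rotation_dilation_transitive[OF e y] by blast
  then have "c \<noteq> 0" using y by auto
  then have "avg r y = ennreal (\<bar>c\<bar> ^ CARD('n)) * avg r (R *v e)"
    by (subst R(3)) (rule avg_dilation)
  then show ?thesis by (simp only: R(2) avg_rotation[OF R(1)])
qed

lemma J_integral:
  assumes [measurable]: "\<phi> \<in> borel_measurable borel"
  shows "(\<integral>\<^sup>+x. G x * J r \<phi> x \<partial>lborel) = (\<integral>\<^sup>+y. ennreal (\<phi> y / norm y ^ CARD('n)) * avg r y \<partial>lborel)"
proof -
  let ?I = "\<lambda>x y. G x * (ennreal (\<phi> y / norm y ^ CARD('n)) * indicator {z. near r (fst z) (snd z)} (x, y))"
  have "(\<integral>\<^sup>+x. G x * J r \<phi> x \<partial>lborel) = (\<integral>\<^sup>+x. \<integral>\<^sup>+y. ?I x y \<partial>lborel \<partial>lborel)"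
    unfolding J_def by (intro nn_integral_cong, subst nn_integral_cmult[symmetric])
      (auto simp: indicator_def)
  also have "\<dots> = (\<integral>\<^sup>+y. \<integral>\<^sup>+x. ?I x y \<partial>lborel \<partial>lborel)"
    by (rule lborel_pair.Fubini'[symmetric]) measurable
  also have "\<dots> = (\<integral>\<^sup>+y. ennreal (\<phi> y / norm y ^ CARD('n)) * avg r y \<partial>lborel)"
    unfolding avg_def by (intro nn_integral_cong, subst nn_integral_cmult[symmetric])
      (auto simp: indicator_def mult_ac)
  finally show ?thesis .
qed

lemma J_integral_avg:
  assumes [measurable]: "\<phi> \<in> borel_measurable borel" and e: "norm e = 1"
    and \<phi>: "\<And>y. 0 \<le> \<phi> y"
  shows "(\<integral>\<^sup>+x. G x * J r \<phi> x \<partial>lborel) = avg r e * (\<integral>\<^sup>+y. ennreal (\<phi> y) \<partial>lborel)"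
proof -
  have "(\<integral>\<^sup>+x. G x * J r \<phi> x \<partial>lborel) = (\<integral>\<^sup>+y. ennreal (\<phi> y) * avg r e \<partial>lborel)"
    unfolding J_integral[OF assms(1)]
  proof (rule nn_integral_cong_AE)
    have "AE y in lborel. y \<noteq> (0 :: real ^ 'n)" by (rule AE_lborel_singleton)
    then show "AE y in lborel. ennreal (\<phi> y / norm y ^ CARD('n)) * avg r y = ennreal (\<phi> y) * avg r e"
    proof eventually_elim
      fix y :: "real ^ 'n" assume y: "y \<noteq> 0"
      have "ennreal (\<phi> y / norm y ^ CARD('n)) * ennreal (norm y ^ CARD('n)) = ennreal (\<phi> y)"
        using y \<phi> by (subst ennreal_mult[symmetric]) auto
      then show "ennreal (\<phi> y / norm y ^ CARD('n)) * avg r y = ennreal (\<phi> y) * avg r e"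
        unfolding avg_eq[OF e y] by (simp add: mult.assoc[symmetric])
    qed
  qed
  then show ?thesis by (simp add: nn_integral_multc mult.commute)
qed

lemma ball_volume: "0 \<le> r \<Longrightarrow> emeasure lborel (ball (x :: real ^ 'n) r) = ennreal (unit_ball_vol (real CARD('n)) * r ^ CARD('n))"
  by (simp add: emeasure_ball)

text \<open>\<open>J_integral_avg\<close> is applied to the indicator of the shell
  \<open>1 < norm y < 2\<close>. For \<open>r \<le> 1 / 2\<close>, every \<open>x\<close> near such
  a \<open>y\<close> lies in the larger shell of \<open>shell_finite\<close>, and there
  \<open>J\<close> is at most a constant times \<open>r ^ CARD('n)\<close>.\<close>

lemma avg_bound:
  assumes e: "norm e = 1"
  shows "\<exists>C. \<forall>r. 0 < r \<and> r \<le> 1 / 2 \<longrightarrow> avg r e \<le> ennreal (C * r ^ CARD('n))"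
proof -
  let ?A = "{x :: real ^ 'n. 1 < norm x \<and> norm x < 2}"
  let ?S = "{x :: real ^ 'n. 1 / 2 < norm x \<and> norm x < 4}"
  have [measurable]: "?A \<in> sets borel" "?S \<in> sets borel" by measurable
  define F where "F = enn2real (\<integral>\<^sup>+x. G x * indicator ?S x \<partial>lborel)"
  have F: "(\<integral>\<^sup>+x. G x * indicator ?S x \<partial>lborel) = ennreal F"
    unfolding F_def using shell_finite by (simp add: ennreal_enn2real)
  have F0: "0 \<le> F" by (simp add: F_def)
  define V where "V = measure lborel ?A"
  have "bounded ?A" by (rule bounded_subset[OF bounded_ball[of 0 2]]) auto
  then have A_fin: "emeasure lborel ?A < \<infinity>" by (rule emeasure_bounded_finite)
  then have V: "emeasure lborel ?A = ennreal V"
    unfolding V_def measure_def by (simp add: ennreal_enn2real)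
  \<comment> \<open>A ball inside the shell shows that its volume \<open>V\<close> is positive and
    can be divided by.\<close>
  have "ball ((3 / 2) *\<^sub>R e) (1 / 2) \<subseteq> ?A"
  proof
    fix x assume "x \<in> ball ((3 / 2) *\<^sub>R e) (1 / 2)"
    then have "norm ((3 / 2) *\<^sub>R e - x) < 1 / 2" by (simp add: dist_norm)
    moreover have "norm ((3 / 2) *\<^sub>R e) = 3 / 2" using e by simp
    ultimately show "x \<in> ?A"
      using norm_triangle_ineq2[of "(3 / 2) *\<^sub>R e" x] norm_triangle_ineq2[of x "(3 / 2) *\<^sub>R e"]
      by (simp add: norm_minus_commute)
  qed
  then have "emeasure lborel (ball ((3 / 2) *\<^sub>R e) (1 / 2)) \<le> ennreal V"
    unfolding V[symmetric] by (intro emeasure_mono) simp_all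
  moreover have "0 < emeasure lborel (ball ((3 / 2) *\<^sub>R e) (1 / 2))"
    by (subst ball_volume) simp_all
  ultimately have V0: "0 < V" using less_le_trans by fastforce
  have "avg r e \<le> ennreal (unit_ball_vol (real CARD('n)) * 2 ^ CARD('n) * F / V * r ^ CARD('n))" if r: "0 < r" "r \<le> 1 / 2" for r
  proof -
    have J_le: "J r (indicator ?A) x \<le> ennreal (unit_ball_vol (real CARD('n)) * (2 * r) ^ CARD('n)) * indicator ?S x" for x
    proof -
      \<comment> \<open>Since \<open>norm y < 2\<close> on the shell, a point \<open>y\<close> that
        is near \<open>x\<close> in the relative sense is within \<open>2 * r\<close> of it.\<close>
      have "J r (indicator ?A) x \<le> (\<integral>\<^sup>+y. indicator ?S x * indicator (ball x (2 * r)) y \<partial>lborel)"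
        unfolding J_def
      proof (rule nn_integral_mono)
        fix y
        show "ennreal (indicator ?A y / norm y ^ CARD('n)) * indicator {y. near r x y} y
            \<le> indicator ?S x * indicator (ball x (2 * r)) y"
        proof (cases "y \<in> ?A \<and> near r x y")
          case True
          then have y: "1 < norm y" "norm y < 2" and xy: "norm (x - y) < r * norm y"
            by (simp_all add: near_def)
          have "r * norm y \<le> 1 / 2 * norm y" using r by (intro mult_right_mono) auto
          then have "norm (x - y) < norm y / 2" using xy by simp
          then have "x \<in> ?S"
            using y norm_triangle_ineq2[of x y] norm_triangle_ineq2[of y x]
            by (simp add: norm_minus_commute)
          moreover have "r * norm y < 2 * r" using r y by simp
          then have "y \<in> ball x (2 * r)" using xy by (simp add: dist_norm)
          moreover have "1 / norm y ^ CARD('n) \<le> 1"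
          proof -
            have "1 \<le> norm y ^ CARD('n)" using y by (intro one_le_power) simp
            then show ?thesis by (simp add: divide_le_eq_1)
          qed
          ultimately show ?thesis using True by (simp add: ennreal_le_1)
        next
          case False
          then show ?thesis by (auto simp: indicator_def)
        qed
      qed
      also have "\<dots> = ennreal (unit_ball_vol (real CARD('n)) * (2 * r) ^ CARD('n)) * indicator ?S x"
        using r by (subst nn_integral_cmult) (auto simp: ball_volume mult.commute intro!: borel_measurable_indicator)
      finally show ?thesis .
    qed
    have "avg r e * ennreal V = avg r e * (\<integral>\<^sup>+y. ennreal (indicator ?A y) \<partial>lborel)"
      by (simp add: V[symmetric] ennreal_indicator)
    also have "\<dots> = (\<integral>\<^sup>+x. G x * J r (indicator ?A) x \<partial>lborel)"
      by (rule J_integral_avg[OF _ e, symmetric]) simp_all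
    also have "\<dots> \<le> (\<integral>\<^sup>+x. ennreal (unit_ball_vol (real CARD('n)) * (2 * r) ^ CARD('n)) * (G x * indicator ?S x) \<partial>lborel)"
    proof (rule nn_integral_mono)
      fix x
      show "G x * J r (indicator ?A) x \<le> ennreal (unit_ball_vol (real CARD('n)) * (2 * r) ^ CARD('n)) * (G x * indicator ?S x)"
        using mult_left_mono[OF J_le[of x], of "G x"] by (simp add: mult_ac)
    qed
    also have "\<dots> = ennreal (unit_ball_vol (real CARD('n)) * (2 * r) ^ CARD('n) * F)"
    proof -
      have "(\<integral>\<^sup>+x. ennreal (unit_ball_vol (real CARD('n)) * (2 * r) ^ CARD('n)) * (G x * indicator ?S x) \<partial>lborel)
          = ennreal (unit_ball_vol (real CARD('n)) * (2 * r) ^ CARD('n)) * (\<integral>\<^sup>+x. G x * indicator ?S x \<partial>lborel)"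
        by (rule nn_integral_cmult) measurable
      then show ?thesis
        unfolding F using r F0 by (simp only: ennreal_mult[symmetric] mult_nonneg_nonneg
            unit_ball_vol_nonneg zero_le_power of_nat_0_le_iff)
    qed
    finally have "avg r e * ennreal V * ennreal (1 / V) \<le> ennreal (unit_ball_vol (real CARD('n)) * (2 * r) ^ CARD('n) * F) * ennreal (1 / V)"
      by (rule mult_right_mono) simp
    moreover have "avg r e * ennreal V * ennreal (1 / V) = avg r e"
      using V0 by (simp add: mult.assoc ennreal_mult[symmetric])
    moreover have "ennreal (unit_ball_vol (real CARD('n)) * (2 * r) ^ CARD('n) * F) * ennreal (1 / V)
        = ennreal (unit_ball_vol (real CARD('n)) * 2 ^ CARD('n) * F / V * r ^ CARD('n))"
      using V0 r F0 by (simp add: ennreal_mult[symmetric] power_mult_distrib mult_ac)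
    ultimately show ?thesis by simp
  qed
  then show ?thesis by (intro exI[of _ "unit_ball_vol (real CARD('n)) * 2 ^ CARD('n) * F / V"]) blast
qed

text \<open>Restrict the integral to the ball of radius \<open>r * norm x / 2\<close> about
  \<open>x\<close>. There \<open>norm x / 2 < norm y\<close>, which gives nearness,
  \<open>norm y \<le> 2 * norm x\<close>, and \<open>\<phi> x / 2 \<le> \<phi> y\<close>; these
  losses make up the factor \<open>2 * 4 ^ CARD('n)\<close>.\<close>

lemma J_lower:
  assumes cont: "continuous_on UNIV \<phi>" and x: "x \<noteq> 0" and \<phi>: "0 < \<phi> x"
  shows "\<exists>d>0. \<forall>r. 0 < r \<and> r \<le> 1 / 2 \<and> r < d \<longrightarrow>
    ennreal (unit_ball_vol (real CARD('n)) / (2 * 4 ^ CARD('n)) * \<phi> x * r ^ CARD('n)) \<le> J r \<phi> x"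
proof -
  have "\<exists>\<delta>>0. \<forall>y. dist y x < \<delta> \<longrightarrow> dist (\<phi> y) (\<phi> x) < \<phi> x / 2"
    using cont \<phi> unfolding continuous_on_iff by (metis UNIV_I half_gt_zero)
  then obtain \<delta> where \<delta>: "0 < \<delta>" "\<And>y. dist y x < \<delta> \<Longrightarrow> dist (\<phi> y) (\<phi> x) < \<phi> x / 2" by blast
  have nx: "0 < norm x" using x by simp
  have "ennreal (unit_ball_vol (real CARD('n)) / (2 * 4 ^ CARD('n)) * \<phi> x * r ^ CARD('n)) \<le> J r \<phi> x"
    if r: "0 < r" "r \<le> 1 / 2" "r < \<delta> / norm x" for r
  proof -
    define \<rho> where "\<rho> = r * norm x / 2"
    have \<rho>: "0 < \<rho>" "\<rho> \<le> norm x / 4" using r nx by (simp_all add: \<rho>_def)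
    have "\<rho> < \<delta>" using r nx \<delta>(1) by (simp add: \<rho>_def field_simps)
    have "ennreal (unit_ball_vol (real CARD('n)) / (2 * 4 ^ CARD('n)) * \<phi> x * r ^ CARD('n))
        = ennreal (\<phi> x / 2 / (2 * norm x) ^ CARD('n)) * ennreal (unit_ball_vol (real CARD('n)) * \<rho> ^ CARD('n))"
      using nx \<phi> r by (simp add: \<rho>_def ennreal_mult[symmetric] power_mult_distrib power_divide field_simps)
        (simp add: power_mult_distrib[symmetric])
    also have "\<dots> = (\<integral>\<^sup>+y. ennreal (\<phi> x / 2 / (2 * norm x) ^ CARD('n)) * indicator (ball x \<rho>) y \<partial>lborel)"
      using \<rho> by (subst nn_integral_cmult) (auto simp: ball_volume intro!: borel_measurable_indicator)
    also have "\<dots> \<le> J r \<phi> x"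
      unfolding J_def
    proof (rule nn_integral_mono)
      fix y
      show "ennreal (\<phi> x / 2 / (2 * norm x) ^ CARD('n)) * indicator (ball x \<rho>) y
          \<le> ennreal (\<phi> y / norm y ^ CARD('n)) * indicator {y. near r x y} y"
      proof (cases "y \<in> ball x \<rho>")
        case True
        then have xy: "norm (x - y) < \<rho>" by (simp add: dist_norm)
        have y: "norm x / 2 < norm y" "norm y \<le> 2 * norm x"
          using xy \<rho> norm_triangle_ineq2[of x y] norm_triangle_ineq2[of y x] nx
          by (simp_all add: norm_minus_commute)
        have "\<rho> < r * norm y" using mult_strict_left_mono[OF y(1) r(1)] by (simp add: \<rho>_def)
        then have near: "near r x y" using xy by (simp add: near_def)
        have "dist y x < \<delta>" using xy \<open>\<rho> < \<delta>\<close> by (simp add: dist_norm norm_minus_commute)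
        then have "\<phi> x / 2 \<le> \<phi> y" using \<delta>(2)[of y] by (simp add: dist_real_def abs_if split: if_splits)
        moreover have "norm y ^ CARD('n) \<le> (2 * norm x) ^ CARD('n)" using y by (intro power_mono) auto
        moreover have "0 < norm y ^ CARD('n)" using y nx by (intro zero_less_power) linarith
        ultimately have "\<phi> x / 2 / (2 * norm x) ^ CARD('n) \<le> \<phi> y / norm y ^ CARD('n)"
          using \<phi> by (intro frac_le) auto
        then show ?thesis using near True by (simp add: ennreal_leI)
      qed simp
    qed
    finally show ?thesis .
  qed
  then show ?thesis using \<delta>(1) nx by (intro exI[of _ "\<delta> / norm x"]) auto
qed

text \<open>The upper bound on \<open>avg\<close> and the lower bound on \<open>J\<close> both carry
  \<open>r ^ CARD('n)\<close>, which cancels and leaves the constant \<open>C / c\<close>, the same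
  for all \<open>\<phi>\<close>. The threshold in \<open>J_lower\<close> depends on
  \<open>x\<close>, so the limit is taken pointwise and passed through the integral by Fatou's
  lemma.\<close>

theorem averaging_bound:
  "\<exists>C. \<forall>\<phi>. continuous_on UNIV \<phi> \<and> (\<forall>y. 0 \<le> \<phi> y) \<longrightarrow>
    (\<integral>\<^sup>+x. G x * ennreal (\<phi> x) \<partial>lborel) \<le> ennreal C * (\<integral>\<^sup>+x. ennreal (\<phi> x) \<partial>lborel)"
proof -
  define e :: "real ^ 'n" where "e = axis undefined 1"
  have e: "norm e = 1" by (simp add: e_def norm_axis_1)
  obtain C where C: "\<And>r. 0 < r \<Longrightarrow> r \<le> 1 / 2 \<Longrightarrow> avg r e \<le> ennreal (C * r ^ CARD('n))"
    using avg_bound[OF e] by blast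
  define c where "c = unit_ball_vol (real CARD('n)) / (2 * 4 ^ CARD('n))"
  have c: "0 < c" by (simp add: c_def)
  \<comment> \<open>The shift by 2 keeps \<open>r k\<close> in the range
    \<open>r \<le> 1 / 2\<close> of both estimates.\<close>
  define r where "r k = 1 / (real k + 2)" for k :: nat
  have r: "0 < r k" "r k \<le> 1 / 2" for k by (simp_all add: r_def)
  have r_lim: "r \<longlonglongrightarrow> 0"
  proof -
    have "(\<lambda>k. 1 / real (Suc (k + 1))) \<longlonglongrightarrow> 0"
      using LIMSEQ_ignore_initial_segment[OF LIMSEQ_inverse_real_of_nat, of 1] by (simp add: inverse_eq_divide)
    then show ?thesis by (simp add: r_def[abs_def] add.commute)
  qed
  have "(\<integral>\<^sup>+x. G x * ennreal (\<phi> x) \<partial>lborel) \<le> ennreal (C / c) * (\<integral>\<^sup>+x. ennreal (\<phi> x) \<partial>lborel)"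
    if cont: "continuous_on UNIV \<phi>" and nonneg: "\<And>y. 0 \<le> \<phi> y" for \<phi> :: "real ^ 'n \<Rightarrow> real"
  proof -
    have [measurable]: "\<phi> \<in> borel_measurable borel"
      using cont by (rule borel_measurable_continuous_onI)
    let ?K = "\<lambda>k x. G x * J (r k) \<phi> x * ennreal (1 / r k ^ CARD('n))"
    have [measurable]: "J r \<phi> \<in> borel_measurable borel" for r
    proof -
      have "(\<lambda>x. \<integral>\<^sup>+y. ennreal (\<phi> y / norm y ^ CARD('n)) * indicator {z. near r (fst z) (snd z)} (x, y) \<partial>lborel)
          \<in> borel_measurable borel"
        by measurable
      then show ?thesis by (simp add: J_def[abs_def] indicator_def)
    qed
    have "(\<integral>\<^sup>+x. ennreal c * (G x * ennreal (\<phi> x)) \<partial>lborel) \<le> (\<integral>\<^sup>+x. liminf (\<lambda>k. ?K k x) \<partial>lborel)"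
    proof (rule nn_integral_mono_AE)
      have "AE x in lborel. x \<noteq> (0 :: real ^ 'n)" by (rule AE_lborel_singleton)
      then show "AE x in lborel. ennreal c * (G x * ennreal (\<phi> x)) \<le> liminf (\<lambda>k. ?K k x)"
      proof eventually_elim
        fix x :: "real ^ 'n" assume x: "x \<noteq> 0"
        show "ennreal c * (G x * ennreal (\<phi> x)) \<le> liminf (\<lambda>k. ?K k x)"
        proof (cases "\<phi> x = 0")
          case False
          then have "0 < \<phi> x" using nonneg[of x] by simp
          from J_lower[OF cont x this] obtain d where d: "0 < d"
            "\<And>r. 0 < r \<Longrightarrow> r \<le> 1 / 2 \<Longrightarrow> r < d \<Longrightarrow> ennreal (c * \<phi> x * r ^ CARD('n)) \<le> J r \<phi> x"
            unfolding c_def by blast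
          show ?thesis
          proof (rule Liminf_bounded)
            show "\<forall>\<^sub>F k in sequentially. ennreal c * (G x * ennreal (\<phi> x)) \<le> ?K k x"
              using order_tendstoD(2)[OF r_lim d(1)]
            proof eventually_elim
              fix k assume k: "r k < d"
              have "ennreal c * (G x * ennreal (\<phi> x))
                  = G x * ennreal (c * \<phi> x * r k ^ CARD('n)) * ennreal (1 / r k ^ CARD('n))"
                using r[of k] c nonneg[of x]
                by (simp add: mult.assoc ennreal_mult[symmetric]) (simp add: ennreal_mult mult_ac)
              also have "\<dots> \<le> ?K k x"
                by (intro mult_right_mono mult_left_mono d(2) r k) simp_all
              finally show "ennreal c * (G x * ennreal (\<phi> x)) \<le> ?K k x" .
            qed
          qed
        qed simp
      qed
    qed
    also have "\<dots> \<le> liminf (\<lambda>k. \<integral>\<^sup>+x. ?K k x \<partial>lborel)"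
      by (rule nn_integral_liminf) measurable
    also have "\<dots> \<le> ennreal C * (\<integral>\<^sup>+x. ennreal (\<phi> x) \<partial>lborel)"
    proof (rule Liminf_le)
      have "(\<integral>\<^sup>+x. ?K k x \<partial>lborel) \<le> ennreal C * (\<integral>\<^sup>+x. ennreal (\<phi> x) \<partial>lborel)" for k
      proof -
        have "(\<integral>\<^sup>+x. ?K k x \<partial>lborel) = avg (r k) e * (\<integral>\<^sup>+y. ennreal (\<phi> y) \<partial>lborel) * ennreal (1 / r k ^ CARD('n))"
          by (subst nn_integral_multc) (simp_all add: J_integral_avg[OF _ e nonneg])
        also have "\<dots> \<le> ennreal (C * r k ^ CARD('n)) * (\<integral>\<^sup>+y. ennreal (\<phi> y) \<partial>lborel) * ennreal (1 / r k ^ CARD('n))"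
          by (intro mult_right_mono C r) simp_all
        also have "\<dots> = ennreal C * (\<integral>\<^sup>+y. ennreal (\<phi> y) \<partial>lborel)"
        proof -
          have "ennreal (C * r k ^ CARD('n)) * ennreal (1 / r k ^ CARD('n)) = ennreal C"
            using r[of k] by (subst ennreal_mult''[symmetric]) auto
          then show ?thesis by (metis mult.assoc mult.commute)
        qed
        finally show ?thesis .
      qed
      then show "\<forall>\<^sub>F k in sequentially. (\<integral>\<^sup>+x. ?K k x \<partial>lborel) \<le> ennreal C * (\<integral>\<^sup>+x. ennreal (\<phi> x) \<partial>lborel)"
        by simp
    qed simp
    finally have "ennreal c * (\<integral>\<^sup>+x. G x * ennreal (\<phi> x) \<partial>lborel) \<le> ennreal C * (\<integral>\<^sup>+x. ennreal (\<phi> x) \<partial>lborel)"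
      by (simp add: nn_integral_cmult)
    then have "ennreal (1 / c) * (ennreal c * (\<integral>\<^sup>+x. G x * ennreal (\<phi> x) \<partial>lborel))
        \<le> ennreal (1 / c) * (ennreal C * (\<integral>\<^sup>+x. ennreal (\<phi> x) \<partial>lborel))"
      by (rule mult_left_mono) simp
    moreover have "ennreal (1 / c) * (ennreal c * Z) = Z" for Z
      using c by (simp add: mult.assoc[symmetric] ennreal_mult[symmetric])
    moreover have "ennreal (1 / c) * (ennreal C * Z) = ennreal (C / c) * Z" for Z
      using c by (simp add: mult.assoc[symmetric] ennreal_mult'[symmetric])
    ultimately show ?thesis by simp
  qed
  then show ?thesis by blast
qed

end

section \<open>Rotation invariance of the Fourier transform\<close>

text \<open>Valued in \<open>ennreal\<close>, so that estimates can be chained before the functions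
  involved are known to be square integrable.\<close>

definition l2sq :: "('a::euclidean_space \<Rightarrow> complex) \<Rightarrow> ennreal" where
  "l2sq f = (\<integral>\<^sup>+x. ennreal ((cmod (f x))\<^sup>2) \<partial>lborel)"

lemma cmod_diff_square_le: "(cmod (x - y))\<^sup>2 \<le> 2 * (cmod (x - z))\<^sup>2 + 2 * (cmod (z - y))\<^sup>2"
proof -
  have "(cmod (x - y))\<^sup>2 \<le> (cmod (x - z) + cmod (z - y))\<^sup>2"
    using norm_triangle_ineq[of "x - z" "z - y"] by (intro power_mono) auto
  also have "\<dots> \<le> 2 * (cmod (x - z))\<^sup>2 + 2 * (cmod (z - y))\<^sup>2"
    using sum_squares_bound[of "cmod (x - z)" "cmod (z - y)"] by (simp add: power2_sum)
  finally show ?thesis .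
qed

lemma ennreal_cmod_diff_square_le:
  "ennreal ((cmod (x - y))\<^sup>2) \<le> 2 * ennreal ((cmod (x - z))\<^sup>2) + 2 * ennreal ((cmod (z - y))\<^sup>2)"
proof -
  have "ennreal ((cmod (x - y))\<^sup>2) \<le> ennreal (2 * (cmod (x - z))\<^sup>2 + 2 * (cmod (z - y))\<^sup>2)"
    by (rule ennreal_leI) (rule cmod_diff_square_le)
  also have "\<dots> = 2 * ennreal ((cmod (x - z))\<^sup>2) + 2 * ennreal ((cmod (z - y))\<^sup>2)"
    by (simp add: ennreal_mult)
  finally show ?thesis .
qed

lemma l2sq_diff_le:
  assumes [measurable]: "f \<in> borel_measurable borel" "g \<in> borel_measurable borel" "k \<in> borel_measurable borel"
  shows "l2sq (\<lambda>x. f x - g x) \<le> 2 * l2sq (\<lambda>x. f x - k x) + 2 * l2sq (\<lambda>x. k x - g x)"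
proof -
  have "l2sq (\<lambda>x. f x - g x) \<le> (\<integral>\<^sup>+x. 2 * ennreal ((cmod (f x - k x))\<^sup>2) + 2 * ennreal ((cmod (k x - g x))\<^sup>2) \<partial>lborel)"
    unfolding l2sq_def by (intro nn_integral_mono ennreal_cmod_diff_square_le)
  also have "\<dots> = 2 * l2sq (\<lambda>x. f x - k x) + 2 * l2sq (\<lambda>x. k x - g x)"
    unfolding l2sq_def by (simp add: nn_integral_add nn_integral_cmult)
  finally show ?thesis .
qed

lemma l2sq_diff_commute: "l2sq (\<lambda>x. f x - g x) = l2sq (\<lambda>x. g x - f x)"
  by (simp add: l2sq_def norm_minus_commute)

lemma l2sq_cong_AE: "AE x in lborel. f x = g x \<Longrightarrow> l2sq f = l2sq g"
  unfolding l2sq_def by (rule nn_integral_cong_AE) (auto elim: eventually_mono)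

lemma l2sq_rotation:
  fixes R :: "real ^ 'n ^ 'n"
  assumes "orthogonal_matrix R" and [measurable]: "f \<in> borel_measurable borel"
  shows "l2sq (\<lambda>x. f (R *v x)) = l2sq f"
  unfolding l2sq_def by (rule nn_integral_rotation[OF assms(1)]) measurable

lemma l2sq_eq_0_AE:
  assumes [measurable]: "f \<in> borel_measurable borel" and "l2sq f = 0"
  shows "AE x in lborel. f x = 0"
proof -
  have "AE x in lborel. ennreal ((cmod (f x))\<^sup>2) = 0"
    using assms(2) unfolding l2sq_def by (subst (asm) nn_integral_0_iff_AE) auto
  then show ?thesis by eventually_elim simp
qed

lemma fourier_rotation:
  fixes R :: "real ^ 'n ^ 'n"
  assumes R: "orthogonal_matrix R" and [measurable]: "f \<in> borel_measurable borel"
  shows "fourier (\<lambda>t. f (R *v t)) \<omega> = fourier f (R *v \<omega>)"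
proof -
  have "fourier (\<lambda>t. f (R *v t)) \<omega> = (LINT t|lborel. f (R *v t) * cis (- (2 * pi * ((R *v t) \<bullet> (R *v \<omega>)))))"
    by (simp only: fourier_cis orthogonal_matrix_inner(1)[OF R])
  also have "\<dots> = fourier f (R *v \<omega>)"
    unfolding fourier_cis by (rule integral_rotation[OF R]) measurable
  finally show ?thesis .
qed

lemma fourier_diff:
  assumes "integrable lborel f" "integrable lborel g"
  shows "fourier (\<lambda>t. f t - g t) \<omega> = fourier f \<omega> - fourier g \<omega>"
proof -
  have int: "integrable lborel (\<lambda>t. F t * cis (- (2 * pi * (t \<bullet> \<omega>))))" if F: "integrable lborel F" for F :: "'a \<Rightarrow> complex"
  proof -
    have [measurable]: "F \<in> borel_measurable borel" using borel_measurable_integrable[OF F] by simp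
    show ?thesis
      by (rule Bochner_Integration.integrable_bound[OF F]) (measurable, simp add: norm_mult)
  qed
  show ?thesis
    unfolding fourier_cis left_diff_distrib by (intro Bochner_Integration.integral_diff int assms)
qed

text \<open>\<open>h\<close> is known only through its approximants. For these the rotation defect
  of \<open>fourier (u n)\<close> is the transform of the defect of \<open>u n\<close>, which
  \<open>fourier_L2_le\<close> controls and which tends to 0 because \<open>g\<close> is
  invariant.\<close>

lemma fourier_transform_rotation_invariant:
  fixes R :: "real ^ 'n ^ 'n"
  assumes R: "orthogonal_matrix R" and sq: "square_integrable g" "square_integrable h"
    and ft: "is_fourier_transform (abs_l2 g) (abs_l2 h)"
    and inv: "AE t in lborel. g (R *v t) = g t"
  shows "AE \<omega> in lborel. h (R *v \<omega>) = h \<omega>"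
proof -
  note [measurable] = sq[THEN square_integrable_measurable]
  obtain u where u: "\<And>n. integrable lborel (u n)" "\<And>n. square_integrable (u n)"
      "\<And>n. square_integrable (fourier (u n))"
    and lim: "(\<lambda>n. abs_l2 (u n)) \<longlonglongrightarrow> abs_l2 g" "(\<lambda>n. abs_l2 (fourier (u n))) \<longlonglongrightarrow> abs_l2 h"
    using ft unfolding is_fourier_transform_def by blast
  have [measurable]: "u n \<in> borel_measurable borel" for n
    using u(2) by (rule square_integrable_measurable)
  let ?v = "\<lambda>n. fourier (u n)"
  define A where "A n = l2sq (\<lambda>x. ?v n x - h x)" for n
  define B where "B n = l2sq (\<lambda>x. u n x - g x)" for n
  have A: "A \<longlonglongrightarrow> 0"
    using lim(2) unfolding A_def l2sq_def by (subst (asm) abs_l2_tendsto_iff[OF u(3) sq(2)])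
  have B: "B \<longlonglongrightarrow> 0"
    using lim(1) unfolding B_def l2sq_def by (subst (asm) abs_l2_tendsto_iff[OF u(2) sq(1)])
  have le: "l2sq (\<lambda>\<omega>. h (R *v \<omega>) - h \<omega>) \<le> 2 * A n + 2 * (2 * (2 * B n + 2 * B n) + 2 * A n)" for n
  proof -
    have "l2sq (\<lambda>\<omega>. h (R *v \<omega>) - h \<omega>) \<le> 2 * l2sq (\<lambda>\<omega>. h (R *v \<omega>) - ?v n (R *v \<omega>)) + 2 * l2sq (\<lambda>\<omega>. ?v n (R *v \<omega>) - h \<omega>)"
      by (rule l2sq_diff_le) measurable
    also have "l2sq (\<lambda>\<omega>. h (R *v \<omega>) - ?v n (R *v \<omega>)) = A n"
      unfolding A_def l2sq_diff_commute[of "?v n"] by (rule l2sq_rotation[OF R]) measurable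
    also have "l2sq (\<lambda>\<omega>. ?v n (R *v \<omega>) - h \<omega>) \<le> 2 * l2sq (\<lambda>\<omega>. ?v n (R *v \<omega>) - ?v n \<omega>) + 2 * A n"
      unfolding A_def by (rule l2sq_diff_le) measurable
    also have "l2sq (\<lambda>\<omega>. ?v n (R *v \<omega>) - ?v n \<omega>) \<le> l2sq (\<lambda>t. u n (R *v t) - u n t)"
    proof -
      have "?v n (R *v \<omega>) - ?v n \<omega> = fourier (\<lambda>t. u n (R *v t) - u n t) \<omega>" for \<omega>
        by (subst fourier_diff[OF integrable_rotation[OF R u(1)] u(1)])
          (simp add: fourier_rotation[OF R])
      then show ?thesis
        unfolding l2sq_def using fourier_L2_le[OF Bochner_Integration.integrable_diff[OF integrable_rotation[OF R u(1)] u(1)]]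
        by simp
    qed
    also have "l2sq (\<lambda>t. u n (R *v t) - u n t) \<le> 2 * l2sq (\<lambda>t. u n (R *v t) - g t) + 2 * l2sq (\<lambda>t. g t - u n t)"
      by (rule l2sq_diff_le) measurable
    also have "l2sq (\<lambda>t. u n (R *v t) - g t) = l2sq (\<lambda>t. u n (R *v t) - g (R *v t))"
      using inv by (intro l2sq_cong_AE) (auto elim: eventually_mono)
    also have "\<dots> = B n"
      unfolding B_def by (rule l2sq_rotation[OF R]) measurable
    also have "l2sq (\<lambda>t. g t - u n t) = B n"
      unfolding B_def by (rule l2sq_diff_commute)
    finally show ?thesis by (simp add: mult_left_mono add_left_mono)
  qed
  have "(\<lambda>n. 2 * A n + 2 * (2 * (2 * B n + 2 * B n) + 2 * A n)) \<longlonglongrightarrow> 2 * 0 + 2 * (2 * (2 * 0 + 2 * 0) + 2 * 0)"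
    by (intro tendsto_add ennreal_tendsto_cmult A B) simp_all
  then have "l2sq (\<lambda>\<omega>. h (R *v \<omega>) - h \<omega>) \<le> 2 * 0 + 2 * (2 * (2 * 0 + 2 * 0) + 2 * 0)"
    by (rule LIMSEQ_le_const) (use le in blast)
  then have "l2sq (\<lambda>\<omega>. h (R *v \<omega>) - h \<omega>) = 0" by simp
  then have "AE \<omega> in lborel. h (R *v \<omega>) - h \<omega> = 0"
    by (intro l2sq_eq_0_AE) measurable
  then show ?thesis by eventually_elim simp
qed

text \<open>Dilation invariance is the invariance of \<open>da / |a|\<close>. For the integrability
  over the shell, substitute \<open>a\<close> times the variable: the shell condition confines
  \<open>|a|\<close> to a range proportional to the new norm, the integral of
  \<open>da / |a|\<close> over that range is bounded, and the admissibility integral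
  remains.\<close>

lemma dilation_average_invariant:
  fixes h :: "real ^ 'n \<Rightarrow> complex"
  assumes [measurable]: "h \<in> borel_measurable borel"
    and rot: "\<And>R :: real ^ 'n ^ 'n. rotation_matrix R \<Longrightarrow> AE \<omega> in lborel. h (R *v \<omega>) = h \<omega>"
    and fin: "(\<integral>\<^sup>+\<omega>. ennreal ((cmod (h \<omega>))\<^sup>2 / norm \<omega> ^ CARD('n)) \<partial>lborel) < \<infinity>"
  shows "rotation_dilation_invariant (\<lambda>\<omega>. \<integral>\<^sup>+a. ennreal ((cmod (h (a *\<^sub>R \<omega>)))\<^sup>2 / \<bar>a\<bar>) \<partial>lborel)"
proof
  let ?F = "\<lambda>\<omega> a. ennreal ((cmod (h (a *\<^sub>R \<omega>)))\<^sup>2 / \<bar>a\<bar>)"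
  show [measurable]: "(\<lambda>\<omega>. \<integral>\<^sup>+a. ?F \<omega> a \<partial>lborel) \<in> borel_measurable borel" by measurable
  show "(\<integral>\<^sup>+a. ?F (c *\<^sub>R \<omega>) a \<partial>lborel) = (\<integral>\<^sup>+a. ?F \<omega> a \<partial>lborel)" if c: "c \<noteq> 0" for c \<omega>
  proof -
    have "(\<integral>\<^sup>+a. ?F \<omega> a \<partial>lborel) = ennreal \<bar>c\<bar> * (\<integral>\<^sup>+a. ?F \<omega> (0 + c * a) \<partial>lborel)"
      by (rule nn_integral_real_affine) (use c in measurable)
    also have "\<dots> = (\<integral>\<^sup>+a. ennreal \<bar>c\<bar> * ?F \<omega> (0 + c * a) \<partial>lborel)"
      by (rule nn_integral_cmult[symmetric]) measurable
    also have "\<dots> = (\<integral>\<^sup>+a. ?F (c *\<^sub>R \<omega>) a \<partial>lborel)"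
      using c by (intro nn_integral_cong) (simp add: ennreal_mult'[symmetric] abs_mult mult.commute)
    finally show ?thesis by simp
  qed
  show "AE \<omega> in lborel. (\<integral>\<^sup>+a. ?F (R *v \<omega>) a \<partial>lborel) = (\<integral>\<^sup>+a. ?F \<omega> a \<partial>lborel)"
    if R: "rotation_matrix R" for R :: "real ^ 'n ^ 'n"
  proof -
    have R_scale: "R *v (a *\<^sub>R \<omega>) = a *\<^sub>R (R *v \<omega>)" for a \<omega>
      by (rule matrix_vector_mult_scaleR)
    have "AE \<omega> in lborel. h (a *\<^sub>R (R *v \<omega>)) = h (a *\<^sub>R \<omega>)" for a
    proof (cases "a = 0")
      case False
      from AE_lborel_affine[OF False rot[OF R], of 0] show ?thesis by (simp add: R_scale)
    qed simp
    \<comment> \<open>The exceptional set of frequencies depends on \<open>a\<close>. Exchanging the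
      two quantifiers gives one null set of frequencies outside which equality holds for almost
      every \<open>a\<close>, enough for the integrals over \<open>a\<close> to agree.\<close>
    then have "AE a in lborel. AE \<omega> in lborel. h (a *\<^sub>R (R *v \<omega>)) = h (a *\<^sub>R \<omega>)" by simp
    then have "AE \<omega> in lborel. AE a in lborel. h (a *\<^sub>R (R *v \<omega>)) = h (a *\<^sub>R \<omega>)"
      by (subst (asm) lborel_pair.AE_commute) measurable
    then show ?thesis
    proof eventually_elim
      fix \<omega> assume "AE a in lborel. h (a *\<^sub>R (R *v \<omega>)) = h (a *\<^sub>R \<omega>)"
      then show "(\<integral>\<^sup>+a. ?F (R *v \<omega>) a \<partial>lborel) = (\<integral>\<^sup>+a. ?F \<omega> a \<partial>lborel)"
        by (intro nn_integral_cong_AE) (auto elim: eventually_mono)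
    qed
  qed
  let ?S = "{x :: real ^ 'n. 1 / 2 < norm x \<and> norm x < 4}"
  have [measurable]: "?S \<in> sets borel" by measurable
  let ?n = "CARD('n)"
  let ?W = "\<lambda>\<eta>. ennreal (4 ^ ?n * ((cmod (h \<eta>))\<^sup>2 / norm \<eta> ^ ?n))"
  \<comment> \<open>The shell condition on \<open>\<eta> / a\<close>, read as a condition on
    \<open>a\<close>. Its lower bound for \<open>|a|\<close> also bounds the Jacobian
    \<open>1 / |a|^n\<close> by \<open>(4 / norm \<eta>)^n\<close>, the origin of the factor
    \<open>4 ^ ?n\<close> in \<open>?W\<close>.\<close>
  let ?T = "\<lambda>\<eta>. {a. norm \<eta> / 4 < \<bar>a\<bar> \<and> \<bar>a\<bar> < 2 * norm \<eta>}"
  have "(\<integral>\<^sup>+x. (\<integral>\<^sup>+a. ?F x a \<partial>lborel) * indicator ?S x \<partial>lborel)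
      = (\<integral>\<^sup>+x. \<integral>\<^sup>+a. ?F x a * indicator ?S x \<partial>lborel \<partial>lborel)"
    by (intro nn_integral_cong nn_integral_multc[symmetric]) measurable
  also have "\<dots> = (\<integral>\<^sup>+a. \<integral>\<^sup>+x. ?F x a * indicator ?S x \<partial>lborel \<partial>lborel)"
    by (rule lborel_pair.Fubini'[symmetric]) measurable
  also have "\<dots> \<le> (\<integral>\<^sup>+a. \<integral>\<^sup>+\<eta>. ?W \<eta> * ennreal (1 / \<bar>a\<bar> * indicator (?T \<eta>) a) \<partial>lborel \<partial>lborel)"
  proof (rule nn_integral_mono)
    fix a :: real
    show "(\<integral>\<^sup>+x. ?F x a * indicator ?S x \<partial>lborel) \<le> (\<integral>\<^sup>+\<eta>. ?W \<eta> * ennreal (1 / \<bar>a\<bar> * indicator (?T \<eta>) a) \<partial>lborel)"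
    proof (cases "a = 0")
      case False
      have "(\<integral>\<^sup>+x. ?F x a * indicator ?S x \<partial>lborel)
          = ennreal (\<bar>inverse a\<bar> ^ DIM(real ^ 'n)) * (\<integral>\<^sup>+\<eta>. ?F (0 + inverse a *\<^sub>R \<eta>) a * indicator ?S (0 + inverse a *\<^sub>R \<eta>) \<partial>lborel)"
        by (rule nn_integral_lborel_affine) (measurable, use False in simp)
      also have "\<dots> = (\<integral>\<^sup>+\<eta>. ennreal (\<bar>inverse a\<bar> ^ ?n) * (?F (inverse a *\<^sub>R \<eta>) a * indicator ?S (inverse a *\<^sub>R \<eta>)) \<partial>lborel)"
        by (subst nn_integral_cmult) simp_all
      also have "\<dots> \<le> (\<integral>\<^sup>+\<eta>. ?W \<eta> * ennreal (1 / \<bar>a\<bar> * indicator (?T \<eta>) a) \<partial>lborel)"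
      proof (rule nn_integral_mono)
        fix \<eta> :: "real ^ 'n"
        show "ennreal (\<bar>inverse a\<bar> ^ ?n) * (?F (inverse a *\<^sub>R \<eta>) a * indicator ?S (inverse a *\<^sub>R \<eta>))
            \<le> ?W \<eta> * ennreal (1 / \<bar>a\<bar> * indicator (?T \<eta>) a)"
        proof (cases "inverse a *\<^sub>R \<eta> \<in> ?S")
          case True
          then have T: "norm \<eta> / 4 < \<bar>a\<bar>" "\<bar>a\<bar> < 2 * norm \<eta>"
            using False by (simp_all add: field_simps)
          then have \<eta>: "0 < norm \<eta>" by linarith
          have "\<bar>inverse a\<bar> \<le> 4 / norm \<eta>"
            using T \<eta> False by (simp add: field_simps)
          then have "\<bar>inverse a\<bar> ^ ?n \<le> (4 / norm \<eta>) ^ ?n" by (intro power_mono) auto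
          then have "\<bar>inverse a\<bar> ^ ?n * ((cmod (h \<eta>))\<^sup>2 / \<bar>a\<bar>) \<le> (4 / norm \<eta>) ^ ?n * ((cmod (h \<eta>))\<^sup>2 / \<bar>a\<bar>)"
            by (intro mult_right_mono) auto
          also have "\<dots> = 4 ^ ?n * ((cmod (h \<eta>))\<^sup>2 / norm \<eta> ^ ?n) * (1 / \<bar>a\<bar>)"
            by (simp add: power_divide)
          finally show ?thesis
            using True T False by (simp add: ennreal_mult[symmetric] ennreal_leI)
        qed simp
      qed
      finally show ?thesis .
    qed simp
  qed
  also have "\<dots> = (\<integral>\<^sup>+\<eta>. \<integral>\<^sup>+a. ?W \<eta> * ennreal (1 / \<bar>a\<bar> * indicator (?T \<eta>) a) \<partial>lborel \<partial>lborel)"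
  proof (rule lborel_pair.Fubini')
    have "(\<lambda>z. ?W (fst z) * ennreal (1 / \<bar>snd z\<bar> * indicator {z. norm (fst z) / 4 < \<bar>snd z\<bar> \<and> \<bar>snd z\<bar> < 2 * norm (fst z)} z))
        \<in> borel_measurable ((lborel :: (real ^ 'n) measure) \<Otimes>\<^sub>M (lborel :: real measure))"
      by measurable
    then show "(\<lambda>(\<eta>, a). ?W \<eta> * ennreal (1 / \<bar>a\<bar> * indicator (?T \<eta>) a))
        \<in> borel_measurable ((lborel :: (real ^ 'n) measure) \<Otimes>\<^sub>M (lborel :: real measure))"
      by (simp add: indicator_def case_prod_unfold)
  qed
  also have "\<dots> \<le> (\<integral>\<^sup>+\<eta>. ?W \<eta> * ennreal 16 \<partial>lborel)"
  proof (rule nn_integral_mono)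
    fix \<eta> :: "real ^ 'n"
    have "(\<integral>\<^sup>+a. ennreal (1 / \<bar>a\<bar> * indicator (?T \<eta>) a) \<partial>lborel) \<le> ennreal 16"
    proof (cases "\<eta> = 0")
      case True
      then have "1 / \<bar>a\<bar> * indicator (?T \<eta>) a = 0" for a :: real
        by (auto simp: indicator_def)
      then show ?thesis by (simp only: ennreal_0 nn_integral_const) simp
    next
      case False
      \<comment> \<open>On \<open>?T \<eta>\<close> the integrand is at most
        \<open>4 / norm \<eta>\<close>, and \<open>?T \<eta>\<close> lies in an interval of length
        \<open>4 * norm \<eta>\<close>; the product 16 is independent of
        \<open>\<eta>\<close>.\<close>
      have "(\<integral>\<^sup>+a. ennreal (1 / \<bar>a\<bar> * indicator (?T \<eta>) a) \<partial>lborel)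
          \<le> (\<integral>\<^sup>+a. ennreal (4 / norm \<eta>) * indicator {- (2 * norm \<eta>)..2 * norm \<eta>} a \<partial>lborel)"
      proof (rule nn_integral_mono)
        fix a :: real
        show "ennreal (1 / \<bar>a\<bar> * indicator (?T \<eta>) a) \<le> ennreal (4 / norm \<eta>) * indicator {- (2 * norm \<eta>)..2 * norm \<eta>} a"
        proof (cases "a \<in> ?T \<eta>")
          case True
          then have "1 / \<bar>a\<bar> \<le> 1 / (norm \<eta> / 4)" using False by (intro frac_le) auto
          then have "1 / \<bar>a\<bar> \<le> 4 / norm \<eta>" by simp
          moreover have "a \<in> {- (2 * norm \<eta>)..2 * norm \<eta>}" using True by auto
          ultimately show ?thesis using True by (simp add: ennreal_leI)
        qed simp
      qed
      also have "\<dots> = ennreal (4 / norm \<eta>) * ennreal (4 * norm \<eta>)"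
        by (subst nn_integral_cmult) auto
      also have "\<dots> = ennreal 16" using False by (simp add: ennreal_mult[symmetric])
      finally show ?thesis .
    qed
    then have "?W \<eta> * (\<integral>\<^sup>+a. ennreal (1 / \<bar>a\<bar> * indicator (?T \<eta>) a) \<partial>lborel) \<le> ?W \<eta> * ennreal 16"
      by (intro mult_left_mono) auto
    then show "(\<integral>\<^sup>+a. ?W \<eta> * ennreal (1 / \<bar>a\<bar> * indicator (?T \<eta>) a) \<partial>lborel) \<le> ?W \<eta> * ennreal 16"
      by (subst nn_integral_cmult) (auto intro!: borel_measurable_indicator)
  qed
  also have "\<dots> = ennreal (4 ^ ?n) * (\<integral>\<^sup>+\<eta>. ennreal ((cmod (h \<eta>))\<^sup>2 / norm \<eta> ^ ?n) \<partial>lborel) * ennreal 16"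
  proof -
    have W: "?W \<eta> = ennreal (4 ^ ?n) * ennreal ((cmod (h \<eta>))\<^sup>2 / norm \<eta> ^ ?n)" for \<eta>
      by (rule ennreal_mult) simp_all
    have "(\<integral>\<^sup>+\<eta>. ?W \<eta> \<partial>lborel) = ennreal (4 ^ ?n) * (\<integral>\<^sup>+\<eta>. ennreal ((cmod (h \<eta>))\<^sup>2 / norm \<eta> ^ ?n) \<partial>lborel)"
      unfolding W by (rule nn_integral_cmult) measurable
    moreover have "(\<integral>\<^sup>+\<eta>. ?W \<eta> * ennreal 16 \<partial>lborel) = (\<integral>\<^sup>+\<eta>. ?W \<eta> \<partial>lborel) * ennreal 16"
      by (rule nn_integral_multc) measurable
    ultimately show ?thesis by (simp only:)
  qed
  also have "\<dots> < \<infinity>"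
    using fin by (simp add: ennreal_mult_less_top)
  finally show "(\<integral>\<^sup>+x. (\<integral>\<^sup>+a. ?F x a \<partial>lborel) * indicator ?S x \<partial>lborel) < \<infinity>" .
qed

section \<open>Density of continuous functions\<close>

text \<open>Integrability makes \<open>fourier f\<close> bounded and continuous. Continuity and
  boundedness pass to correlations with integrable functions, which can then be put into
  \<open>L2_le_fourier\<close>.\<close>

definition test_fun :: "('a::euclidean_space \<Rightarrow> complex) \<Rightarrow> bool" where
  "test_fun f \<longleftrightarrow> continuous_on UNIV f \<and> (\<exists>A. \<forall>t. cmod (f t) \<le> A) \<and> integrable lborel f \<and> square_integrable f"

lemma test_fun_add:
  assumes "test_fun f" "test_fun g"
  shows "test_fun (\<lambda>x. f x + g x)"
proof -
  obtain A B where "\<And>t. cmod (f t) \<le> A" "\<And>t. cmod (g t) \<le> B"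
    using assms by (auto simp: test_fun_def)
  then have "cmod (f t + g t) \<le> A + B" for t
    by (meson add_mono norm_triangle_le)
  then show ?thesis
    using assms unfolding test_fun_def
    by (intro conjI exI[of _ "A + B"] allI continuous_on_add Bochner_Integration.integrable_add square_integrable_add) auto
qed

lemma test_fun_mult:
  assumes "test_fun f"
  shows "test_fun (\<lambda>x. c * f x)"
proof -
  obtain A where A: "\<And>t. cmod (f t) \<le> A"
    using assms by (auto simp: test_fun_def)
  have "cmod (c * f t) \<le> cmod c * A" for t
    unfolding norm_mult by (intro mult_left_mono A norm_ge_zero)
  then show ?thesis
    using assms unfolding test_fun_def
    by (intro conjI exI[of _ "cmod c * A"] allI continuous_on_mult continuous_on_const
        integrable_mult_right square_integrable_mult_const) auto
qed

lemma test_fun_0: "test_fun (\<lambda>x. 0)"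
  by (auto simp: test_fun_def square_integrable_0)

definition cutoff :: "'a::euclidean_space \<Rightarrow> 'a \<Rightarrow> nat \<Rightarrow> 'a \<Rightarrow> real" where
  "cutoff p q k x = min 1 (real k * infdist x (- box p q))"

lemma cutoff_bounds: "0 \<le> cutoff p q k x" "cutoff p q k x \<le> indicator (box p q) x"
  by (auto simp: cutoff_def indicator_def infdist_nonneg)

lemma cutoff_continuous: "continuous_on UNIV (cutoff p q k)"
  unfolding cutoff_def by (intro continuous_intros)

lemma cutoff_tendsto: "(\<lambda>k. cutoff p q k x) \<longlonglongrightarrow> indicator (box p q) x"
proof (cases "x \<in> box p q")
  case True
  \<comment> \<open>\<open>infdist\<close> to the empty set is 0 by convention, so positivity of the
    distance requires a nonempty complement.\<close>
  have "- box p q \<noteq> {}"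
  proof
    assume "- box p q = {}"
    then have "box p q = UNIV" by blast
    then show False using bounded_box[of p q] not_bounded_UNIV by simp
  qed
  then have d: "0 < infdist x (- box p q)"
    using True by (intro infdist_pos_not_in_closed) (auto simp: closed_Compl open_box)
  obtain K where K: "1 / infdist x (- box p q) < real K" using reals_Archimedean2 by blast
  have "cutoff p q k x = 1" if "k \<ge> K" for k
  proof -
    have "1 / infdist x (- box p q) \<le> real k" using K that by linarith
    then have "1 \<le> real k * infdist x (- box p q)" using d by (simp add: divide_le_eq)
    then show ?thesis by (simp add: cutoff_def)
  qed
  then have "\<forall>\<^sub>F k in sequentially. cutoff p q k x = 1" by (auto simp: eventually_sequentially)
  then show ?thesis using True by (simp add: tendsto_eventually)
next
  case False
  then show ?thesis by (simp add: cutoff_def)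
qed

lemma cutoff_measurable [measurable]: "cutoff p q k \<in> borel_measurable borel"
  by (intro borel_measurable_continuous_onI cutoff_continuous)

lemma test_fun_cutoff: "test_fun (\<lambda>x. complex_of_real (cutoff p q k x))"
proof -
  have b: "cmod (complex_of_real (cutoff p q k x)) \<le> indicator (box p q) x" for x
    using cutoff_bounds[of p q k x] by simp
  have int: "integrable lborel (\<lambda>x. indicator (box p q) x :: real)"
    using emeasure_bounded_finite[OF bounded_box, of p q] by (simp add: integrable_real_indicator)
  have "integrable lborel (\<lambda>x. complex_of_real (cutoff p q k x))"
    by (rule Bochner_Integration.integrable_bound[OF int])
      (measurable, intro AE_I2, use b in simp)
  moreover have "integrable lborel (\<lambda>x. (cmod (complex_of_real (cutoff p q k x)))\<^sup>2)"
  proof (rule Bochner_Integration.integrable_bound[OF int])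
    show "AE x in lborel. norm ((cmod (complex_of_real (cutoff p q k x)))\<^sup>2) \<le> norm (indicator (box p q) x :: real)"
    proof (rule AE_I2)
      fix x
      have "(cmod (complex_of_real (cutoff p q k x)))\<^sup>2 \<le> (indicator (box p q) x)\<^sup>2"
        by (intro power_mono b) simp
      also have "(indicator (box p q) x)\<^sup>2 = (indicator (box p q) x :: real)"
        by (simp add: indicator_def)
      finally show "norm ((cmod (complex_of_real (cutoff p q k x)))\<^sup>2) \<le> norm (indicator (box p q) x :: real)"
        by simp
    qed
  qed measurable
  moreover have "cmod (complex_of_real (cutoff p q k x)) \<le> 1" for x
    using b[of x] by (rule order_trans) (simp add: indicator_def)
  ultimately show ?thesis
    unfolding test_fun_def square_integrable_def
    by (auto intro!: continuous_on_of_real cutoff_continuous)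
qed

text \<open>It suffices that a function orthogonal to all test functions vanishes. Testing against
  continuous cutoffs gives, in the limit, vanishing integrals over all boxes.\<close>

lemma test_fun_dense:
  assumes f: "square_integrable f"
  obtains u where "\<And>j. test_fun (u j)" "(\<lambda>j. abs_l2 (u j)) \<longlonglongrightarrow> abs_l2 f"
proof -
  let ?S = "{abs_l2 u | u. test_fun u} :: 'a l2 set"
  have "closure ?S = UNIV"
  proof (rule dense_if_orthogonal_trivial)
    show "subspace ?S"
      unfolding subspace_def
    proof (intro conjI ballI allI)
      show "0 \<in> ?S" using test_fun_0 by (auto simp: zero_l2_def intro!: exI[of _ "\<lambda>x. 0"])
      fix x assume "x \<in> ?S"
      then obtain u where u: "test_fun u" "x = abs_l2 u" by blast
      show "c *\<^sub>R x \<in> ?S" for c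
      proof -
        have "c *\<^sub>R x = abs_l2 (\<lambda>t. complex_of_real c * u t)"
          using u by (simp add: scaleR_scaleC test_fun_def scaleC.abs_eq l2_eq_refl)
        then show ?thesis using test_fun_mult[OF u(1)] by blast
      qed
      fix y assume "y \<in> ?S"
      then obtain v where v: "test_fun v" "y = abs_l2 v" by blast
      have "x + y = abs_l2 (\<lambda>t. u t + v t)"
        using u v by (simp add: test_fun_def plus_l2.abs_eq l2_eq_refl)
      then show "x + y \<in> ?S" using test_fun_add[OF u(1) v(1)] by blast
    qed
    fix H :: "'a l2" assume orth: "\<And>s. s \<in> ?S \<Longrightarrow> inner s H = 0"
    obtain h where h: "square_integrable h" "H = abs_l2 h" by (rule l2_representative)
    note [measurable] = square_integrable_measurable[OF h(1)]
    have zero: "Re (LINT x|lborel. u x * cnj (h x)) = 0" if "test_fun u" for u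
    proof -
      have "inner (abs_l2 u) H = 0" using that by (intro orth) blast
      then show ?thesis
        using that h by (simp add: inner_l2_def cinner_abs test_fun_def)
    qed
    have hbox: "integrable lborel (\<lambda>x. indicator (box p q) x * cmod (h x))" for p q
    proof -
      have "integrable lborel (\<lambda>x. complex_of_real (indicator (box p q) x) * cnj (h x))"
        by (intro square_integrable_mult_cnj square_integrable_indicator_box h)
      from integrable_norm[OF this] show ?thesis by (simp add: norm_mult)
    qed
    \<comment> \<open>Applied with \<open>w\<close> the real and the imaginary part of
      \<open>h\<close>. Dominated convergence replaces the cutoffs by the indicator of the
      box.\<close>
    have box: "AE x in lborel. w x = 0"
      if [measurable]: "w \<in> borel_measurable borel" and w_le: "\<And>x. \<bar>w x\<bar> \<le> cmod (h x)"
        and w: "\<And>p q k. (LINT x|lborel. cutoff p q k x * w x) = 0" for w :: "'a \<Rightarrow> real"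
    proof (rule AE_zero_of_box_integrals_zero)
      fix p q :: 'a
      show "set_integrable lborel (box p q) w"
        unfolding set_integrable_def
        by (rule Bochner_Integration.integrable_bound[OF hbox[of p q]])
          (measurable, simp add: indicator_def w_le)
      have "(\<lambda>k. LINT x|lborel. cutoff p q k x * w x) \<longlonglongrightarrow> (LINT x|lborel. indicator (box p q) x * w x)"
      proof (rule integral_dominated_convergence[where w = "\<lambda>x. indicator (box p q) x * cmod (h x)"])
        show "AE x in lborel. (\<lambda>k. cutoff p q k x * w x) \<longlonglongrightarrow> indicator (box p q) x * w x"
          by (intro AE_I2 tendsto_mult tendsto_const cutoff_tendsto)
        show "AE x in lborel. norm (cutoff p q k x * w x) \<le> indicator (box p q) x * cmod (h x)" for k
        proof (rule AE_I2)
          fix x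
          show "norm (cutoff p q k x * w x) \<le> indicator (box p q) x * cmod (h x)"
            using cutoff_bounds[of p q k x] w_le[of x] by (simp add: abs_mult) (intro mult_mono, auto)
        qed
        show "(\<lambda>x. indicator (box p q) x * w x) \<in> borel_measurable lborel"
          by (auto intro!: borel_measurable_times borel_measurable_indicator)
      qed (use hbox in measurable)
      then have "(LINT x|lborel. indicator (box p q) x * w x) = 0"
        unfolding w by (simp add: LIMSEQ_const_iff)
      then show "(LINT x:box p q|lborel. w x) = 0"
        by (simp add: set_lebesgue_integral_def)
    qed measurable
    have int: "integrable lborel (\<lambda>x. complex_of_real (cutoff p q k x) * cnj (h x))" for p q k
      using test_fun_cutoff[of p q k] by (intro square_integrable_mult_cnj h) (simp add: test_fun_def)
    have "AE x in lborel. Re (h x) = 0"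
    proof (rule box)
      fix p q :: 'a and k
      have "Re (LINT x|lborel. complex_of_real (cutoff p q k x) * cnj (h x)) = 0"
        by (rule zero[OF test_fun_cutoff])
      then show "(LINT x|lborel. cutoff p q k x * Re (h x)) = 0"
        using integral_Re[OF int[of p q k]] by simp
    qed (simp_all add: abs_Re_le_cmod)
    moreover have "AE x in lborel. Im (h x) = 0"
    proof (rule box)
      fix p q :: 'a and k
      \<comment> \<open>Orthogonality is given for the real inner product only; multiplying the test
        function by the imaginary unit extracts the imaginary part.\<close>
      have "Re (LINT x|lborel. \<i> * complex_of_real (cutoff p q k x) * cnj (h x)) = 0"
        by (rule zero[OF test_fun_mult[OF test_fun_cutoff]])
      then have "Im (LINT x|lborel. complex_of_real (cutoff p q k x) * cnj (h x)) = 0"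
        by (simp add: mult.assoc)
      then show "(LINT x|lborel. cutoff p q k x * Im (h x)) = 0"
        using integral_Im[OF int[of p q k]] by simp
    qed (simp_all add: abs_Im_le_cmod)
    ultimately have "AE x in lborel. h x = 0"
      by eventually_elim (simp add: complex_eq_iff)
    then show "H = 0"
      using h abs_l2_eq_iff[OF h(1) square_integrable_0] by (simp add: zero_l2_def)
  qed
  then have "abs_l2 f \<in> closure ?S" by simp
  then obtain s where s: "\<And>j. s j \<in> ?S" "s \<longlonglongrightarrow> abs_l2 f" by (auto simp: closure_sequential)
  then have "\<forall>j. \<exists>u. test_fun u \<and> s j = abs_l2 u" by blast
  from choice[OF this] obtain u where "\<forall>j. test_fun (u j) \<and> s j = abs_l2 (u j)" ..
  with s(2) show thesis by (intro that[of u]) (auto simp: LIMSEQ_def)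
qed

section \<open>The Bessel inequality for one wavelet\<close>

text \<open>For \<open>a = 0\<close> this is the zero function, since \<open>0 powr x = 0\<close>.\<close>

definition wav :: "('a::euclidean_space \<Rightarrow> complex) \<Rightarrow> real \<Rightarrow> 'a \<Rightarrow> 'a \<Rightarrow> complex" where
  "wav g a b t = complex_of_real (\<bar>a\<bar> powr (- real DIM('a) / 2)) * g ((t - b) /\<^sub>R a)"

definition coef :: "('a::euclidean_space \<Rightarrow> complex) \<Rightarrow> ('a \<Rightarrow> complex) \<Rightarrow> real \<Rightarrow> 'a \<Rightarrow> complex" where
  "coef f g a b = (LINT t|lborel. f t * cnj (wav g a b t))"

lemma wav_measurable [measurable]:
  assumes [measurable]: "g \<in> borel_measurable borel"
  shows "wav g a b \<in> borel_measurable borel"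
  unfolding wav_def[abs_def] by measurable

lemma square_integrable_wav:
  assumes g: "square_integrable g"
  shows "square_integrable (wav g a b)"
proof (cases "a = 0")
  case True
  then have "wav g a b = (\<lambda>t. 0)" by (simp add: wav_def fun_eq_iff)
  then show ?thesis by (simp add: square_integrable_0)
next
  case False
  then have "square_integrable (\<lambda>t. g (- (b /\<^sub>R a) + inverse a *\<^sub>R t))"
    by (intro square_integrable_affine g) simp
  also have "(\<lambda>t. g (- (b /\<^sub>R a) + inverse a *\<^sub>R t)) = (\<lambda>t. g ((t - b) /\<^sub>R a))"
    by (simp add: scaleR_diff_right)
  finally show ?thesis
    unfolding wav_def by (rule square_integrable_mult_const)
qed

lemma pi_aff_abs:
  assumes g: "square_integrable g"
  shows "pi_aff b a (abs_l2 g) = abs_l2 (wav g a b)"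
proof -
  have eq: "(\<lambda>t. complex_of_real (\<bar>a\<bar> powr (- real DIM('a) / 2)) * g (t /\<^sub>R a)) = wav g a 0"
    by (simp add: wav_def fun_eq_iff)
  have "dilate a (abs_l2 g) = abs_l2 (wav g a 0)"
    unfolding eq[symmetric] by (rule dilate.abs_eq[OF l2_eq_refl[OF g]])
  then have "pi_aff b a (abs_l2 g) = abs_l2 (\<lambda>t. wav g a 0 (t - b))"
    unfolding pi_aff_def by (simp add: translate.abs_eq[OF l2_eq_refl[OF square_integrable_wav[OF g]]])
  then show ?thesis by (simp add: wav_def[abs_def])
qed

lemma powr_half_square: "0 < x \<Longrightarrow> (x powr (- real n / 2))\<^sup>2 * x ^ n = 1"
  by (simp add: power2_eq_square powr_add[symmetric] powr_realpow[symmetric])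

lemma l2sq_wav:
  assumes [measurable]: "g \<in> borel_measurable borel" and a: "a \<noteq> 0"
  shows "l2sq (wav g a b) = l2sq g"
proof -
  have "l2sq (wav g a b) = ennreal (\<bar>a\<bar> ^ DIM('a)) * (\<integral>\<^sup>+t. ennreal ((cmod (wav g a b (b + a *\<^sub>R t)))\<^sup>2) \<partial>lborel)"
    unfolding l2sq_def by (rule nn_integral_lborel_affine) (measurable, use a in simp)
  also have "\<dots> = (\<integral>\<^sup>+t. ennreal (\<bar>a\<bar> ^ DIM('a)) * ennreal ((cmod (wav g a b (b + a *\<^sub>R t)))\<^sup>2) \<partial>lborel)"
    by (rule nn_integral_cmult[symmetric]) measurable
  also have "\<dots> = l2sq g"
    unfolding l2sq_def
  proof (rule nn_integral_cong)
    fix t :: 'a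
    have "\<bar>a\<bar> ^ DIM('a) * (cmod (wav g a b (b + a *\<^sub>R t)))\<^sup>2
        = ((\<bar>a\<bar> powr (- real DIM('a) / 2))\<^sup>2 * \<bar>a\<bar> ^ DIM('a)) * (cmod (g t))\<^sup>2"
      using a by (simp add: wav_def norm_mult power_mult_distrib)
    also have "\<dots> = (cmod (g t))\<^sup>2"
      using a by (subst powr_half_square) auto
    finally show "ennreal (\<bar>a\<bar> ^ DIM('a)) * ennreal ((cmod (wav g a b (b + a *\<^sub>R t)))\<^sup>2) = ennreal ((cmod (g t))\<^sup>2)"
      by (simp add: ennreal_mult[symmetric])
  qed
  finally show ?thesis .
qed

lemma norm_abs_l2sq: "square_integrable f \<Longrightarrow> ennreal ((norm (abs_l2 f))\<^sup>2) = l2sq f"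
  unfolding l2sq_def by (rule norm_abs_l2)

lemma norm_abs_wav:
  assumes g: "square_integrable g"
  shows "norm (abs_l2 (wav g a b)) \<le> norm (abs_l2 g)"
proof (cases "a = 0")
  case True
  then have "wav g a b = (\<lambda>t. 0)" by (simp add: wav_def fun_eq_iff)
  then show ?thesis by (simp add: zero_l2_def[symmetric])
next
  case False
  then have "ennreal ((norm (abs_l2 (wav g a b)))\<^sup>2) = ennreal ((norm (abs_l2 g))\<^sup>2)"
    using l2sq_wav[OF square_integrable_measurable[OF g] False]
    by (simp add: norm_abs_l2sq g square_integrable_wav)
  then show ?thesis by (simp add: ennreal_inj power2_eq_iff_nonneg)
qed

lemma coef_cinner:
  "square_integrable f \<Longrightarrow> square_integrable g \<Longrightarrow> coef f g a b = cinner (abs_l2 f) (abs_l2 (wav g a b))"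
  unfolding coef_def by (simp add: cinner_abs square_integrable_wav)

lemma coef_measurable [measurable]:
  assumes [measurable]: "f \<in> borel_measurable borel" "g \<in> borel_measurable borel"
  shows "(\<lambda>(a, b). coef f g a b) \<in> borel_measurable (lborel \<Otimes>\<^sub>M lborel)"
    and "coef f g a \<in> borel_measurable borel"
proof -
  have "(\<lambda>p. LINT t|lborel. f t * cnj (complex_of_real (\<bar>fst p\<bar> powr (- real DIM('a) / 2)) * g ((t - snd p) /\<^sub>R fst p)))
      \<in> borel_measurable (lborel \<Otimes>\<^sub>M lborel)"
    by measurable
  then show "(\<lambda>(a, b). coef f g a b) \<in> borel_measurable (lborel \<Otimes>\<^sub>M lborel)"
    by (simp add: coef_def wav_def case_prod_unfold)
  have "(\<lambda>b. LINT t|lborel. f t * cnj (complex_of_real (\<bar>a\<bar> powr (- real DIM('a) / 2)) * g ((t - b) /\<^sub>R a)))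
      \<in> borel_measurable borel"
    by measurable
  then show "coef f g a \<in> borel_measurable borel"
    by (simp add: coef_def[abs_def] wav_def)
qed

text \<open>Approximating the wavelet in \<open>L2\<close>, or by \<open>coef_diff_left\<close> the
  analysed function, makes the coefficients converge at every \<open>(a, b)\<close>; this is the
  input for the applications of Fatou's lemma below.\<close>

lemma coef_diff_right:
  assumes "square_integrable f" "square_integrable g" "square_integrable g'"
  shows "cmod (coef f g a b - coef f g' a b) \<le> norm (abs_l2 f) * norm (abs_l2 g - abs_l2 g')"
proof -
  have "wav (\<lambda>t. g t - g' t) a b = (\<lambda>t. wav g a b t - wav g' a b t)"
    by (simp add: wav_def fun_eq_iff right_diff_distrib)
  then have eq: "abs_l2 (wav g a b) - abs_l2 (wav g' a b) = abs_l2 (wav (\<lambda>t. g t - g' t) a b)"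
    using assms by (simp add: diff_abs_l2 square_integrable_wav)
  have "coef f g a b - coef f g' a b = cinner (abs_l2 f) (abs_l2 (wav (\<lambda>t. g t - g' t) a b))"
    using assms by (simp add: coef_cinner cinner_diff_right[symmetric] eq)
  also have "cmod \<dots> \<le> norm (abs_l2 f) * norm (abs_l2 (wav (\<lambda>t. g t - g' t) a b))"
    by (rule cinner_Cauchy_Schwarz)
  also have "\<dots> \<le> norm (abs_l2 f) * norm (abs_l2 (\<lambda>t. g t - g' t))"
    using assms by (intro mult_left_mono norm_abs_wav square_integrable_diff) auto
  finally show ?thesis using assms by (simp add: diff_abs_l2)
qed

lemma coef_diff_left:
  assumes "square_integrable f" "square_integrable f'" "square_integrable g"
  shows "cmod (coef f g a b - coef f' g a b) \<le> norm (abs_l2 f - abs_l2 f') * norm (abs_l2 g)"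
proof -
  have "coef f g a b - coef f' g a b = cinner (abs_l2 f - abs_l2 f') (abs_l2 (wav g a b))"
    using assms by (simp add: coef_cinner cinner_diff_left)
  also have "cmod \<dots> \<le> norm (abs_l2 f - abs_l2 f') * norm (abs_l2 (wav g a b))"
    by (rule cinner_Cauchy_Schwarz)
  also have "\<dots> \<le> norm (abs_l2 f - abs_l2 f') * norm (abs_l2 g)"
    using assms by (intro mult_left_mono norm_abs_wav) auto
  finally show ?thesis .
qed

lemma integrable_wav:
  assumes v: "integrable lborel v" and a: "a \<noteq> 0"
  shows "integrable lborel (wav v a b)"
proof -
  have "integrable lborel (\<lambda>t. v (- (b /\<^sub>R a) + inverse a *\<^sub>R t))"
    using a by (intro integrable_lborel_affine v) simp
  also have "(\<lambda>t. v (- (b /\<^sub>R a) + inverse a *\<^sub>R t)) = (\<lambda>t. v ((t - b) /\<^sub>R a))"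
    by (simp add: scaleR_diff_right)
  finally show ?thesis unfolding wav_def by simp
qed

lemma fourier_wav_square:
  fixes v :: "'a::euclidean_space \<Rightarrow> complex"
  assumes [measurable]: "v \<in> borel_measurable borel" and a: "a \<noteq> 0"
  shows "(cmod (fourier (wav v a 0) \<omega>))\<^sup>2 = \<bar>a\<bar> ^ DIM('a) * (cmod (fourier v (a *\<^sub>R \<omega>)))\<^sup>2"
proof -
  let ?c = "\<bar>a\<bar> powr (- real DIM('a) / 2)"
  have "fourier (wav v a 0) \<omega> = \<bar>a\<bar> ^ DIM('a) *\<^sub>R (LINT t|lborel. wav v a 0 (0 + a *\<^sub>R t) * cis (- (2 * pi * ((0 + a *\<^sub>R t) \<bullet> \<omega>))))"
    unfolding fourier_cis by (rule integral_lborel_affine) (measurable, use a in simp)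
  also have "\<dots> = \<bar>a\<bar> ^ DIM('a) *\<^sub>R (LINT t|lborel. complex_of_real ?c * (v t * cis (- (2 * pi * (t \<bullet> (a *\<^sub>R \<omega>))))))"
    using a by (simp add: wav_def mult.assoc)
  also have "\<dots> = complex_of_real (\<bar>a\<bar> ^ DIM('a) * ?c) * fourier v (a *\<^sub>R \<omega>)"
    unfolding fourier_cis by (subst integral_mult_right_zero) (simp add: scaleR_conv_of_real)
  finally have "(cmod (fourier (wav v a 0) \<omega>))\<^sup>2 = (\<bar>a\<bar> ^ DIM('a) * ?c)\<^sup>2 * (cmod (fourier v (a *\<^sub>R \<omega>)))\<^sup>2"
    by (simp only: norm_mult norm_of_real power_mult_distrib power2_abs)
  also have "(\<bar>a\<bar> ^ DIM('a) * ?c)\<^sup>2 = \<bar>a\<bar> ^ DIM('a) * (?c\<^sup>2 * \<bar>a\<bar> ^ DIM('a))"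
    by (simp add: power2_eq_square mult_ac)
  also have "?c\<^sup>2 * \<bar>a\<bar> ^ DIM('a) = 1" using a by (intro powr_half_square) simp
  finally show ?thesis by simp
qed

lemma coef_shift:
  assumes [measurable]: "f \<in> borel_measurable borel" "v \<in> borel_measurable borel"
  shows "coef f v a b = (LINT t|lborel. cnj (wav v a 0 t) * f (t + b))"
proof -
  have "coef f v a b = \<bar>1\<bar> ^ DIM('a) *\<^sub>R (LINT t|lborel. f (b + 1 *\<^sub>R t) * cnj (wav v a b (b + 1 *\<^sub>R t)))"
    unfolding coef_def by (rule integral_lborel_affine) simp_all
  then show ?thesis by (simp add: wav_def add.commute mult.commute)
qed

text \<open>As a function of \<open>b\<close> the coefficient is the correlation of \<open>f\<close>
  with the integrable function \<open>W\<close>. It is integrable, bounded and continuous, so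
  \<open>L2_le_fourier\<close> applies, and its transform factors into
  \<open>cnj (fourier W \<omega>) * fourier f \<omega>\<close>.\<close>

lemma coef_energy_integrable:
  fixes v :: "'a::euclidean_space \<Rightarrow> complex"
  assumes f: "test_fun f" and v: "integrable lborel v" and a: "a \<noteq> 0"
  shows "(\<integral>\<^sup>+b. ennreal ((cmod (coef f v a b))\<^sup>2) \<partial>lborel)
    \<le> (\<integral>\<^sup>+\<omega>. ennreal ((cmod (fourier f \<omega>))\<^sup>2 * \<bar>a\<bar> ^ DIM('a) * (cmod (fourier v (a *\<^sub>R \<omega>)))\<^sup>2) \<partial>lborel)"
proof -
  have fi: "integrable lborel f" and cont: "continuous_on UNIV f" using f by (simp_all add: test_fun_def)
  have [measurable]: "f \<in> borel_measurable borel" "v \<in> borel_measurable borel"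
    using borel_measurable_integrable[OF fi] borel_measurable_integrable[OF v] by simp_all
  obtain A where A: "\<And>t. cmod (f t) \<le> A" using f by (auto simp: test_fun_def)
  define W where "W = wav v a 0"
  have W: "integrable lborel W" unfolding W_def by (rule integrable_wav[OF v a])
  have [measurable]: "W \<in> borel_measurable borel" unfolding W_def by measurable
  have coef: "coef f v a = (\<lambda>b. LINT t|lborel. cnj (W t) * f (t + b))"
    unfolding W_def by (rule ext) (rule coef_shift; measurable)
  have WA: "integrable lborel (\<lambda>t. A * cmod (W t))" using W by simp
  have le: "cmod (cnj (W t) * f (t + b)) \<le> A * cmod (W t)" for t b
    using mult_right_mono[OF A[of "t + b"] norm_ge_zero[of "W t"]] by (simp add: norm_mult mult.commute)
  have f_shift: "integrable lborel (\<lambda>b. f (t + b))" "(LINT b|lborel. cmod (f (t + b))) = (LINT b|lborel. cmod (f b))" for t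
  proof -
    show "integrable lborel (\<lambda>b. f (t + b))" using integrable_lborel_affine[OF fi, of 1 t] by simp
    have "(\<lambda>b. cmod (f b)) \<in> borel_measurable borel" by measurable
    from integral_lborel_affine[OF this, of 1 t]
    show "(LINT b|lborel. cmod (f (t + b))) = (LINT b|lborel. cmod (f b))" by simp
  qed
  have pair: "integrable (lborel \<Otimes>\<^sub>M lborel) (\<lambda>(t, b). cnj (W t) * f (t + b))"
  proof (rule lborel_pair.Fubini_integrable)
    have "(\<lambda>t. LINT b|lborel. cmod (case (t, b) of (t, b) \<Rightarrow> cnj (W t) * f (t + b)))
        = (\<lambda>t. cmod (W t) * (LINT b|lborel. cmod (f b)))"
      by (simp add: norm_mult f_shift)
    then show "integrable lborel (\<lambda>t. LINT b|lborel. cmod (case (t, b) of (t, b) \<Rightarrow> cnj (W t) * f (t + b)))"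
      using W by simp
    show "AE t in lborel. integrable lborel (\<lambda>b. case (t, b) of (t, b) \<Rightarrow> cnj (W t) * f (t + b))"
      by (intro AE_I2) (simp add: f_shift)
  qed measurable
  have "(\<integral>\<^sup>+b. ennreal ((cmod (coef f v a b))\<^sup>2) \<partial>lborel) \<le> (\<integral>\<^sup>+\<omega>. ennreal ((cmod (fourier (coef f v a) \<omega>))\<^sup>2) \<partial>lborel)"
  proof (rule L2_le_fourier)
    show "integrable lborel (coef f v a)"
      unfolding coef using lborel_pair.integrable_snd[OF pair] by simp
    show "continuous_on UNIV (coef f v a)"
      unfolding continuous_on_sequentially coef comp_def
    proof (intro allI ballI impI)
      fix s b assume *: "(\<forall>n. s n \<in> UNIV) \<and> s \<longlonglongrightarrow> (b::'a)"
      show "(\<lambda>n. LINT t|lborel. cnj (W t) * f (t + s n)) \<longlonglongrightarrow> (LINT t|lborel. cnj (W t) * f (t + b))"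
      proof (rule integral_dominated_convergence[OF _ _ WA])
        show "AE t in lborel. (\<lambda>n. cnj (W t) * f (t + s n)) \<longlonglongrightarrow> cnj (W t) * f (t + b)"
        proof (rule AE_I2)
          fix t
          have "(\<lambda>n. t + s n) \<longlonglongrightarrow> t + b" using * by (intro tendsto_add tendsto_const) auto
          then have "(\<lambda>n. f (t + s n)) \<longlonglongrightarrow> f (t + b)"
            by (intro continuous_on_tendsto_compose[OF cont]) auto
          then show "(\<lambda>n. cnj (W t) * f (t + s n)) \<longlonglongrightarrow> cnj (W t) * f (t + b)"
            by (intro tendsto_mult tendsto_const)
        qed
        show "AE t in lborel. cmod (cnj (W t) * f (t + s n)) \<le> A * cmod (W t)" for n
          by (intro AE_I2 le)
      qed measurable
    qed
    show "cmod (coef f v a b) \<le> (LINT t|lborel. A * cmod (W t))" for b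
    proof -
      have "integrable lborel (\<lambda>t. cnj (W t) * f (t + b))"
        by (rule Bochner_Integration.integrable_bound[OF WA])
          (measurable, intro AE_I2 order_trans[OF le], simp)
      then have "(LINT t|lborel. cmod (cnj (W t) * f (t + b))) \<le> (LINT t|lborel. A * cmod (W t))"
        by (intro integral_mono integrable_norm WA le)
      then show ?thesis unfolding coef by (rule order_trans[OF integral_norm_bound])
    qed
  qed
  also have "\<dots> = (\<integral>\<^sup>+\<omega>. ennreal ((cmod (fourier f \<omega>))\<^sup>2 * \<bar>a\<bar> ^ DIM('a) * (cmod (fourier v (a *\<^sub>R \<omega>)))\<^sup>2) \<partial>lborel)"
  proof (rule nn_integral_cong)
    fix \<omega> :: 'a
    let ?e = "\<lambda>x. cis (- (2 * pi * (x \<bullet> \<omega>)))"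
    have pair': "integrable (lborel \<Otimes>\<^sub>M lborel) (\<lambda>(t, b). cnj (W t) * f (t + b) * ?e b)"
      by (rule Bochner_Integration.integrable_bound[OF pair]) (measurable, auto simp: norm_mult)
    have "fourier (coef f v a) \<omega> = (LINT b|lborel. LINT t|lborel. cnj (W t) * f (t + b) * ?e b)"
      unfolding fourier_cis coef by (simp only: integral_mult_left_zero)
    also have "\<dots> = (LINT t|lborel. LINT b|lborel. cnj (W t) * f (t + b) * ?e b)"
      by (rule lborel_pair.Fubini_integral[OF pair'])
    also have "\<dots> = (LINT t|lborel. cnj (W t * ?e t) * fourier f \<omega>)"
    proof (intro Bochner_Integration.integral_cong refl)
      fix t
      have "fourier f \<omega> = \<bar>1\<bar> ^ DIM('a) *\<^sub>R (LINT b|lborel. f (t + 1 *\<^sub>R b) * ?e (t + 1 *\<^sub>R b))"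
        unfolding fourier_cis by (rule integral_lborel_affine) simp_all
      also have "\<dots> = (LINT b|lborel. ?e t * (f (t + b) * ?e b))"
      proof -
        have "?e (t + b) = ?e t * ?e b" for b
          by (simp add: cis_mult inner_add_left distrib_left)
        then show ?thesis by (simp only: scaleR_one abs_one power_one mult_ac)
      qed
      also have "\<dots> = ?e t * (LINT b|lborel. f (t + b) * ?e b)"
        by (rule integral_mult_right_zero)
      finally have "cnj (W t * ?e t) * fourier f \<omega> = cnj (W t) * (cnj (?e t) * ?e t) * (LINT b|lborel. f (t + b) * ?e b)"
        by (simp add: mult_ac)
      also have "cnj (?e t) * ?e t = 1" by (simp add: cis_cnj cis_mult)
      finally show "(LINT b|lborel. cnj (W t) * f (t + b) * ?e b) = cnj (W t * ?e t) * fourier f \<omega>"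
        by (auto simp: mult.assoc)
    qed
    also have "\<dots> = (LINT t|lborel. cnj (W t * ?e t)) * fourier f \<omega>"
      by (rule integral_mult_left_zero)
    also have "(LINT t|lborel. cnj (W t * ?e t)) = cnj (fourier W \<omega>)"
      unfolding fourier_cis by (rule Bochner_Integration.integral_cnj)
    finally have "(cmod (fourier (coef f v a) \<omega>))\<^sup>2 = (cmod (fourier W \<omega>))\<^sup>2 * (cmod (fourier f \<omega>))\<^sup>2"
      by (simp add: norm_mult power_mult_distrib)
    also have "(cmod (fourier W \<omega>))\<^sup>2 = \<bar>a\<bar> ^ DIM('a) * (cmod (fourier v (a *\<^sub>R \<omega>)))\<^sup>2"
      unfolding W_def by (rule fourier_wav_square) (measurable, rule a)
    finally show "ennreal ((cmod (fourier (coef f v a) \<omega>))\<^sup>2)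
        = ennreal ((cmod (fourier f \<omega>))\<^sup>2 * \<bar>a\<bar> ^ DIM('a) * (cmod (fourier v (a *\<^sub>R \<omega>)))\<^sup>2)"
      by (simp add: mult_ac)
  qed
  finally show ?thesis .
qed

lemma liminf_square_coef:
  assumes "(\<lambda>n. c n) \<longlonglongrightarrow> (z :: complex)"
  shows "ennreal ((cmod z)\<^sup>2) = liminf (\<lambda>n. ennreal ((cmod (c n))\<^sup>2))"
proof -
  have "(\<lambda>n. ennreal ((cmod (c n))\<^sup>2)) \<longlonglongrightarrow> ennreal ((cmod z)\<^sup>2)"
    by (intro tendsto_ennrealI tendsto_power tendsto_norm assms)
  then show ?thesis by (rule lim_imp_Liminf[symmetric, OF trivial_limit_sequentially])
qed

lemma tendsto_of_norm_diff_le: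
  fixes c :: "nat \<Rightarrow> complex"
  assumes le: "\<And>n. cmod (c n - z) \<le> d n" and d: "d \<longlonglongrightarrow> 0"
  shows "c \<longlonglongrightarrow> z"
proof -
  have "(\<lambda>n. c n - z) \<longlonglongrightarrow> 0"
    by (rule tendsto_0_le[OF d, of _ 1]) (use le in \<open>auto intro!: always_eventually order_trans[OF _ abs_ge_self]\<close>)
  then show ?thesis by (rule LIM_zero_cancel)
qed

text \<open>Passes from the integrable approximants to \<open>g\<close>. The factor 2 comes from
  comparing \<open>|fourier (u n)|^2\<close> with \<open>|h|^2\<close> through the square of a sum;
  the error term is bounded by a multiple of the squared \<open>L2\<close> distance because
  \<open>fourier f\<close> is bounded.\<close>

lemma coef_energy_limit:
  fixes g h :: "'a::euclidean_space \<Rightarrow> complex"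
  assumes f: "test_fun f" and sq: "square_integrable g" "square_integrable h"
    and ft: "is_fourier_transform (abs_l2 g) (abs_l2 h)" and a: "a \<noteq> 0"
  shows "(\<integral>\<^sup>+b. ennreal ((cmod (coef f g a b))\<^sup>2) \<partial>lborel)
    \<le> 2 * (\<integral>\<^sup>+\<omega>. ennreal ((cmod (fourier f \<omega>))\<^sup>2 * \<bar>a\<bar> ^ DIM('a) * (cmod (h (a *\<^sub>R \<omega>)))\<^sup>2) \<partial>lborel)"
proof -
  have fi: "integrable lborel f" and fsq: "square_integrable f" using f by (simp_all add: test_fun_def)
  note [measurable] = sq[THEN square_integrable_measurable] square_integrable_measurable[OF fsq]
  obtain u where u: "\<And>n. integrable lborel (u n)" "\<And>n. square_integrable (u n)"
      "\<And>n. square_integrable (fourier (u n))"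
    and lim: "(\<lambda>n. abs_l2 (u n)) \<longlonglongrightarrow> abs_l2 g" "(\<lambda>n. abs_l2 (fourier (u n))) \<longlonglongrightarrow> abs_l2 h"
    using ft unfolding is_fourier_transform_def by blast
  have [measurable]: "u n \<in> borel_measurable borel" for n
    using u(2) by (rule square_integrable_measurable)
  define A where "A = (LINT t|lborel. cmod (f t))"
  have A: "0 \<le> A" "\<And>\<omega>. cmod (fourier f \<omega>) \<le> A"
    by (simp_all add: A_def fourier_bound)
  define E where "E n = l2sq (\<lambda>x. fourier (u n) x - h x)" for n
  have E: "E \<longlonglongrightarrow> 0"
    using lim(2) unfolding E_def l2sq_def by (subst (asm) abs_l2_tendsto_iff[OF u(3) sq(2)])
  define X where "X = (\<integral>\<^sup>+\<omega>. ennreal ((cmod (fourier f \<omega>))\<^sup>2 * \<bar>a\<bar> ^ DIM('a) * (cmod (h (a *\<^sub>R \<omega>)))\<^sup>2) \<partial>lborel)"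
  have step: "(\<integral>\<^sup>+b. ennreal ((cmod (coef f (u n) a b))\<^sup>2) \<partial>lborel) \<le> 2 * X + ennreal (2 * A\<^sup>2) * E n" for n
  proof -
    have "(\<integral>\<^sup>+b. ennreal ((cmod (coef f (u n) a b))\<^sup>2) \<partial>lborel)
        \<le> (\<integral>\<^sup>+\<omega>. ennreal ((cmod (fourier f \<omega>))\<^sup>2 * \<bar>a\<bar> ^ DIM('a) * (cmod (fourier (u n) (a *\<^sub>R \<omega>)))\<^sup>2) \<partial>lborel)"
      by (rule coef_energy_integrable[OF f u(1) a])
    also have "\<dots> \<le> (\<integral>\<^sup>+\<omega>. 2 * ennreal ((cmod (fourier f \<omega>))\<^sup>2 * \<bar>a\<bar> ^ DIM('a) * (cmod (h (a *\<^sub>R \<omega>)))\<^sup>2)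
        + ennreal (2 * A\<^sup>2) * (ennreal (\<bar>a\<bar> ^ DIM('a)) * ennreal ((cmod (fourier (u n) (a *\<^sub>R \<omega>) - h (a *\<^sub>R \<omega>)))\<^sup>2)) \<partial>lborel)"
    proof (rule nn_integral_mono)
      fix \<omega> :: 'a
      let ?F = "(cmod (fourier f \<omega>))\<^sup>2 * \<bar>a\<bar> ^ DIM('a)"
      let ?z = "fourier (u n) (a *\<^sub>R \<omega>)" and ?h = "h (a *\<^sub>R \<omega>)"
      have "(cmod ?z)\<^sup>2 \<le> 2 * (cmod (?z - ?h))\<^sup>2 + 2 * (cmod ?h)\<^sup>2"
        using cmod_diff_square_le[of ?z 0 ?h] by simp
      then have "?F * (cmod ?z)\<^sup>2 \<le> ?F * (2 * (cmod (?z - ?h))\<^sup>2 + 2 * (cmod ?h)\<^sup>2)"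
        by (rule mult_left_mono) simp
      also have "\<dots> = 2 * (?F * (cmod ?h)\<^sup>2) + ?F * (2 * (cmod (?z - ?h))\<^sup>2)"
        by (simp add: distrib_left)
      also have "?F * (2 * (cmod (?z - ?h))\<^sup>2) \<le> A\<^sup>2 * \<bar>a\<bar> ^ DIM('a) * (2 * (cmod (?z - ?h))\<^sup>2)"
        using A by (intro mult_right_mono power_mono) auto
      finally have "ennreal (?F * (cmod ?z)\<^sup>2)
          \<le> ennreal (2 * (?F * (cmod ?h)\<^sup>2) + 2 * A\<^sup>2 * (\<bar>a\<bar> ^ DIM('a) * (cmod (?z - ?h))\<^sup>2))"
        by (intro ennreal_leI) (simp add: mult_ac)
      also have "\<dots> = 2 * ennreal (?F * (cmod ?h)\<^sup>2)
          + ennreal (2 * A\<^sup>2) * (ennreal (\<bar>a\<bar> ^ DIM('a)) * ennreal ((cmod (?z - ?h))\<^sup>2))"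
        by (simp only: ennreal_plus ennreal_mult mult_nonneg_nonneg zero_le_power2 zero_le_power
            abs_ge_zero norm_ge_zero zero_le_numeral ennreal_numeral add_nonneg_nonneg)
      finally show "ennreal (?F * (cmod ?z)\<^sup>2) \<le> 2 * ennreal (?F * (cmod ?h)\<^sup>2)
          + ennreal (2 * A\<^sup>2) * (ennreal (\<bar>a\<bar> ^ DIM('a)) * ennreal ((cmod (?z - ?h))\<^sup>2))" .
    qed
    also have "\<dots> = 2 * X + ennreal (2 * A\<^sup>2) * (ennreal (\<bar>a\<bar> ^ DIM('a)) *
        (\<integral>\<^sup>+\<omega>. ennreal ((cmod (fourier (u n) (0 + a *\<^sub>R \<omega>) - h (0 + a *\<^sub>R \<omega>)))\<^sup>2) \<partial>lborel))"
      unfolding X_def by (subst nn_integral_add) (simp_all add: nn_integral_cmult)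
    also have "ennreal (\<bar>a\<bar> ^ DIM('a)) * (\<integral>\<^sup>+\<omega>. ennreal ((cmod (fourier (u n) (0 + a *\<^sub>R \<omega>) - h (0 + a *\<^sub>R \<omega>)))\<^sup>2) \<partial>lborel) = E n"
      unfolding E_def l2sq_def by (rule nn_integral_lborel_affine[symmetric]) (simp_all add: a)
    finally show ?thesis .
  qed
  have coef_lim: "(\<lambda>n. coef f (u n) a b) \<longlonglongrightarrow> coef f g a b" for b
  proof (rule tendsto_of_norm_diff_le)
    show "cmod (coef f (u n) a b - coef f g a b) \<le> norm (abs_l2 f) * norm (abs_l2 (u n) - abs_l2 g)" for n
      by (rule coef_diff_right[OF fsq u(2) sq(1)])
    have "(\<lambda>n. norm (abs_l2 (u n) - abs_l2 g)) \<longlonglongrightarrow> 0"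
      using lim(1) by (intro tendsto_norm_zero LIM_zero)
    from tendsto_mult_left[OF this, of "norm (abs_l2 f)"]
    show "(\<lambda>n. norm (abs_l2 f) * norm (abs_l2 (u n) - abs_l2 g)) \<longlonglongrightarrow> 0" by simp
  qed
  have "(\<integral>\<^sup>+b. ennreal ((cmod (coef f g a b))\<^sup>2) \<partial>lborel)
      = (\<integral>\<^sup>+b. liminf (\<lambda>n. ennreal ((cmod (coef f (u n) a b))\<^sup>2)) \<partial>lborel)"
    by (simp only: liminf_square_coef[OF coef_lim])
  also have "\<dots> \<le> liminf (\<lambda>n. \<integral>\<^sup>+b. ennreal ((cmod (coef f (u n) a b))\<^sup>2) \<partial>lborel)"
    by (rule nn_integral_liminf) measurable
  also have "\<dots> \<le> liminf (\<lambda>n. 2 * X + ennreal (2 * A\<^sup>2) * E n)"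
    by (rule Liminf_mono) (simp add: step)
  also have "\<dots> = 2 * X"
  proof -
    have "(\<lambda>n. 2 * X + ennreal (2 * A\<^sup>2) * E n) \<longlonglongrightarrow> 2 * X + ennreal (2 * A\<^sup>2) * 0"
      by (intro tendsto_add tendsto_const ennreal_tendsto_cmult E) simp
    then have "liminf (\<lambda>n. 2 * X + ennreal (2 * A\<^sup>2) * E n) = 2 * X + ennreal (2 * A\<^sup>2) * 0"
      by (rule lim_imp_Liminf[OF trivial_limit_sequentially])
    then show ?thesis by simp
  qed
  finally show ?thesis unfolding X_def .
qed

section \<open>The Bessel inequality over all dilations\<close>

lemma fourier_continuous:
  assumes f: "integrable lborel f"
  shows "continuous_on UNIV (fourier f)"
  unfolding continuous_on_sequentially comp_def fourier_cis
proof (intro allI ballI impI)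
  fix s w assume *: "(\<forall>n. s n \<in> UNIV) \<and> s \<longlonglongrightarrow> (w::'a)"
  have [measurable]: "f \<in> borel_measurable borel"
    using borel_measurable_integrable[OF f] by simp
  show "(\<lambda>n. LINT t|lborel. f t * cis (- (2 * pi * (t \<bullet> s n)))) \<longlonglongrightarrow> (LINT t|lborel. f t * cis (- (2 * pi * (t \<bullet> w))))"
  proof (rule integral_dominated_convergence[where w = "\<lambda>t. cmod (f t)"])
    show "AE t in lborel. (\<lambda>n. f t * cis (- (2 * pi * (t \<bullet> s n)))) \<longlonglongrightarrow> f t * cis (- (2 * pi * (t \<bullet> w)))"
    proof (rule AE_I2)
      fix t
      have "(\<lambda>n. - (2 * pi * (t \<bullet> s n))) \<longlonglongrightarrow> - (2 * pi * (t \<bullet> w))"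
        using * by (intro tendsto_minus tendsto_mult tendsto_const tendsto_inner) auto
      then have "(\<lambda>n. cis (- (2 * pi * (t \<bullet> s n)))) \<longlonglongrightarrow> cis (- (2 * pi * (t \<bullet> w)))"
        by (rule continuous_on_tendsto_compose[OF continuous_on_cis[OF continuous_on_id, of UNIV]]) auto
      then show "(\<lambda>n. f t * cis (- (2 * pi * (t \<bullet> s n)))) \<longlonglongrightarrow> f t * cis (- (2 * pi * (t \<bullet> w)))"
        by (intro tendsto_mult tendsto_const)
    qed
    show "integrable lborel (\<lambda>t. cmod (f t))" using f by (rule integrable_norm)
    show "AE t in lborel. cmod (f t * cis (- (2 * pi * (t \<bullet> s n)))) \<le> cmod (f t)" for n
      by (simp add: norm_mult)
  qed measurable
qed

definition Bessel_bound :: "('a::euclidean_space \<Rightarrow> complex) \<Rightarrow> real \<Rightarrow> bool" where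
  "Bessel_bound g C \<longleftrightarrow> (\<forall>f. square_integrable f \<longrightarrow>
    (\<integral>\<^sup>+a. \<integral>\<^sup>+b. ennreal (1 / \<bar>a\<bar> ^ (DIM('a) + 1)) * ennreal ((cmod (coef f g a b))\<^sup>2) \<partial>lborel \<partial>lborel)
      \<le> ennreal C * l2sq f)"

text \<open>After the integrals are exchanged, the dilation average multiplies the continuous weight
  \<open>|fourier f|^2\<close>, as \<open>averaging_bound\<close> requires, and
  \<open>fourier_L2_le\<close> leads back to \<open>f\<close>. The constant \<open>2 * C\<close>
  inherits its 2 from \<open>coef_energy_limit\<close>.\<close>

lemma Bessel_bound_nice:
  fixes g h :: "real ^ 'n \<Rightarrow> complex"
  assumes sq: "square_integrable g" "square_integrable h"
    and ft: "is_fourier_transform (abs_l2 g) (abs_l2 h)"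
    and G: "rotation_dilation_invariant (\<lambda>\<omega>. \<integral>\<^sup>+a. ennreal ((cmod (h (a *\<^sub>R \<omega>)))\<^sup>2 / \<bar>a\<bar>) \<partial>lborel)"
  shows "\<exists>C. \<forall>f. test_fun f \<longrightarrow>
    (\<integral>\<^sup>+a. \<integral>\<^sup>+b. ennreal (1 / \<bar>a\<bar> ^ (DIM(real ^ 'n) + 1)) * ennreal ((cmod (coef f g a b))\<^sup>2) \<partial>lborel \<partial>lborel)
      \<le> ennreal C * l2sq f"
proof -
  note [measurable] = sq[THEN square_integrable_measurable]
  let ?G = "\<lambda>\<omega>. \<integral>\<^sup>+a. ennreal ((cmod (h (a *\<^sub>R \<omega>)))\<^sup>2 / \<bar>a\<bar>) \<partial>lborel"
  obtain C where C: "\<And>\<phi>. continuous_on UNIV \<phi> \<Longrightarrow> (\<And>y. 0 \<le> \<phi> y) \<Longrightarrow>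
      (\<integral>\<^sup>+x. ?G x * ennreal (\<phi> x) \<partial>lborel) \<le> ennreal C * (\<integral>\<^sup>+x. ennreal (\<phi> x) \<partial>lborel)"
    using rotation_dilation_invariant.averaging_bound[OF G] by blast
  have "(\<integral>\<^sup>+a. \<integral>\<^sup>+b. ennreal (1 / \<bar>a\<bar> ^ (DIM(real ^ 'n) + 1)) * ennreal ((cmod (coef f g a b))\<^sup>2) \<partial>lborel \<partial>lborel)
      \<le> ennreal (2 * C) * l2sq f" if f: "test_fun f" for f
  proof -
    have fi: "integrable lborel f" and fsq: "square_integrable f" using f by (simp_all add: test_fun_def)
    note [measurable] = square_integrable_measurable[OF fsq]
    let ?\<phi> = "\<lambda>\<omega>. (cmod (fourier f \<omega>))\<^sup>2"
    let ?H = "\<lambda>\<omega> a. ennreal ((cmod (h (a *\<^sub>R \<omega>)))\<^sup>2 / \<bar>a\<bar>)"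
    have "(\<integral>\<^sup>+a. \<integral>\<^sup>+b. ennreal (1 / \<bar>a\<bar> ^ (DIM(real ^ 'n) + 1)) * ennreal ((cmod (coef f g a b))\<^sup>2) \<partial>lborel \<partial>lborel)
        \<le> (\<integral>\<^sup>+a. \<integral>\<^sup>+\<omega>. 2 * (ennreal (?\<phi> \<omega>) * ?H \<omega> a) \<partial>lborel \<partial>lborel)"
    proof (rule nn_integral_mono)
      fix a :: real
      show "(\<integral>\<^sup>+b. ennreal (1 / \<bar>a\<bar> ^ (DIM(real ^ 'n) + 1)) * ennreal ((cmod (coef f g a b))\<^sup>2) \<partial>lborel)
          \<le> (\<integral>\<^sup>+\<omega>. 2 * (ennreal (?\<phi> \<omega>) * ?H \<omega> a) \<partial>lborel)"
      proof (cases "a = 0")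
        case False
        let ?w = "ennreal (1 / \<bar>a\<bar> ^ (DIM(real ^ 'n) + 1))"
        let ?K = "\<lambda>\<omega>. ennreal (?\<phi> \<omega> * \<bar>a\<bar> ^ DIM(real ^ 'n) * (cmod (h (a *\<^sub>R \<omega>)))\<^sup>2)"
        have "(\<integral>\<^sup>+b. ?w * ennreal ((cmod (coef f g a b))\<^sup>2) \<partial>lborel)
            = ?w * (\<integral>\<^sup>+b. ennreal ((cmod (coef f g a b))\<^sup>2) \<partial>lborel)"
          by (rule nn_integral_cmult) measurable
        also have "\<dots> \<le> ?w * (2 * (\<integral>\<^sup>+\<omega>. ?K \<omega> \<partial>lborel))"
          by (rule mult_left_mono[OF coef_energy_limit[OF f sq ft False]]) simp
        also have "\<dots> = (\<integral>\<^sup>+\<omega>. 2 * (?w * ?K \<omega>) \<partial>lborel)"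
          by (simp add: nn_integral_cmult mult.left_commute)
        also have "\<dots> = (\<integral>\<^sup>+\<omega>. 2 * (ennreal (?\<phi> \<omega>) * ?H \<omega> a) \<partial>lborel)"
        proof (intro nn_integral_cong arg_cong[where f = "\<lambda>x. 2 * x"])
          fix \<omega> :: "real ^ 'n"
          have "1 / \<bar>a\<bar> ^ (DIM(real ^ 'n) + 1) * (?\<phi> \<omega> * \<bar>a\<bar> ^ DIM(real ^ 'n) * (cmod (h (a *\<^sub>R \<omega>)))\<^sup>2)
              = ?\<phi> \<omega> * ((cmod (h (a *\<^sub>R \<omega>)))\<^sup>2 / \<bar>a\<bar>)"
            using False by simp
          then show "?w * ?K \<omega> = ennreal (?\<phi> \<omega>) * ?H \<omega> a"
            by (simp add: ennreal_mult[symmetric] del: power_Suc)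
        qed
        finally show ?thesis .
      qed simp
    qed
    also have "\<dots> = (\<integral>\<^sup>+\<omega>. \<integral>\<^sup>+a. 2 * (ennreal (?\<phi> \<omega>) * ?H \<omega> a) \<partial>lborel \<partial>lborel)"
      by (rule lborel_pair.Fubini') measurable
    also have "\<dots> = (\<integral>\<^sup>+\<omega>. 2 * (?G \<omega> * ennreal (?\<phi> \<omega>)) \<partial>lborel)"
      by (simp add: nn_integral_cmult mult.commute)
    also have "\<dots> = 2 * (\<integral>\<^sup>+\<omega>. ?G \<omega> * ennreal (?\<phi> \<omega>) \<partial>lborel)"
      by (rule nn_integral_cmult) measurable
    also have "\<dots> \<le> 2 * (ennreal C * l2sq (fourier f))"
      unfolding l2sq_def
      by (intro mult_left_mono C continuous_on_power continuous_on_norm fourier_continuous fi) simp_all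
    also have "\<dots> \<le> 2 * (ennreal C * l2sq f)"
      unfolding l2sq_def by (intro mult_left_mono fourier_L2_le fi) simp_all
    also have "\<dots> = ennreal (2 * C) * l2sq f"
      by (simp add: ennreal_mult' mult.assoc)
    finally show ?thesis .
  qed
  then show ?thesis by blast
qed

text \<open>Fatou's lemma on the space of all \<open>(a, b)\<close>: the coefficients of
  approximating test functions converge pointwise and their norms converge, so the constant is
  preserved.\<close>

lemma Bessel_bound_extend:
  fixes g :: "'a::euclidean_space \<Rightarrow> complex"
  assumes g: "square_integrable g"
    and test_fun: "\<And>f. test_fun f \<Longrightarrow>
      (\<integral>\<^sup>+a. \<integral>\<^sup>+b. ennreal (1 / \<bar>a\<bar> ^ (DIM('a) + 1)) * ennreal ((cmod (coef f g a b))\<^sup>2) \<partial>lborel \<partial>lborel)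
        \<le> ennreal C * l2sq f"
  shows "Bessel_bound g C"
  unfolding Bessel_bound_def
proof (intro allI impI)
  fix f :: "'a \<Rightarrow> complex" assume f: "square_integrable f"
  note [measurable] = square_integrable_measurable[OF f] square_integrable_measurable[OF g]
  obtain u where u: "\<And>j. test_fun (u j)" "(\<lambda>j. abs_l2 (u j)) \<longlonglongrightarrow> abs_l2 f" using test_fun_dense[OF f] by blast
  have usq: "square_integrable (u j)" for j using u(1)[of j] by (simp add: test_fun_def)
  have [measurable]: "u j \<in> borel_measurable borel" for j by (rule square_integrable_measurable[OF usq])
  let ?P = "(lborel :: real measure) \<Otimes>\<^sub>M (lborel :: 'a measure)"
  let ?q = "\<lambda>f (a, b). ennreal (1 / \<bar>a\<bar> ^ (DIM('a) + 1)) * ennreal ((cmod (coef f g a b))\<^sup>2)"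
  have q_meas: "?q v \<in> borel_measurable ?P" if [measurable]: "v \<in> borel_measurable borel" for v
  proof -
    have [measurable]: "(\<lambda>(a, b). coef v g a b) \<in> borel_measurable ?P" by (rule coef_measurable) measurable
    have "(\<lambda>p. ennreal (1 / \<bar>fst p\<bar> ^ (DIM('a) + 1)) * ennreal ((cmod ((\<lambda>(a, b). coef v g a b) p))\<^sup>2)) \<in> borel_measurable ?P"
      by measurable
    then show ?thesis by (simp add: case_prod_unfold)
  qed
  have Q: "(\<integral>\<^sup>+a. \<integral>\<^sup>+b. ennreal (1 / \<bar>a\<bar> ^ (DIM('a) + 1)) * ennreal ((cmod (coef v g a b))\<^sup>2) \<partial>lborel \<partial>lborel)
      = (\<integral>\<^sup>+p. ?q v p \<partial>?P)" if "v \<in> borel_measurable borel" for v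
    using lborel.nn_integral_fst[OF q_meas[OF that]] by simp
  have coef_lim: "(\<lambda>j. coef (u j) g a b) \<longlonglongrightarrow> coef f g a b" for a b
  proof (rule tendsto_of_norm_diff_le)
    show "cmod (coef (u j) g a b - coef f g a b) \<le> norm (abs_l2 (u j) - abs_l2 f) * norm (abs_l2 g)" for j
      by (rule coef_diff_left[OF usq f g])
    have "(\<lambda>n. norm (abs_l2 (u n) - abs_l2 f)) \<longlonglongrightarrow> 0"
      using u(2) by (intro tendsto_norm_zero LIM_zero)
    from tendsto_mult_right[OF this, of "norm (abs_l2 g)"]
    show "(\<lambda>n. norm (abs_l2 (u n) - abs_l2 f) * norm (abs_l2 g)) \<longlonglongrightarrow> 0" by simp
  qed
  have "(\<integral>\<^sup>+p. ?q f p \<partial>?P) = (\<integral>\<^sup>+p. liminf (\<lambda>j. ?q (u j) p) \<partial>?P)"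
  proof (rule nn_integral_cong)
    fix p :: "real \<times> 'a"
    have "(\<lambda>j. ennreal ((cmod (coef (u j) g (fst p) (snd p)))\<^sup>2)) \<longlonglongrightarrow> ennreal ((cmod (coef f g (fst p) (snd p)))\<^sup>2)"
      by (intro tendsto_ennrealI tendsto_power tendsto_norm coef_lim)
    then have "(\<lambda>j. ?q (u j) p) \<longlonglongrightarrow> ?q f p"
      unfolding case_prod_unfold by (intro ennreal_tendsto_cmult) simp_all
    then show "?q f p = liminf (\<lambda>j. ?q (u j) p)"
      by (rule lim_imp_Liminf[symmetric, OF trivial_limit_sequentially])
  qed
  also have "\<dots> \<le> liminf (\<lambda>j. \<integral>\<^sup>+p. ?q (u j) p \<partial>?P)"
    by (intro nn_integral_liminf q_meas) measurable
  also have "\<dots> \<le> liminf (\<lambda>j. ennreal C * ennreal ((norm (abs_l2 (u j)))\<^sup>2))"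
  proof (rule Liminf_mono, rule always_eventually, rule allI)
    fix j
    show "(\<integral>\<^sup>+p. ?q (u j) p \<partial>?P) \<le> ennreal C * ennreal ((norm (abs_l2 (u j)))\<^sup>2)"
      using test_fun[OF u(1)[of j]] Q[of "u j"] by (simp add: norm_abs_l2sq[OF usq])
  qed
  also have "\<dots> = ennreal C * ennreal ((norm (abs_l2 f))\<^sup>2)"
  proof -
    have "(\<lambda>j. ennreal C * ennreal ((norm (abs_l2 (u j)))\<^sup>2)) \<longlonglongrightarrow> ennreal C * ennreal ((norm (abs_l2 f))\<^sup>2)"
      by (intro ennreal_tendsto_cmult tendsto_ennrealI tendsto_power tendsto_norm u(2)) simp
    then show ?thesis by (rule lim_imp_Liminf[OF trivial_limit_sequentially])
  qed
  finally show "(\<integral>\<^sup>+a. \<integral>\<^sup>+b. ennreal (1 / \<bar>a\<bar> ^ (DIM('a) + 1)) * ennreal ((cmod (coef f g a b))\<^sup>2) \<partial>lborel \<partial>lborel)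
      \<le> ennreal C * l2sq f"
    using Q[of f] by (simp add: norm_abs_l2sq[OF f])
qed

lemma admissible_wavelet_Bessel_bound:
  fixes g :: "real ^ 'n \<Rightarrow> complex"
  assumes g: "square_integrable g" and adm: "admissible_wavelet (abs_l2 g)"
  shows "\<exists>C. Bessel_bound g C"
proof -
  obtain H where H: "is_fourier_transform (abs_l2 g) H" "admissibility_integral H < \<infinity>"
    using adm by (auto simp: admissible_wavelet_def)
  obtain h where h: "square_integrable h" "H = abs_l2 h" by (rule l2_representative)
  note [measurable] = square_integrable_measurable[OF g] square_integrable_measurable[OF h(1)]
  have inv: "AE t in lborel. g (R *v t) = g t" if "rotation_matrix R" for R :: "real ^ 'n ^ 'n"
    using adm that by (simp add: admissible_wavelet_def rotation_invariant.abs_eq[OF l2_eq_refl[OF g]])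
  have "rotation_dilation_invariant (\<lambda>\<omega>. \<integral>\<^sup>+a. ennreal ((cmod (h (a *\<^sub>R \<omega>)))\<^sup>2 / \<bar>a\<bar>) \<partial>lborel)"
  proof (rule dilation_average_invariant)
    show "AE \<omega> in lborel. h (R *v \<omega>) = h \<omega>" if R: "rotation_matrix R" for R :: "real ^ 'n ^ 'n"
      using R H(1) unfolding h(2)
      by (intro fourier_transform_rotation_invariant[OF _ g h(1) _ inv[OF R]]) (simp_all add: rotation_matrix_def)
    show "(\<integral>\<^sup>+\<omega>. ennreal ((cmod (h \<omega>))\<^sup>2 / norm \<omega> ^ CARD('n)) \<partial>lborel) < \<infinity>"
      using H(2) unfolding h(2) admissibility_integral.abs_eq[OF l2_eq_refl[OF h(1)]] by simp
  qed measurable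
  from Bessel_bound_nice[OF g h(1) H(1)[unfolded h(2)] this]
  show ?thesis using Bessel_bound_extend[OF g] by blast
qed

section \<open>Tensor products of wavelets\<close>

lemma nn_integral_lborel_pair:
  fixes f :: "'a::euclidean_space \<times> 'b::euclidean_space \<Rightarrow> ennreal"
  assumes [measurable]: "f \<in> borel_measurable borel"
  shows "(\<integral>\<^sup>+z. f z \<partial>lborel) = (\<integral>\<^sup>+x. \<integral>\<^sup>+y. f (x, y) \<partial>lborel \<partial>lborel)"
proof -
  have "f \<in> borel_measurable (lborel \<Otimes>\<^sub>M lborel)" unfolding lborel_prod by simp
  from lborel.nn_integral_fst[OF this] show ?thesis by (simp add: lborel_prod)
qed

lemma integral_lborel_pair:
  fixes f :: "'a::euclidean_space \<times> 'b::euclidean_space \<Rightarrow> complex"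
  assumes "integrable lborel f"
  shows "(LINT z|lborel. f z) = (LINT y|lborel. LINT x|lborel. f (x, y))"
proof -
  have "integrable (lborel \<Otimes>\<^sub>M lborel) (case_prod (\<lambda>x y. f (x, y)))"
    using assms by (simp add: lborel_prod)
  from lborel_pair.integral_snd[OF this] show ?thesis by (simp add: lborel_prod)
qed

text \<open>The restriction in \<open>aff_measure\<close> disappears because the weight vanishes where some dilation
  parameter is \<open>0\<close>, by \<open>1 / 0 = 0\<close>.\<close>

lemma nn_integral_aff_measure:
  fixes f :: "('a::euclidean_space \<times> 'b::euclidean_space) \<times> (real \<times> real) \<Rightarrow> ennreal"
  assumes [measurable]: "f \<in> borel_measurable borel"
  shows "(\<integral>\<^sup>+x. f x \<partial>aff_measure) =
    (\<integral>\<^sup>+x. ennreal (1 / \<bar>fst (snd x)\<bar> ^ (DIM('a) + 1) * (1 / \<bar>snd (snd x)\<bar> ^ (DIM('b) + 1))) * f x \<partial>lborel)"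
proof -
  let ?X = "UNIV \<times> ((- {0}) \<times> (- {0})) :: (('a \<times> 'b) \<times> (real \<times> real)) set"
  let ?w = "\<lambda>x :: ('a \<times> 'b) \<times> (real \<times> real). ennreal (1 / \<bar>fst (snd x)\<bar> ^ (DIM('a) + 1) * (1 / \<bar>snd (snd x)\<bar> ^ (DIM('b) + 1)))"
  have X: "?X \<in> sets borel"
    by (intro borel_open open_Times open_UNIV open_Compl closed_singleton)
  have w\<^sub>1: "(\<lambda>x :: ('a \<times> 'b) \<times> (real \<times> real). 1 / \<bar>fst (snd x)\<bar> ^ (DIM('a) + 1)) \<in> borel_measurable borel"
    by (rule measurable_compose[where f = "\<lambda>x. fst (snd x)" and N = borel])
      (intro borel_measurable_continuous_onI continuous_intros, measurable)
  have w\<^sub>2: "(\<lambda>x :: ('a \<times> 'b) \<times> (real \<times> real). 1 / \<bar>snd (snd x)\<bar> ^ (DIM('b) + 1)) \<in> borel_measurable borel"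
    by (rule measurable_compose[where f = "\<lambda>x. snd (snd x)" and N = borel])
      (intro borel_measurable_continuous_onI continuous_intros, measurable)
  have w: "?w \<in> borel_measurable lborel"
    unfolding measurable_lborel2
    by (rule measurable_compose[OF borel_measurable_times[OF w\<^sub>1 w\<^sub>2] measurable_ennreal])
  have f: "f \<in> borel_measurable lborel"
    unfolding measurable_lborel2 by (rule assms)
  have "(\<integral>\<^sup>+x. f x \<partial>aff_measure) = (\<integral>\<^sup>+x. ?w x * f x \<partial>restrict_space lborel ?X)"
    unfolding aff_measure_def case_prod_unfold
    by (rule nn_integral_density[OF measurable_restrict_space1[OF w] measurable_restrict_space1[OF f]])
  also have "\<dots> = (\<integral>\<^sup>+x. ?w x * f x * indicator ?X x \<partial>lborel)"
    using X by (intro nn_integral_restrict_space) simp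
  also have "\<dots> = (\<integral>\<^sup>+x. ?w x * f x \<partial>lborel)"
    by (intro nn_integral_cong) (auto simp: indicator_def)
  finally show ?thesis .
qed

lemma borel_measurable_aff_measure:
  "f \<in> borel_measurable borel \<Longrightarrow> f \<in> borel_measurable aff_measure"
  unfolding aff_measure_def by (simp add: measurable_restrict_space1)

lemma square_integrable_section:
  fixes F :: "'a::euclidean_space \<times> 'b::euclidean_space \<Rightarrow> complex"
  assumes F: "square_integrable F"
  shows "(\<integral>\<^sup>+y. l2sq (\<lambda>s. F (s, y)) \<partial>lborel) = l2sq F"
    and "AE y in lborel. square_integrable (\<lambda>s. F (s, y))"
proof -
  have Fm: "F \<in> borel_measurable borel" by (rule square_integrable_measurable[OF F])
  then have [measurable]: "F \<in> borel_measurable (lborel \<Otimes>\<^sub>M lborel)" unfolding lborel_prod by simp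
  have "l2sq F = (\<integral>\<^sup>+x. \<integral>\<^sup>+y. ennreal ((cmod (F (x, y)))\<^sup>2) \<partial>lborel \<partial>lborel)"
    unfolding l2sq_def by (intro nn_integral_lborel_pair measurable_compose[OF Fm]) measurable
  also have "\<dots> = (\<integral>\<^sup>+y. \<integral>\<^sup>+x. ennreal ((cmod (F (x, y)))\<^sup>2) \<partial>lborel \<partial>lborel)"
    by (rule lborel_pair.Fubini'[symmetric]) measurable
  finally show eq: "(\<integral>\<^sup>+y. l2sq (\<lambda>s. F (s, y)) \<partial>lborel) = l2sq F" by (simp add: l2sq_def)
  have "l2sq F < \<infinity>"
    using F by (simp add: square_integrable_iff_nn_integral l2sq_def)
  then have "AE y in lborel. l2sq (\<lambda>s. F (s, y)) \<noteq> \<infinity>"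
    unfolding eq[symmetric] by (intro nn_integral_PInf_AE) (simp_all add: l2sq_def less_top)
  then show "AE y in lborel. square_integrable (\<lambda>s. F (s, y))"
  proof eventually_elim
    fix y assume "l2sq (\<lambda>s. F (s, y)) \<noteq> \<infinity>"
    moreover have "(\<lambda>s. F (s, y)) \<in> borel_measurable lborel" by measurable
    ultimately show "square_integrable (\<lambda>s. F (s, y))"
      by (simp add: square_integrable_iff_nn_integral l2sq_def less_top)
  qed
qed

section \<open>Iterated wavelet coefficients on a product space\<close>

context
  fixes F :: "'a::euclidean_space \<times> 'b::euclidean_space \<Rightarrow> complex"
    and g\<^sub>1 :: "'a \<Rightarrow> complex" and g\<^sub>2 :: "'b \<Rightarrow> complex"
  assumes F: "square_integrable F" and g\<^sub>1: "square_integrable g\<^sub>1" and g\<^sub>2: "square_integrable g\<^sub>2"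
begin

definition partial_coef :: "real \<Rightarrow> 'a \<Rightarrow> 'b \<Rightarrow> complex" where
  "partial_coef a b y = coef (\<lambda>s. F (s, y)) g\<^sub>1 a b"

definition tensor_coef :: "real \<Rightarrow> 'a \<Rightarrow> real \<Rightarrow> 'b \<Rightarrow> complex" where
  "tensor_coef a\<^sub>1 b\<^sub>1 a\<^sub>2 b\<^sub>2 = (LINT z|lborel. F z * cnj (wav g\<^sub>1 a\<^sub>1 b\<^sub>1 (fst z) * wav g\<^sub>2 a\<^sub>2 b\<^sub>2 (snd z)))"

lemma F_measurable [measurable]: "F \<in> borel_measurable (borel \<Otimes>\<^sub>M borel)"
  unfolding borel_prod by (rule square_integrable_measurable[OF F])

lemma g_measurable [measurable]: "g\<^sub>1 \<in> borel_measurable borel" "g\<^sub>2 \<in> borel_measurable borel"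
  by (rule square_integrable_measurable[OF g\<^sub>1], rule square_integrable_measurable[OF g\<^sub>2])

lemma partial_coef_measurable [measurable (raw)]:
  assumes [measurable]: "f\<^sub>1 \<in> borel_measurable M" "f\<^sub>2 \<in> borel_measurable M" "f\<^sub>3 \<in> borel_measurable M"
  shows "(\<lambda>x. partial_coef (f\<^sub>1 x) (f\<^sub>2 x) (f\<^sub>3 x)) \<in> borel_measurable M"
  unfolding partial_coef_def coef_def wav_def by measurable

lemma tensor_coef_measurable [measurable (raw)]:
  assumes [measurable]: "f\<^sub>1 \<in> borel_measurable M" "f\<^sub>2 \<in> borel_measurable M"
    "f\<^sub>3 \<in> borel_measurable M" "f\<^sub>4 \<in> borel_measurable M"
  shows "(\<lambda>x. tensor_coef (f\<^sub>1 x) (f\<^sub>2 x) (f\<^sub>3 x) (f\<^sub>4 x)) \<in> borel_measurable M"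
  unfolding tensor_coef_def wav_def lborel_prod[symmetric] by measurable

text \<open>The second wavelet analyses this function, so it must belong to \<open>L2\<close>.
  Cauchy-Schwarz in the first variable bounds its value at \<open>y\<close> by the norm of the
  section of \<open>F\<close> at \<open>y\<close>.\<close>

lemma partial_coef_square_integrable: "square_integrable (partial_coef a b)"
proof -
  have "(\<integral>\<^sup>+y. ennreal ((cmod (partial_coef a b y))\<^sup>2) \<partial>lborel)
      \<le> (\<integral>\<^sup>+y. ennreal ((norm (abs_l2 g\<^sub>1))\<^sup>2) * l2sq (\<lambda>s. F (s, y)) \<partial>lborel)"
  proof (rule nn_integral_mono_AE)
    show "AE y in lborel. ennreal ((cmod (partial_coef a b y))\<^sup>2) \<le> ennreal ((norm (abs_l2 g\<^sub>1))\<^sup>2) * l2sq (\<lambda>s. F (s, y))"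
      using square_integrable_section(2)[OF F]
    proof eventually_elim
      fix y assume y: "square_integrable (\<lambda>s. F (s, y))"
      have "cmod (partial_coef a b y) \<le> norm (abs_l2 (\<lambda>s. F (s, y))) * norm (abs_l2 (wav g\<^sub>1 a b))"
        unfolding partial_coef_def coef_cinner[OF y g\<^sub>1] by (rule cinner_Cauchy_Schwarz)
      also have "\<dots> \<le> norm (abs_l2 (\<lambda>s. F (s, y))) * norm (abs_l2 g\<^sub>1)"
        by (intro mult_left_mono norm_abs_wav g\<^sub>1) simp
      finally have "(cmod (partial_coef a b y))\<^sup>2 \<le> (norm (abs_l2 (\<lambda>s. F (s, y))) * norm (abs_l2 g\<^sub>1))\<^sup>2"
        by (rule power_mono) simp
      then have "ennreal ((cmod (partial_coef a b y))\<^sup>2)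
          \<le> ennreal ((norm (abs_l2 g\<^sub>1))\<^sup>2 * (norm (abs_l2 (\<lambda>s. F (s, y))))\<^sup>2)"
        by (intro ennreal_leI) (simp add: power_mult_distrib mult.commute)
      then show "ennreal ((cmod (partial_coef a b y))\<^sup>2) \<le> ennreal ((norm (abs_l2 g\<^sub>1))\<^sup>2) * l2sq (\<lambda>s. F (s, y))"
        by (simp add: ennreal_mult norm_abs_l2sq[OF y])
    qed
  qed
  also have "\<dots> = ennreal ((norm (abs_l2 g\<^sub>1))\<^sup>2) * l2sq F"
    unfolding square_integrable_section(1)[OF F, symmetric]
    by (rule nn_integral_cmult) (unfold l2sq_def, measurable)
  also have "\<dots> < \<infinity>"
    using F by (simp add: ennreal_mult_less_top square_integrable_iff_nn_integral l2sq_def)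
  finally show ?thesis
    by (simp add: square_integrable_iff_nn_integral)
qed

lemma tensor_coef_iterated: "tensor_coef a\<^sub>1 b\<^sub>1 a\<^sub>2 b\<^sub>2 = coef (partial_coef a\<^sub>1 b\<^sub>1) g\<^sub>2 a\<^sub>2 b\<^sub>2"
proof -
  have "square_integrable (\<lambda>(s, t). wav g\<^sub>1 a\<^sub>1 b\<^sub>1 s * wav g\<^sub>2 a\<^sub>2 b\<^sub>2 t)"
    by (intro square_integrable_tensor square_integrable_wav g\<^sub>1 g\<^sub>2)
  from square_integrable_mult_cnj[OF F this]
  have "integrable lborel (\<lambda>z. F z * cnj (wav g\<^sub>1 a\<^sub>1 b\<^sub>1 (fst z) * wav g\<^sub>2 a\<^sub>2 b\<^sub>2 (snd z)))"
    by (simp add: case_prod_unfold)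
  then have "tensor_coef a\<^sub>1 b\<^sub>1 a\<^sub>2 b\<^sub>2
      = (LINT y|lborel. LINT s|lborel. F (s, y) * cnj (wav g\<^sub>1 a\<^sub>1 b\<^sub>1 s * wav g\<^sub>2 a\<^sub>2 b\<^sub>2 y))"
    unfolding tensor_coef_def by (simp only: integral_lborel_pair fst_conv snd_conv)
  also have "\<dots> = coef (partial_coef a\<^sub>1 b\<^sub>1) g\<^sub>2 a\<^sub>2 b\<^sub>2"
    unfolding coef_def[of "partial_coef a\<^sub>1 b\<^sub>1"] partial_coef_def coef_def[of "\<lambda>s. F (s, y)" for y]
    by (simp add: mult.assoc[symmetric])
  finally show ?thesis .
qed

text \<open>For fixed \<open>(a\<^sub>1, b\<^sub>1)\<close> the inequality for
  \<open>g\<^sub>2\<close>, applied to the partial coefficient, leaves its squared norm in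
  \<open>y\<close>. For almost every fixed \<open>y\<close> the inequality for
  \<open>g\<^sub>1\<close> then applies to the section of \<open>F\<close>.\<close>

lemma tensor_Bessel_iterated:
  assumes C\<^sub>1: "Bessel_bound g\<^sub>1 C\<^sub>1" and C\<^sub>2: "Bessel_bound g\<^sub>2 C\<^sub>2"
  shows "(\<integral>\<^sup>+a\<^sub>1. \<integral>\<^sup>+b\<^sub>1. \<integral>\<^sup>+a\<^sub>2. \<integral>\<^sup>+b\<^sub>2.
      ennreal (1 / \<bar>a\<^sub>1\<bar> ^ (DIM('a) + 1)) * (ennreal (1 / \<bar>a\<^sub>2\<bar> ^ (DIM('b) + 1)) * ennreal ((cmod (tensor_coef a\<^sub>1 b\<^sub>1 a\<^sub>2 b\<^sub>2))\<^sup>2))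
      \<partial>lborel \<partial>lborel \<partial>lborel \<partial>lborel) \<le> ennreal C\<^sub>2 * (ennreal C\<^sub>1 * l2sq F)"
proof -
  let ?w\<^sub>1 = "\<lambda>a. ennreal (1 / \<bar>a\<bar> ^ (DIM('a) + 1))" and ?w\<^sub>2 = "\<lambda>a. ennreal (1 / \<bar>a\<bar> ^ (DIM('b) + 1))"
  have "(\<integral>\<^sup>+a\<^sub>1. \<integral>\<^sup>+b\<^sub>1. \<integral>\<^sup>+a\<^sub>2. \<integral>\<^sup>+b\<^sub>2. ?w\<^sub>1 a\<^sub>1 * (?w\<^sub>2 a\<^sub>2 * ennreal ((cmod (tensor_coef a\<^sub>1 b\<^sub>1 a\<^sub>2 b\<^sub>2))\<^sup>2))
      \<partial>lborel \<partial>lborel \<partial>lborel \<partial>lborel)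
    \<le> (\<integral>\<^sup>+a\<^sub>1. \<integral>\<^sup>+b\<^sub>1. \<integral>\<^sup>+y. ennreal C\<^sub>2 * (?w\<^sub>1 a\<^sub>1 * ennreal ((cmod (partial_coef a\<^sub>1 b\<^sub>1 y))\<^sup>2)) \<partial>lborel \<partial>lborel \<partial>lborel)"
  proof (intro nn_integral_mono)
    fix a\<^sub>1 :: real and b\<^sub>1 :: 'a
    have "(\<integral>\<^sup>+a\<^sub>2. \<integral>\<^sup>+b\<^sub>2. ?w\<^sub>1 a\<^sub>1 * (?w\<^sub>2 a\<^sub>2 * ennreal ((cmod (tensor_coef a\<^sub>1 b\<^sub>1 a\<^sub>2 b\<^sub>2))\<^sup>2)) \<partial>lborel \<partial>lborel)
        = ?w\<^sub>1 a\<^sub>1 * (\<integral>\<^sup>+a\<^sub>2. \<integral>\<^sup>+b\<^sub>2. ?w\<^sub>2 a\<^sub>2 * ennreal ((cmod (tensor_coef a\<^sub>1 b\<^sub>1 a\<^sub>2 b\<^sub>2))\<^sup>2) \<partial>lborel \<partial>lborel)"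
      by (subst nn_integral_cmult[symmetric], measurable)
        (intro nn_integral_cong nn_integral_cmult, measurable)
    also have "\<dots> \<le> ?w\<^sub>1 a\<^sub>1 * (ennreal C\<^sub>2 * l2sq (partial_coef a\<^sub>1 b\<^sub>1))"
      unfolding tensor_coef_iterated
      using C\<^sub>2 partial_coef_square_integrable unfolding Bessel_bound_def by (intro mult_left_mono) auto
    also have "\<dots> = (\<integral>\<^sup>+y. ennreal C\<^sub>2 * (?w\<^sub>1 a\<^sub>1 * ennreal ((cmod (partial_coef a\<^sub>1 b\<^sub>1 y))\<^sup>2)) \<partial>lborel)"
      by (simp add: l2sq_def nn_integral_cmult mult.left_commute)
    finally show "(\<integral>\<^sup>+a\<^sub>2. \<integral>\<^sup>+b\<^sub>2. ?w\<^sub>1 a\<^sub>1 * (?w\<^sub>2 a\<^sub>2 * ennreal ((cmod (tensor_coef a\<^sub>1 b\<^sub>1 a\<^sub>2 b\<^sub>2))\<^sup>2)) \<partial>lborel \<partial>lborel)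
        \<le> (\<integral>\<^sup>+y. ennreal C\<^sub>2 * (?w\<^sub>1 a\<^sub>1 * ennreal ((cmod (partial_coef a\<^sub>1 b\<^sub>1 y))\<^sup>2)) \<partial>lborel)" .
  qed
  \<comment> \<open>The variable \<open>y\<close> moves outermost, first past
    \<open>b\<^sub>1\<close> and then past \<open>a\<^sub>1\<close>, so that for fixed
    \<open>y\<close> exactly the integral of the first Bessel inequality remains.\<close>
  also have "\<dots> = (\<integral>\<^sup>+a\<^sub>1. \<integral>\<^sup>+y. \<integral>\<^sup>+b\<^sub>1. ennreal C\<^sub>2 * (?w\<^sub>1 a\<^sub>1 * ennreal ((cmod (partial_coef a\<^sub>1 b\<^sub>1 y))\<^sup>2)) \<partial>lborel \<partial>lborel \<partial>lborel)"
    by (intro nn_integral_cong lborel_pair.Fubini'[symmetric]) measurable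
  also have "\<dots> = (\<integral>\<^sup>+y. \<integral>\<^sup>+a\<^sub>1. \<integral>\<^sup>+b\<^sub>1. ennreal C\<^sub>2 * (?w\<^sub>1 a\<^sub>1 * ennreal ((cmod (partial_coef a\<^sub>1 b\<^sub>1 y))\<^sup>2)) \<partial>lborel \<partial>lborel \<partial>lborel)"
    by (rule lborel_pair.Fubini'[symmetric]) measurable
  also have "\<dots> = (\<integral>\<^sup>+y. ennreal C\<^sub>2 * (\<integral>\<^sup>+a\<^sub>1. \<integral>\<^sup>+b\<^sub>1. ?w\<^sub>1 a\<^sub>1 * ennreal ((cmod (partial_coef a\<^sub>1 b\<^sub>1 y))\<^sup>2) \<partial>lborel \<partial>lborel) \<partial>lborel)"
    by (intro nn_integral_cong, subst nn_integral_cmult[symmetric], measurable)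
      (intro nn_integral_cong nn_integral_cmult, measurable)
  also have "\<dots> \<le> (\<integral>\<^sup>+y. ennreal C\<^sub>2 * (ennreal C\<^sub>1 * l2sq (\<lambda>s. F (s, y))) \<partial>lborel)"
  proof (rule nn_integral_mono_AE)
    show "AE y in lborel. ennreal C\<^sub>2 * (\<integral>\<^sup>+a\<^sub>1. \<integral>\<^sup>+b\<^sub>1. ?w\<^sub>1 a\<^sub>1 * ennreal ((cmod (partial_coef a\<^sub>1 b\<^sub>1 y))\<^sup>2) \<partial>lborel \<partial>lborel)
        \<le> ennreal C\<^sub>2 * (ennreal C\<^sub>1 * l2sq (\<lambda>s. F (s, y)))"
      using square_integrable_section(2)[OF F]
    proof eventually_elim
      fix y assume "square_integrable (\<lambda>s. F (s, y))"
      then show "ennreal C\<^sub>2 * (\<integral>\<^sup>+a\<^sub>1. \<integral>\<^sup>+b\<^sub>1. ?w\<^sub>1 a\<^sub>1 * ennreal ((cmod (partial_coef a\<^sub>1 b\<^sub>1 y))\<^sup>2) \<partial>lborel \<partial>lborel)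
          \<le> ennreal C\<^sub>2 * (ennreal C\<^sub>1 * l2sq (\<lambda>s. F (s, y)))"
        using C\<^sub>1 unfolding Bessel_bound_def partial_coef_def by (intro mult_left_mono) auto
    qed
  qed
  also have "\<dots> = ennreal C\<^sub>2 * (ennreal C\<^sub>1 * l2sq F)"
  proof -
    have [measurable]: "(\<lambda>y. l2sq (\<lambda>s. F (s, y))) \<in> borel_measurable borel"
      unfolding l2sq_def by measurable
    show ?thesis
      unfolding square_integrable_section(1)[OF F, symmetric] by (simp add: nn_integral_cmult)
  qed
  finally show ?thesis .
qed

lemma cinner_pi_aff_tensor:
  "cinner (abs_l2 F) (pi_aff_tensor x (abs_l2 g\<^sub>1) (abs_l2 g\<^sub>2))
    = tensor_coef (fst (snd x)) (fst (fst x)) (snd (snd x)) (snd (fst x))"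
proof -
  have "pi_aff_tensor x (abs_l2 g\<^sub>1) (abs_l2 g\<^sub>2)
      = abs_l2 (\<lambda>(s, t). wav g\<^sub>1 (fst (snd x)) (fst (fst x)) s * wav g\<^sub>2 (snd (snd x)) (snd (fst x)) t)"
    unfolding pi_aff_tensor_def case_prod_unfold
    by (simp add: pi_aff_abs g\<^sub>1 g\<^sub>2 tensor.abs_eq l2_eq_refl square_integrable_wav case_prod_unfold)
  then show ?thesis
    using square_integrable_tensor[OF square_integrable_wav[OF g\<^sub>1] square_integrable_wav[OF g\<^sub>2]]
    by (simp add: cinner_abs F tensor_coef_def case_prod_unfold)
qed

lemma cinner_pi_aff_tensor_measurable:
  "(\<lambda>x. cinner (abs_l2 F) (pi_aff_tensor x (abs_l2 g\<^sub>1) (abs_l2 g\<^sub>2))) \<in> borel_measurable borel"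
  unfolding cinner_pi_aff_tensor borel_prod[symmetric] by measurable

text \<open>Splitting the product space gives both translations outside and both dilations inside,
  whereas the iterated estimate groups each translation with its dilation; Tonelli's theorem
  reorders the four integrals.\<close>

lemma tensor_Bessel:
  assumes C\<^sub>1: "Bessel_bound g\<^sub>1 C\<^sub>1" and C\<^sub>2: "Bessel_bound g\<^sub>2 C\<^sub>2"
  shows "(\<integral>\<^sup>+x. ennreal ((cmod (cinner (abs_l2 F) (pi_aff_tensor x (abs_l2 g\<^sub>1) (abs_l2 g\<^sub>2))))\<^sup>2) \<partial>aff_measure)
    \<le> ennreal C\<^sub>2 * (ennreal C\<^sub>1 * l2sq F)"
proof -
  define \<Phi> where "\<Phi> a\<^sub>1 b\<^sub>1 a\<^sub>2 b\<^sub>2 = ennreal (1 / \<bar>a\<^sub>1\<bar> ^ (DIM('a) + 1)) *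
    (ennreal (1 / \<bar>a\<^sub>2\<bar> ^ (DIM('b) + 1)) * ennreal ((cmod (tensor_coef a\<^sub>1 b\<^sub>1 a\<^sub>2 b\<^sub>2))\<^sup>2))" for a\<^sub>1 b\<^sub>1 a\<^sub>2 b\<^sub>2
  have \<Phi>_meas [measurable (raw)]: "(\<lambda>x. \<Phi> (f\<^sub>1 x) (f\<^sub>2 x) (f\<^sub>3 x) (f\<^sub>4 x)) \<in> borel_measurable M"
    if [measurable]: "f\<^sub>1 \<in> borel_measurable M" "f\<^sub>2 \<in> borel_measurable M" "f\<^sub>3 \<in> borel_measurable M" "f\<^sub>4 \<in> borel_measurable M"
    for M :: "'m measure" and f\<^sub>1 f\<^sub>2 f\<^sub>3 f\<^sub>4
    unfolding \<Phi>_def by measurable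
  have m1: "(\<lambda>x. \<Phi> (fst (snd x)) (fst (fst x)) (snd (snd x)) (snd (fst x))) \<in> borel_measurable borel"
    unfolding \<Phi>_def borel_prod[symmetric] by measurable
  have "(\<integral>\<^sup>+x. ennreal ((cmod (cinner (abs_l2 F) (pi_aff_tensor x (abs_l2 g\<^sub>1) (abs_l2 g\<^sub>2))))\<^sup>2) \<partial>aff_measure)
      = (\<integral>\<^sup>+x. \<Phi> (fst (snd x)) (fst (fst x)) (snd (snd x)) (snd (fst x)) \<partial>lborel)"
  proof -
    have "ennreal (1 / \<bar>s\<bar> ^ (DIM('a) + 1) * (1 / \<bar>t\<bar> ^ (DIM('b) + 1)))
        = ennreal (1 / \<bar>s\<bar> ^ (DIM('a) + 1)) * ennreal (1 / \<bar>t\<bar> ^ (DIM('b) + 1))" for s t :: real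
      by (rule ennreal_mult) simp_all
    moreover have "(\<lambda>x. ennreal ((cmod (cinner (abs_l2 F) (pi_aff_tensor x (abs_l2 g\<^sub>1) (abs_l2 g\<^sub>2))))\<^sup>2))
        \<in> borel_measurable borel"
      by (rule measurable_compose[OF cinner_pi_aff_tensor_measurable]) measurable
    ultimately show ?thesis
      by (simp only: nn_integral_aff_measure \<Phi>_def cinner_pi_aff_tensor mult.assoc)
  qed
  also have "\<dots> = (\<integral>\<^sup>+b. \<integral>\<^sup>+a. \<Phi> (fst a) (fst b) (snd a) (snd b) \<partial>lborel \<partial>lborel)"
    by (subst nn_integral_lborel_pair[OF m1]) simp
  also have "\<dots> = (\<integral>\<^sup>+b. \<integral>\<^sup>+a\<^sub>1. \<integral>\<^sup>+a\<^sub>2. \<Phi> a\<^sub>1 (fst b) a\<^sub>2 (snd b) \<partial>lborel \<partial>lborel \<partial>lborel)"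
  proof (rule nn_integral_cong)
    fix b :: "'a \<times> 'b"
    have "(\<lambda>a. \<Phi> (fst a) (fst b) (snd a) (snd b)) \<in> borel_measurable borel"
      unfolding \<Phi>_def borel_prod[symmetric] by measurable
    from nn_integral_lborel_pair[OF this]
    show "(\<integral>\<^sup>+a. \<Phi> (fst a) (fst b) (snd a) (snd b) \<partial>lborel) = (\<integral>\<^sup>+a\<^sub>1. \<integral>\<^sup>+a\<^sub>2. \<Phi> a\<^sub>1 (fst b) a\<^sub>2 (snd b) \<partial>lborel \<partial>lborel)"
      by simp
  qed
  also have "\<dots> = (\<integral>\<^sup>+b\<^sub>1. \<integral>\<^sup>+b\<^sub>2. \<integral>\<^sup>+a\<^sub>1. \<integral>\<^sup>+a\<^sub>2. \<Phi> a\<^sub>1 b\<^sub>1 a\<^sub>2 b\<^sub>2 \<partial>lborel \<partial>lborel \<partial>lborel \<partial>lborel)"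
  proof -
    have "(\<lambda>b. \<integral>\<^sup>+a\<^sub>1. \<integral>\<^sup>+a\<^sub>2. \<Phi> a\<^sub>1 (fst b) a\<^sub>2 (snd b) \<partial>lborel \<partial>lborel) \<in> borel_measurable borel"
      unfolding \<Phi>_def borel_prod[symmetric] by measurable
    from nn_integral_lborel_pair[OF this] show ?thesis by simp
  qed
  also have "\<dots> = (\<integral>\<^sup>+b\<^sub>1. \<integral>\<^sup>+a\<^sub>1. \<integral>\<^sup>+b\<^sub>2. \<integral>\<^sup>+a\<^sub>2. \<Phi> a\<^sub>1 b\<^sub>1 a\<^sub>2 b\<^sub>2 \<partial>lborel \<partial>lborel \<partial>lborel \<partial>lborel)"
    unfolding \<Phi>_def by (intro nn_integral_cong lborel_pair.Fubini') measurable
  also have "\<dots> = (\<integral>\<^sup>+a\<^sub>1. \<integral>\<^sup>+b\<^sub>1. \<integral>\<^sup>+b\<^sub>2. \<integral>\<^sup>+a\<^sub>2. \<Phi> a\<^sub>1 b\<^sub>1 a\<^sub>2 b\<^sub>2 \<partial>lborel \<partial>lborel \<partial>lborel \<partial>lborel)"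
    unfolding \<Phi>_def by (intro lborel_pair.Fubini') measurable
  also have "\<dots> = (\<integral>\<^sup>+a\<^sub>1. \<integral>\<^sup>+b\<^sub>1. \<integral>\<^sup>+a\<^sub>2. \<integral>\<^sup>+b\<^sub>2. \<Phi> a\<^sub>1 b\<^sub>1 a\<^sub>2 b\<^sub>2 \<partial>lborel \<partial>lborel \<partial>lborel \<partial>lborel)"
    unfolding \<Phi>_def by (intro nn_integral_cong lborel_pair.Fubini') measurable
  also have "\<dots> \<le> ennreal C\<^sub>2 * (ennreal C\<^sub>1 * l2sq F)"
    unfolding \<Phi>_def by (rule tensor_Bessel_iterated[OF C\<^sub>1 C\<^sub>2])
  finally show ?thesis .
qed

end

section \<open>Norm bounds and the wavelet multipliers\<close>

lemma norm_tensor: "norm (f \<otimes>\<^sub>2 g) = norm f * norm g"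
proof -
  have "complex_of_real ((norm (f \<otimes>\<^sub>2 g))\<^sup>2) = complex_of_real ((norm f * norm g)\<^sup>2)"
    unfolding cinner_self[symmetric] cinner_tensor by (simp add: cinner_self power_mult_distrib)
  then have "(norm (f \<otimes>\<^sub>2 g))\<^sup>2 = (norm f * norm g)\<^sup>2"
    using of_real_eq_iff by blast
  then show ?thesis by (simp add: power2_eq_iff_nonneg)
qed

lemma norm_pi_aff: "norm (pi_aff b a f) \<le> norm f"
proof -
  obtain g where "square_integrable g" "f = abs_l2 g" by (rule l2_representative)
  then show ?thesis by (simp add: pi_aff_abs norm_abs_wav)
qed

lemma norm_pi_aff_tensor: "norm (pi_aff_tensor x f g) \<le> norm f * norm g"
  unfolding pi_aff_tensor_def case_prod_unfold norm_tensor
  by (intro mult_mono norm_pi_aff) auto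

lemma admissible_tensor_Bessel_family:
  fixes \<phi>\<^sub>1 \<phi>\<^sub>2 :: "(real ^ 'd) l2"
  assumes "admissible_wavelet \<phi>\<^sub>1" "admissible_wavelet \<phi>\<^sub>2"
  shows "\<exists>C\<ge>0. \<forall>f. (\<lambda>x. cinner f (pi_aff_tensor x \<phi>\<^sub>1 \<phi>\<^sub>2)) \<in> borel_measurable aff_measure \<and>
    (\<integral>\<^sup>+x. ennreal ((cmod (cinner f (pi_aff_tensor x \<phi>\<^sub>1 \<phi>\<^sub>2)))\<^sup>2) \<partial>aff_measure) \<le> ennreal (C * (norm f)\<^sup>2)"
proof -
  obtain g\<^sub>1 where g\<^sub>1: "square_integrable g\<^sub>1" "\<phi>\<^sub>1 = abs_l2 g\<^sub>1" by (rule l2_representative)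
  obtain g\<^sub>2 where g\<^sub>2: "square_integrable g\<^sub>2" "\<phi>\<^sub>2 = abs_l2 g\<^sub>2" by (rule l2_representative)
  obtain C\<^sub>1 where C\<^sub>1: "Bessel_bound g\<^sub>1 C\<^sub>1"
    using admissible_wavelet_Bessel_bound[OF g\<^sub>1(1)] assms(1) g\<^sub>1(2) by blast
  obtain C\<^sub>2 where C\<^sub>2: "Bessel_bound g\<^sub>2 C\<^sub>2"
    using admissible_wavelet_Bessel_bound[OF g\<^sub>2(1)] assms(2) g\<^sub>2(2) by blast
  show ?thesis
  \<comment> \<open>\<open>Bessel_bound\<close> leaves the sign of its constant open. Since
    \<open>ennreal\<close> truncates at 0, passing to \<open>max 0\<close> keeps both bounds and
    makes the product of the constants nonnegative.\<close>
  proof (intro exI[of _ "max 0 C\<^sub>2 * max 0 C\<^sub>1"] conjI allI)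
    fix f :: "((real ^ 'd) \<times> (real ^ 'd)) l2"
    obtain F where F: "square_integrable F" "f = abs_l2 F" by (rule l2_representative)
    show "(\<lambda>x. cinner f (pi_aff_tensor x \<phi>\<^sub>1 \<phi>\<^sub>2)) \<in> borel_measurable aff_measure"
      unfolding F(2) g\<^sub>1(2) g\<^sub>2(2)
      by (rule borel_measurable_aff_measure[OF cinner_pi_aff_tensor_measurable[OF F(1) g\<^sub>1(1) g\<^sub>2(1)]])
    have "(\<integral>\<^sup>+x. ennreal ((cmod (cinner f (pi_aff_tensor x \<phi>\<^sub>1 \<phi>\<^sub>2)))\<^sup>2) \<partial>aff_measure)
        \<le> ennreal C\<^sub>2 * (ennreal C\<^sub>1 * ennreal ((norm f)\<^sup>2))"
      unfolding F(2) g\<^sub>1(2) g\<^sub>2(2) norm_abs_l2sq[OF F(1)]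
      by (rule tensor_Bessel[OF F(1) g\<^sub>1(1) g\<^sub>2(1) C\<^sub>1 C\<^sub>2])
    also have "\<dots> = ennreal (max 0 C\<^sub>2) * (ennreal (max 0 C\<^sub>1) * ennreal ((norm f)\<^sup>2))"
    proof -
      have "ennreal (max 0 c) = ennreal c" for c by (simp add: max_def ennreal_neg)
      then show ?thesis by (simp only:)
    qed
    also have "\<dots> = ennreal (max 0 C\<^sub>2 * max 0 C\<^sub>1 * (norm f)\<^sup>2)"
      by (simp only: ennreal_mult max.cobounded1 zero_le_power2 mult_nonneg_nonneg mult.assoc)
    finally show "(\<integral>\<^sup>+x. ennreal ((cmod (cinner f (pi_aff_tensor x \<phi>\<^sub>1 \<phi>\<^sub>2)))\<^sup>2) \<partial>aff_measure)
        \<le> ennreal (max 0 C\<^sub>2 * max 0 C\<^sub>1 * (norm f)\<^sup>2)" .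
  qed simp
qed

theorem proposition6p5:
  fixes \<phi>\<^sub>1 \<phi>\<^sub>2 \<psi>\<^sub>1 \<psi>\<^sub>2 :: "(real ^ 'd) l2"
    and m :: "((real ^ 'd) \<times> (real ^ 'd)) \<times> (real \<times> real) \<Rightarrow> complex"
    and p :: real
  assumes "admissible_wavelet \<phi>\<^sub>1" "admissible_wavelet \<phi>\<^sub>2"
    and "admissible_wavelet \<psi>\<^sub>1" "admissible_wavelet \<psi>\<^sub>2"
    and "norm \<phi>\<^sub>1 = 1" "norm \<phi>\<^sub>2 = 1" "norm \<psi>\<^sub>1 = 1" "norm \<psi>\<^sub>2 = 1"
    and "1 \<le> p"
    and "m \<in> borel_measurable aff_measure"
    and "integrable aff_measure (\<lambda>x. cmod (m x) powr p)"
  shows "(\<exists>!M. weak_multiplier m \<phi>\<^sub>1 \<phi>\<^sub>2 \<psi>\<^sub>1 \<psi>\<^sub>2 M) \<and>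
         (\<forall>M. weak_multiplier m \<phi>\<^sub>1 \<phi>\<^sub>2 \<psi>\<^sub>1 \<psi>\<^sub>2 M \<longrightarrow> M \<in> schatten_class p)"
proof -
  let ?e = "\<lambda>x. pi_aff_tensor x \<phi>\<^sub>1 \<phi>\<^sub>2" and ?h = "\<lambda>x. pi_aff_tensor x \<psi>\<^sub>1 \<psi>\<^sub>2"
  obtain C where C: "0 \<le> C" "\<And>f. (\<lambda>x. cinner f (?e x)) \<in> borel_measurable aff_measure"
    "\<And>f. (\<integral>\<^sup>+x. ennreal ((cmod (cinner f (?e x)))\<^sup>2) \<partial>aff_measure) \<le> ennreal (C * (norm f)\<^sup>2)"
    using admissible_tensor_Bessel_family[OF assms(1,2)] by blast
  obtain D where D: "0 \<le> D" "\<And>f. (\<lambda>x. cinner f (?h x)) \<in> borel_measurable aff_measure"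
    "\<And>f. (\<integral>\<^sup>+x. ennreal ((cmod (cinner f (?h x)))\<^sup>2) \<partial>aff_measure) \<le> ennreal (D * (norm f)\<^sup>2)"
    using admissible_tensor_Bessel_family[OF assms(3,4)] by blast
  \<comment> \<open>One constant has to serve both families, and the summand 1 makes it strictly
    positive, as \<open>Bessel_multiplier\<close> demands.\<close>
  have CD: "ennreal (C * (norm f)\<^sup>2) \<le> ennreal ((C + D + 1) * (norm f)\<^sup>2)"
    "ennreal (D * (norm f)\<^sup>2) \<le> ennreal ((C + D + 1) * (norm f)\<^sup>2)" for f :: "((real ^ 'd) \<times> (real ^ 'd)) l2"
    using C(1) D(1) by (intro ennreal_leI mult_right_mono; simp)+
  interpret Bessel_multiplier aff_measure ?e ?h "C + D + 1" m p
  proof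
    show "norm (?e x) \<le> 1" "norm (?h x) \<le> 1" for x
      using norm_pi_aff_tensor[of x \<phi>\<^sub>1 \<phi>\<^sub>2] norm_pi_aff_tensor[of x \<psi>\<^sub>1 \<psi>\<^sub>2] assms(5-8) by simp_all
    show "(\<integral>\<^sup>+x. ennreal ((cmod (cinner f (?e x)))\<^sup>2) \<partial>aff_measure) \<le> ennreal ((C + D + 1) * (norm f)\<^sup>2)" for f
      by (rule order_trans[OF C(3) CD(1)])
    show "(\<integral>\<^sup>+x. ennreal ((cmod (cinner f (?h x)))\<^sup>2) \<partial>aff_measure) \<le> ennreal ((C + D + 1) * (norm f)\<^sup>2)" for f
      by (rule order_trans[OF D(3) CD(2)])
  qed (use C D assms in simp_all)
  have "weak_multiplier m \<phi>\<^sub>1 \<phi>\<^sub>2 \<psi>\<^sub>1 \<psi>\<^sub>2 M \<longleftrightarrow> (\<forall>f g. has_bochner_integral aff_measure (B f g) (cinner (M f) g))" for M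
    by (simp add: weak_multiplier_def B_def[abs_def])
  with multiplier_schatten show ?thesis by simp
qed

end
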